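(* Let $X$ be a metrizable space, $A\subseteq X$ a closed subset, and $G$ an abelian group. Then $$\eta_{G}^{\infty}(X,A)=\eta_{G}(\beta X\setminus X,\beta A\setminus A)$$ and $$\eta^{G}_{\infty}(X,A)=\eta^{G}(\beta X\setminus X,\beta A\setminus A).$$
   Context: Conventions. Normal spaces are $T_1$ (hence Hausdorff). A closed pair $(X,A)$ is a space $X$ with a closed subset $A$; a single space $X$ is identified with $(X,\emptyset)$. $\beta$ denotes Stone–Čech compactification; for $A$ closed in a metrizable space $X$, $\beta A$ is identified with the closure of $A$ in $\beta X$, so $\beta A\setminus A$ is closed in $\beta X\setminus X$. An indexed family $\alpha=\{\alpha_v\}_{v\in(V_\alpha,V_\alpha^A)}$ of subsets of $X$ is a function $v\mapsto\alpha_v$ on an index set $V_\alpha$ together with a distinguished subset $V_\alpha^A\subseteq V_\alpha$; it is finite if $V_\alpha$ is finite. Border covers. A border cover of a closed pair $(X,A)$ with $X$ normal is a finite indexed family $\alpha=\{\alpha_v\}_{v\in(V_\alpha,V_\alpha^A)}$ of open subsets of $X$ for which there is a compact $K_\alpha\subseteq X$ with $X\setminus K_\alpha=\bigcup_{v\in V_\alpha}\alpha_v$ and $A\setminus K_\alpha\subseteq\bigcup_{v\in V_\alpha^A}\alpha_v$. The set of border covers is $\mathrm{cov}_\infty(X,A)$, directed by $\alpha\le\beta$ iff there is a refinement projection $p:V_\beta\to V_\alpha$ with $p(V_\beta^A)\subseteq V_\alpha^A$ and $\beta_v\subseteq\alpha_{p(v)}$ for all $v\in V_\beta$. Border groups.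 For $\alpha\in\mathrm{cov}_\infty(X,A)$ let $X_\alpha$ be the nerve: its simplexes are the nonempty finite $s\subseteq V_\alpha$ with $\mathrm{Car}_\alpha(s)=\bigcap_{v\in s}\alpha_v\neq\emptyset$; $A_\alpha$ is the subcomplex of simplexes $s\subseteq V_\alpha^A$ with $\mathrm{Car}_\alpha(s)\cap A\neq\emptyset$. Refinement projections induce simplicial maps $(X_\beta,A_\beta)\to(X_\alpha,A_\alpha)$, any two contiguous, hence well-defined homomorphisms in simplicial (co)homology. Put $\check H_n^\infty(X,A;G)=\varprojlim_{\alpha}H_n(X_\alpha,A_\alpha;G)$ and $\hat H^n_\infty(X,A;G)=\varinjlim_{\alpha}H^n(X_\alpha,A_\alpha;G)$ over $\mathrm{cov}_\infty(X,A)$. Čech groups based on finite open covers. For a closed pair $(Y,B)$, $\check H_n^f(Y,B;G)$ and $\hat H^n_f(Y,B;G)$ are defined in the same way but over all finite open covers of $(Y,B)$, i.e. finite families $\{\alpha_v\}_{v\in(V_\alpha,V_\alpha^B)}$ of open subsets of $Y$ with $\bigcup_{v\in V_\alpha}\alpha_v=Y$ and $B\subseteq\bigcup_{v\in V_\alpha^B}\alpha_v$. Coefficients of cyclicity. The border cohomological coefficient of cyclicity $\eta_G^\infty(X,A)$ equals the nonnegative integer $n$ if $\hat H^m_\infty(X,A;G)=0$ for all $m>n$ and $\hat H^n_\infty(X,A;G)\ne0$; it equals $+\infty$ if for every $m$ there is $n\ge m$ with $\hat H^n_\infty(X,A;G)\neq0$. The border homological coefficient of cyclicity $\eta^G_\infty(X,A)$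 is defined in the same way with $\check H_n^\infty(X,A;G)$. The cohomological coefficient of cyclicity $\eta_G(Y,B)$ and the homological coefficient of cyclicity $\eta^G(Y,B)$ of a closed pair $(Y,B)$ are defined in the same way with $\hat H^n_f(Y,B;G)$ and $\check H_n^f(Y,B;G)$, respectively. If all the groups in question vanish, the same convention (e.g. the value $0$) is used for all four coefficients. *)

theory Defs
  imports "HOL-Analysis.Analysis" "HOL-Algebra.Product_Groups" "HOL-Library.Poly_Mapping"
begin

section \<open>Simplicial homology and cohomology with coefficients\<close>

text \<open>A simplicial complex is given by its set of simplexes. Simplicial (co)homology is that of the
  ordered chain complex: the \<open>n\<close>-chains are generated by all \<open>(n+1)\<close>-tuples of vertices, repetitions
  allowed, whose entries span a simplex. The coefficient group is the type \<open>'g\<close>.\<close>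

definition ordered_simplices :: "nat \<Rightarrow> 'v set set \<Rightarrow> 'v list set"
  where "ordered_simplices n K = {xs. length xs = Suc n \<and> set xs \<in> K}"

definition face :: "nat \<Rightarrow> 'v list \<Rightarrow> 'v list"
  where "face i xs = take i xs @ drop (Suc i) xs"

definition alt_sign :: "nat \<Rightarrow> 'g::ab_group_add \<Rightarrow> 'g"
  where "alt_sign i g = (if even i then g else - g)"

subsection \<open>Homology\<close>

definition chains :: "nat \<Rightarrow> 'v set set \<Rightarrow> ('v list \<Rightarrow>\<^sub>0 'g::ab_group_add) set"
  where "chains n K = {c. Poly_Mapping.keys c \<subseteq> ordered_simplices n K}"

definition boundary :: "nat \<Rightarrow> ('v list \<Rightarrow>\<^sub>0 'g::ab_group_add) \<Rightarrow> ('v list \<Rightarrow>\<^sub>0 'g)"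
  where "boundary n c =
    (if n = 0 then 0
     else \<Sum>xs\<in>Poly_Mapping.keys c. \<Sum>i\<le>n.
            Poly_Mapping.single (face i xs) (alt_sign i (Poly_Mapping.lookup c xs)))"

definition chain_map_of :: "('v \<Rightarrow> 'w) \<Rightarrow> ('v list \<Rightarrow>\<^sub>0 'g::ab_group_add) \<Rightarrow> ('w list \<Rightarrow>\<^sub>0 'g)"
  where "chain_map_of p c =
    (\<Sum>xs\<in>Poly_Mapping.keys c. Poly_Mapping.single (map p xs) (Poly_Mapping.lookup c xs))"

text \<open>As for singular homology in HOL-Homology, the relative homology group is
  the group of relative cycles modulo that of relative boundaries.\<close>

definition rel_cycle_group ::
    "nat \<Rightarrow> 'v set set \<Rightarrow> 'v set set \<Rightarrow> ('v list \<Rightarrow>\<^sub>0 'g::ab_group_add) monoid"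
  where "rel_cycle_group n K L =
    \<lparr>carrier = {c \<in> chains n K. boundary n c \<in> chains (n - 1) L}, monoid.mult = (+), one = 0\<rparr>"

definition rel_boundaries ::
    "nat \<Rightarrow> 'v set set \<Rightarrow> 'v set set \<Rightarrow> ('v list \<Rightarrow>\<^sub>0 'g::ab_group_add) set"
  where "rel_boundaries n K L = {boundary (Suc n) d + e | d e. d \<in> chains (Suc n) K \<and> e \<in> chains n L}"

definition simp_homology ::
    "nat \<Rightarrow> 'v set set \<Rightarrow> 'v set set \<Rightarrow> ('v list \<Rightarrow>\<^sub>0 'g::ab_group_add) set monoid"
  where "simp_homology n K L = rel_cycle_group n K L Mod rel_boundaries n K L"

text \<open>The homomorphism into the homology of the target pair \<open>(K, L)\<close> induced by a vertex map \<open>p\<close>: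
  it sends the coset of \<open>c\<close> to the coset of \<open>p\<^sub>#(c)\<close>.\<close>

definition homology_induced ::
    "nat \<Rightarrow> 'w set set \<Rightarrow> 'w set set \<Rightarrow> ('v \<Rightarrow> 'w) \<Rightarrow>
     ('v list \<Rightarrow>\<^sub>0 'g::ab_group_add) set \<Rightarrow> ('w list \<Rightarrow>\<^sub>0 'g) set"
  where "homology_induced n K L p S =
    rel_boundaries n K L <#>\<^bsub>rel_cycle_group n K L\<^esub> (chain_map_of p ` S)"

subsection \<open>Cohomology\<close>

text \<open>An \<open>n\<close>-cochain is a function on the ordered \<open>n\<close>-simplexes of \<open>K\<close>, extended by \<open>0\<close> to all lists;
  it is relative if it vanishes on the simplexes of \<open>L\<close>.\<close>

definition rel_cochains :: "nat \<Rightarrow> 'v set set \<Rightarrow> 'v set set \<Rightarrow> ('v list \<Rightarrow> 'g::ab_group_add) set"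
  where "rel_cochains n K L =
    {f. \<forall>xs. xs \<notin> ordered_simplices n K - ordered_simplices n L \<longrightarrow> f xs = 0}"

definition coboundary ::
    "nat \<Rightarrow> 'v set set \<Rightarrow> ('v list \<Rightarrow> 'g::ab_group_add) \<Rightarrow> ('v list \<Rightarrow> 'g)"
  where "coboundary n K f =
    (\<lambda>xs. if xs \<in> ordered_simplices (Suc n) K then \<Sum>i\<le>Suc n. alt_sign i (f (face i xs)) else 0)"

definition rel_cocycle_group ::
    "nat \<Rightarrow> 'v set set \<Rightarrow> 'v set set \<Rightarrow> ('v list \<Rightarrow> 'g::ab_group_add) monoid"
  where "rel_cocycle_group n K L =
    \<lparr>carrier = {f \<in> rel_cochains n K L. coboundary n K f = (\<lambda>_. 0)},
     monoid.mult = (\<lambda>f g xs. f xs + g xs), one = (\<lambda>_. 0)\<rparr>"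

definition rel_coboundaries ::
    "nat \<Rightarrow> 'v set set \<Rightarrow> 'v set set \<Rightarrow> ('v list \<Rightarrow> 'g::ab_group_add) set"
  where "rel_coboundaries n K L =
    (case n of 0 \<Rightarrow> {\<lambda>_. 0} | Suc m \<Rightarrow> coboundary m K ` rel_cochains m K L)"

definition simp_cohomology ::
    "nat \<Rightarrow> 'v set set \<Rightarrow> 'v set set \<Rightarrow> ('v list \<Rightarrow> 'g::ab_group_add) set monoid"
  where "simp_cohomology n K L = rel_cocycle_group n K L Mod rel_coboundaries n K L"

text \<open>A vertex map \<open>p\<close> defined on the pair \<open>(K, L)\<close> induces a homomorphism into the cohomology
  of \<open>(K, L)\<close>: it sends the coset of \<open>f\<close> to the coset of \<open>p\<^sup>#(f)\<close>.\<close>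

definition cochain_map_of ::
    "nat \<Rightarrow> 'v set set \<Rightarrow> ('v \<Rightarrow> 'w) \<Rightarrow> ('w list \<Rightarrow> 'g::ab_group_add) \<Rightarrow> ('v list \<Rightarrow> 'g)"
  where "cochain_map_of n K p f = (\<lambda>xs. if xs \<in> ordered_simplices n K then f (map p xs) else 0)"

definition cohomology_induced ::
    "nat \<Rightarrow> 'v set set \<Rightarrow> 'v set set \<Rightarrow> ('v \<Rightarrow> 'w) \<Rightarrow>
     ('w list \<Rightarrow> 'g::ab_group_add) set \<Rightarrow> ('v list \<Rightarrow> 'g) set"
  where "cohomology_induced n K L p S =
    rel_coboundaries n K L <#>\<^bsub>rel_cocycle_group n K L\<^esub> (cochain_map_of n K p ` S)"


section \<open>Inverse and direct limits of groups\<close>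

text \<open>For an inverse system, \<open>\<phi> i j\<close> is the homomorphism \<open>H j \<rightarrow> H i\<close>, where \<open>i \<preceq> j\<close>.\<close>

definition inverse_limit ::
    "'i set \<Rightarrow> ('i \<Rightarrow> 'i \<Rightarrow> bool) \<Rightarrow> ('i \<Rightarrow> 'h monoid) \<Rightarrow> ('i \<Rightarrow> 'i \<Rightarrow> 'h \<Rightarrow> 'h) \<Rightarrow> ('i \<Rightarrow> 'h) monoid"
  where "inverse_limit I leq H \<phi> =
    (product_group I H)
      \<lparr>carrier := {x \<in> carrier (product_group I H). \<forall>i\<in>I. \<forall>j\<in>I. leq i j \<longrightarrow> \<phi> i j (x j) = x i}\<rparr>"

text \<open>For a direct system, \<open>\<phi> i j\<close> is the homomorphism \<open>H i \<rightarrow> H j\<close>, where \<open>i \<preceq> j\<close>. The limit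
  consists of the classes of the disjoint union of the \<open>H i\<close> under eventual equality.\<close>

definition direct_limit_rel ::
    "'i set \<Rightarrow> ('i \<Rightarrow> 'i \<Rightarrow> bool) \<Rightarrow> ('i \<Rightarrow> 'h monoid) \<Rightarrow> ('i \<Rightarrow> 'i \<Rightarrow> 'h \<Rightarrow> 'h) \<Rightarrow>
     (('i \<times> 'h) \<times> ('i \<times> 'h)) set"
  where "direct_limit_rel I leq H \<phi> =
    {((i, x), (j, y)) | i x j y.
       i \<in> I \<and> x \<in> carrier (H i) \<and> j \<in> I \<and> y \<in> carrier (H j) \<and>
       (\<exists>k\<in>I. leq i k \<and> leq j k \<and> \<phi> i k x = \<phi> j k y)}"

definition direct_limit ::
    "'i set \<Rightarrow> ('i \<Rightarrow> 'i \<Rightarrow> bool) \<Rightarrow> ('i \<Rightarrow> 'h monoid) \<Rightarrow> ('i \<Rightarrow> 'i \<Rightarrow> 'h \<Rightarrow> 'h) \<Rightarrow> ('i \<times> 'h) set monoid"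
  where "direct_limit I leq H \<phi> =
    \<lparr>carrier = (SIGMA i:I. carrier (H i)) // direct_limit_rel I leq H \<phi>,
     monoid.mult = (\<lambda>P Q. direct_limit_rel I leq H \<phi> ``
       {(k, \<phi> i k x \<otimes>\<^bsub>H k\<^esub> \<phi> j k y) | i x j y k.
          (i, x) \<in> P \<and> (j, y) \<in> Q \<and> k \<in> I \<and> leq i k \<and> leq j k}),
     one = direct_limit_rel I leq H \<phi> `` {(i, \<one>\<^bsub>H i\<^esub>) | i. i \<in> I}\<rparr>"


section \<open>Indexed families, nerves and refinement\<close>

text \<open>An indexed family with its index set and the distinguished subset of the index set.\<close>

datatype ('v, 'a) family =
  Family (verts: "'v set") (dverts: "'v set") (part: "'v \<Rightarrow> 'a set")

definition finite_open_family :: "'a topology \<Rightarrow> ('v, 'a) family \<Rightarrow> bool"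
  where "finite_open_family X \<alpha> \<longleftrightarrow>
    finite (verts \<alpha>) \<and> dverts \<alpha> \<subseteq> verts \<alpha> \<and> part \<alpha> \<in> extensional (verts \<alpha>) \<and>
    (\<forall>v\<in>verts \<alpha>. openin X (part \<alpha> v))"

definition carrier_of :: "('v, 'a) family \<Rightarrow> 'v set \<Rightarrow> 'a set"
  where "carrier_of \<alpha> s = (\<Inter>v\<in>s. part \<alpha> v)"

definition nerve :: "('v, 'a) family \<Rightarrow> 'v set set"
  where "nerve \<alpha> = {s. finite s \<and> s \<noteq> {} \<and> s \<subseteq> verts \<alpha> \<and> carrier_of \<alpha> s \<noteq> {}}"

definition subnerve :: "'a set \<Rightarrow> ('v, 'a) family \<Rightarrow> 'v set set"
  where "subnerve A \<alpha> = {s. finite s \<and> s \<noteq> {} \<and> s \<subseteq> dverts \<alpha> \<and> carrier_of \<alpha> s \<inter> A \<noteq> {}}"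

definition refinement_projection ::
    "('v, 'a) family \<Rightarrow> ('v, 'a) family \<Rightarrow> ('v \<Rightarrow> 'v) \<Rightarrow> bool"
  where "refinement_projection \<alpha> \<beta> p \<longleftrightarrow>
    p ` verts \<beta> \<subseteq> verts \<alpha> \<and> p ` dverts \<beta> \<subseteq> dverts \<alpha> \<and> (\<forall>v\<in>verts \<beta>. part \<beta> v \<subseteq> part \<alpha> (p v))"

definition refined_by :: "('v, 'a) family \<Rightarrow> ('v, 'a) family \<Rightarrow> bool"
  where "refined_by \<alpha> \<beta> \<longleftrightarrow> (\<exists>p. refinement_projection \<alpha> \<beta> p)"

text \<open>Any two refinement projections are contiguous, so the choice of one does not matter.\<close>

definition some_projection :: "('v, 'a) family \<Rightarrow> ('v, 'a) family \<Rightarrow> ('v \<Rightarrow> 'v)"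
  where "some_projection \<alpha> \<beta> = (SOME p. refinement_projection \<alpha> \<beta> p)"

definition cech_homology ::
    "('v, 'a) family set \<Rightarrow> 'a set \<Rightarrow> nat \<Rightarrow>
     (('v, 'a) family \<Rightarrow> ('v list \<Rightarrow>\<^sub>0 'g::ab_group_add) set) monoid"
  where "cech_homology \<C> A n =
    inverse_limit \<C> refined_by (\<lambda>\<alpha>. simp_homology n (nerve \<alpha>) (subnerve A \<alpha>))
      (\<lambda>\<alpha> \<beta>. homology_induced n (nerve \<alpha>) (subnerve A \<alpha>) (some_projection \<alpha> \<beta>))"

definition cech_cohomology ::
    "('v, 'a) family set \<Rightarrow> 'a set \<Rightarrow> nat \<Rightarrow>
     (('v, 'a) family \<times> ('v list \<Rightarrow> 'g::ab_group_add) set) set monoid"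
  where "cech_cohomology \<C> A n =
    direct_limit \<C> refined_by (\<lambda>\<alpha>. simp_cohomology n (nerve \<alpha>) (subnerve A \<alpha>))
      (\<lambda>\<alpha> \<beta>. cohomology_induced n (nerve \<beta>) (subnerve A \<beta>) (some_projection \<alpha> \<beta>))"


section \<open>Border covers and finite open covers of a closed pair\<close>

text \<open>Every finite family can be reindexed by a finite set of natural numbers, so families with index
  sets of this kind represent all finite families.\<close>

definition border_covers :: "'a topology \<Rightarrow> 'a set \<Rightarrow> (nat, 'a) family set"
  where "border_covers X A =
    {\<alpha>. finite_open_family X \<alpha> \<and>
        (\<exists>K. compactin X K \<and>
             topspace X - K = (\<Union>v\<in>verts \<alpha>. part \<alpha> v) \<and>
             A - K \<subseteq> (\<Union>v\<in>dverts \<alpha>. part \<alpha> v))}"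

definition finite_open_covers :: "'a topology \<Rightarrow> 'a set \<Rightarrow> (nat, 'a) family set"
  where "finite_open_covers Y B =
    {\<alpha>. finite_open_family Y \<alpha> \<and>
        (\<Union>v\<in>verts \<alpha>. part \<alpha> v) = topspace Y \<and> B \<subseteq> (\<Union>v\<in>dverts \<alpha>. part \<alpha> v)}"

definition border_homology ::
    "'a topology \<Rightarrow> 'a set \<Rightarrow> nat \<Rightarrow>
     ((nat, 'a) family \<Rightarrow> (nat list \<Rightarrow>\<^sub>0 'g::ab_group_add) set) monoid"
  where "border_homology X A n = cech_homology (border_covers X A) A n"

definition border_cohomology ::
    "'a topology \<Rightarrow> 'a set \<Rightarrow> nat \<Rightarrow>
     ((nat, 'a) family \<times> (nat list \<Rightarrow> 'g::ab_group_add) set) set monoid"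
  where "border_cohomology X A n = cech_cohomology (border_covers X A) A n"

definition finite_cech_homology ::
    "'a topology \<Rightarrow> 'a set \<Rightarrow> nat \<Rightarrow>
     ((nat, 'a) family \<Rightarrow> (nat list \<Rightarrow>\<^sub>0 'g::ab_group_add) set) monoid"
  where "finite_cech_homology Y B n = cech_homology (finite_open_covers Y B) B n"

definition finite_cech_cohomology ::
    "'a topology \<Rightarrow> 'a set \<Rightarrow> nat \<Rightarrow>
     ((nat, 'a) family \<times> (nat list \<Rightarrow> 'g::ab_group_add) set) set monoid"
  where "finite_cech_cohomology Y B n = cech_cohomology (finite_open_covers Y B) B n"


section \<open>Coefficients of cyclicity\<close>

text \<open>The value is \<open>0\<close> if all the groups vanish.\<close>

definition coefficient_of_cyclicity :: "(nat \<Rightarrow> 'h monoid) \<Rightarrow> enat"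
  where "coefficient_of_cyclicity H =
    (if \<forall>m. \<exists>n\<ge>m. \<not> trivial_group (H n) then \<infinity>
     else if \<forall>n. trivial_group (H n) then 0
     else enat (THE n. (\<forall>m>n. trivial_group (H m)) \<and> \<not> trivial_group (H n)))"

definition border_coh_cyclicity :: "'g::ab_group_add itself \<Rightarrow> 'a topology \<Rightarrow> 'a set \<Rightarrow> enat"
  where "border_coh_cyclicity (G :: 'g itself) X A =
    coefficient_of_cyclicity
      (border_cohomology X A :: nat \<Rightarrow> ((nat, 'a) family \<times> (nat list \<Rightarrow> 'g) set) set monoid)"

definition border_hom_cyclicity :: "'g::ab_group_add itself \<Rightarrow> 'a topology \<Rightarrow> 'a set \<Rightarrow> enat"
  where "border_hom_cyclicity (G :: 'g itself) X A =
    coefficient_of_cyclicity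
      (border_homology X A :: nat \<Rightarrow> ((nat, 'a) family \<Rightarrow> (nat list \<Rightarrow>\<^sub>0 'g) set) monoid)"

definition coh_cyclicity :: "'g::ab_group_add itself \<Rightarrow> 'a topology \<Rightarrow> 'a set \<Rightarrow> enat"
  where "coh_cyclicity (G :: 'g itself) Y B =
    coefficient_of_cyclicity
      (finite_cech_cohomology Y B :: nat \<Rightarrow> ((nat, 'a) family \<times> (nat list \<Rightarrow> 'g) set) set monoid)"

definition hom_cyclicity :: "'g::ab_group_add itself \<Rightarrow> 'a topology \<Rightarrow> 'a set \<Rightarrow> enat"
  where "hom_cyclicity (G :: 'g itself) Y B =
    coefficient_of_cyclicity
      (finite_cech_homology Y B :: nat \<Rightarrow> ((nat, 'a) family \<Rightarrow> (nat list \<Rightarrow>\<^sub>0 'g) set) monoid)"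


section \<open>The Stone--Cech compactification\<close>

text \<open>\<open>\<beta>X\<close> is the closure of the image of \<open>X\<close> under evaluation in the cube whose coordinates are the
  continuous functions from \<open>X\<close> to the unit interval. For a completely regular Hausdorff space,
  evaluation is an embedding.\<close>

definition unit_functions :: "'a topology \<Rightarrow> ('a \<Rightarrow> real) set"
  where "unit_functions X =
    {f \<in> extensional (topspace X). continuous_map X (top_of_set {0..1}) f}"

definition sc_cube :: "'a topology \<Rightarrow> (('a \<Rightarrow> real) \<Rightarrow> real) topology"
  where "sc_cube X = product_topology (\<lambda>_. top_of_set {0..1}) (unit_functions X)"

definition sc_embed :: "'a topology \<Rightarrow> 'a \<Rightarrow> (('a \<Rightarrow> real) \<Rightarrow> real)"
  where "sc_embed X x = (\<lambda>f\<in>unit_functions X. f x)"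

definition stone_cech :: "'a topology \<Rightarrow> (('a \<Rightarrow> real) \<Rightarrow> real) topology"
  where "stone_cech X = subtopology (sc_cube X) (sc_cube X closure_of (sc_embed X ` topspace X))"

text \<open>The space \<open>\<beta>X \<setminus> X\<close>, and its subset \<open>\<beta>A \<setminus> A\<close> for a closed subset \<open>A\<close> of \<open>X\<close>, where \<open>\<beta>A\<close> is
  taken to be the closure of \<open>A\<close> in \<open>\<beta>X\<close>.\<close>

definition sc_remainder :: "'a topology \<Rightarrow> (('a \<Rightarrow> real) \<Rightarrow> real) topology"
  where "sc_remainder X =
    subtopology (stone_cech X) (topspace (stone_cech X) - sc_embed X ` topspace X)"

definition sc_remainder_of :: "'a topology \<Rightarrow> 'a set \<Rightarrow> (('a \<Rightarrow> real) \<Rightarrow> real) set"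
  where "sc_remainder_of X A = stone_cech X closure_of (sc_embed X ` A) - sc_embed X ` A"

end

theory Submission
  imports Defs "HOL-Library.Function_Algebras"
begin

text \<open>For \<open>U\<close> open in \<open>X\<close> let \<open>\<tau> U\<close> be the trace on \<open>\<beta>X \<setminus> X\<close> of the largest open subset of \<open>\<beta>X\<close>
  extending \<open>U\<close>. It commutes with finite intersections, turns border covers of \<open>(X, A)\<close> into covers of
  the remainder, and does not change when a compact set is removed from \<open>U\<close>. Since \<open>X\<close> is
  metrizable, a set whose closure is not compact contains a closed noncompact set; hence \<open>\<tau> U\<close> is
  empty only if \<open>U\<close> is relatively compact, and \<open>\<tau> U \<subseteq> \<tau> V\<close> only if \<open>U - V\<close> is. After removing the
  relatively compact carriers, a border cover therefore has the same nerve as its trace, and a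
  refinement between traces becomes a refinement of border covers after removing a compact set.
  Finally, every cover of the remainder is refined by the trace of a border cover: the complement in
  \<open>\<beta>X\<close> of a compact subset of \<open>X\<close> is an \<open>F\<^sub>\<sigma>\<close>-set, hence normal, so covers can be shrunk there. Thus
  the two systems of groups are cofinally the same.\<close>

section \<open>Vanishing of inverse and direct limits\<close>

text \<open>A coefficient of cyclicity records only in which degrees the groups vanish. So no
  isomorphism of limits is built: the vanishing of a limit is restated as a property of its system,
  and that property is carried from one system to the other. Families on both sides are indexed by
  natural numbers, so equal nerves give literally equal groups, not merely isomorphic ones. One
  obstacle is that \<tau> neither determines a border cover nor reflects refinement, since compact
  parts of X are invisible in the remainder. The comparison therefore asks only that a refinement of
  traces lift to a refinement by some other cover with the same trace. The other obstacle is to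
  realise a given cover of the remainder. If it is induced by open sets W of \<beta>X, the trace of
  the part of W in X can exceed the part of W in the remainder, because \<tau> uses the largest open
  extension; hence W must be shrunk first. That K has a countable base of neighbourhoods in X, and
  this makes its complement an F-sigma set.\<close>

lemma coefficient_of_cyclicity_cong:
  assumes "\<And>n. trivial_group (H n) \<longleftrightarrow> trivial_group (H' n)"
  shows "coefficient_of_cyclicity H = coefficient_of_cyclicity H'"
  using assms by (simp add: coefficient_of_cyclicity_def)

section \<open>Vanishing criteria and passage to cofinal subsystems\<close>

locale directed_preorder =
  fixes I :: "'i set" and leq :: "'i \<Rightarrow> 'i \<Rightarrow> bool"
  assumes nonempty: "I \<noteq> {}"
    and refl: "i \<in> I \<Longrightarrow> leq i i"
    and trans: "\<lbrakk>i \<in> I; j \<in> I; k \<in> I; leq i j; leq j k\<rbrakk> \<Longrightarrow> leq i k"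
    and directed: "\<lbrakk>i \<in> I; j \<in> I\<rbrakk> \<Longrightarrow> \<exists>k\<in>I. leq i k \<and> leq j k"

definition cofinal_in :: "'i set \<Rightarrow> ('i \<Rightarrow> 'i \<Rightarrow> bool) \<Rightarrow> 'i set \<Rightarrow> bool"
  where "cofinal_in I leq C \<longleftrightarrow> C \<subseteq> I \<and> (\<forall>i\<in>I. \<exists>c\<in>C. leq i c)"

text \<open>Unlike the elements of \<open>inverse_limit\<close>, compatible families may be
  arbitrary outside \<open>I\<close>; so they can be composed with maps of index sets, and built by
  choice, without restricting them each time.\<close>

definition compatible ::
    "'i set \<Rightarrow> ('i \<Rightarrow> 'i \<Rightarrow> bool) \<Rightarrow> ('i \<Rightarrow> 'h monoid) \<Rightarrow> ('i \<Rightarrow> 'i \<Rightarrow> 'h \<Rightarrow> 'h) \<Rightarrow> ('i \<Rightarrow> 'h) \<Rightarrow> bool"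
  where "compatible I leq H \<phi> x \<longleftrightarrow>
    (\<forall>i\<in>I. x i \<in> carrier (H i)) \<and> (\<forall>i\<in>I. \<forall>j\<in>I. leq i j \<longrightarrow> \<phi> i j (x j) = x i)"

definition inverse_vanishes ::
    "'i set \<Rightarrow> ('i \<Rightarrow> 'i \<Rightarrow> bool) \<Rightarrow> ('i \<Rightarrow> 'h monoid) \<Rightarrow> ('i \<Rightarrow> 'i \<Rightarrow> 'h \<Rightarrow> 'h) \<Rightarrow> bool"
  where "inverse_vanishes I leq H \<phi> \<longleftrightarrow>
    (\<forall>x. compatible I leq H \<phi> x \<longrightarrow> (\<forall>i\<in>I. x i = \<one>\<^bsub>H i\<^esub>))"

definition direct_vanishes ::
    "'i set \<Rightarrow> ('i \<Rightarrow> 'i \<Rightarrow> bool) \<Rightarrow> ('i \<Rightarrow> 'h monoid) \<Rightarrow> ('i \<Rightarrow> 'i \<Rightarrow> 'h \<Rightarrow> 'h) \<Rightarrow> bool"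
  where "direct_vanishes I leq H \<phi> \<longleftrightarrow>
    (\<forall>i\<in>I. \<forall>x\<in>carrier (H i). \<exists>k\<in>I. leq i k \<and> \<phi> i k x = \<one>\<^bsub>H k\<^esub>)"

text \<open>Vanishing depends only on where the neutral elements go. Hence the transition maps are
  just asked to respect the carriers, to preserve the neutral elements and to compose.\<close>

locale inverse_system = directed_preorder I leq
  for I :: "'i set" and leq :: "'i \<Rightarrow> 'i \<Rightarrow> bool" +
  fixes H :: "'i \<Rightarrow> 'h monoid" and \<phi> :: "'i \<Rightarrow> 'i \<Rightarrow> 'h \<Rightarrow> 'h"
  assumes group: "i \<in> I \<Longrightarrow> group (H i)"
    and closed: "\<lbrakk>i \<in> I; j \<in> I; leq i j; x \<in> carrier (H j)\<rbrakk> \<Longrightarrow> \<phi> i j x \<in> carrier (H i)"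
    and map_one: "\<lbrakk>i \<in> I; j \<in> I; leq i j\<rbrakk> \<Longrightarrow> \<phi> i j \<one>\<^bsub>H j\<^esub> = \<one>\<^bsub>H i\<^esub>"
    and map_comp: "\<lbrakk>i \<in> I; j \<in> I; k \<in> I; leq i j; leq j k; x \<in> carrier (H k)\<rbrakk>
      \<Longrightarrow> \<phi> i j (\<phi> j k x) = \<phi> i k x"
begin

lemma trivial_inverse_limit_iff:
  "trivial_group (inverse_limit I leq H \<phi>) \<longleftrightarrow> inverse_vanishes I leq H \<phi>"
proof
  assume "trivial_group (inverse_limit I leq H \<phi>)"
  then have L: "carrier (inverse_limit I leq H \<phi>) = {\<lambda>i\<in>I. \<one>\<^bsub>H i\<^esub>}"
    by (simp add: trivial_group_def inverse_limit_def product_group_def)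
  show "inverse_vanishes I leq H \<phi>"
    unfolding inverse_vanishes_def
  proof (intro allI impI ballI)
    fix x i assume x: "compatible I leq H \<phi> x" and i: "i \<in> I"
    then have "restrict x I \<in> carrier (inverse_limit I leq H \<phi>)"
      by (auto simp: compatible_def inverse_limit_def)
    then have "restrict x I = (\<lambda>i\<in>I. \<one>\<^bsub>H i\<^esub>)"
      using L by simp
    then show "x i = \<one>\<^bsub>H i\<^esub>"
      using i by (metis restrict_apply')
  qed
next
  assume R: "inverse_vanishes I leq H \<phi>"
  let ?e = "\<lambda>i\<in>I. \<one>\<^bsub>H i\<^esub>"
  have "x = ?e" if x: "x \<in> carrier (inverse_limit I leq H \<phi>)" for x
  proof -
    from x have "compatible I leq H \<phi> x" and ext: "x \<in> extensional I"
      by (auto simp: compatible_def inverse_limit_def PiE_def)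
    then have "x i = \<one>\<^bsub>H i\<^esub>" if "i \<in> I" for i
      using R that by (auto simp: inverse_vanishes_def)
    then show ?thesis
      using ext by (auto simp: extensional_def)
  qed
  moreover have "?e \<in> carrier (inverse_limit I leq H \<phi>)"
    using group map_one by (auto simp: inverse_limit_def group.is_monoid)
  ultimately have c: "carrier (inverse_limit I leq H \<phi>) = {?e}"
    by blast
  have m: "?e \<otimes>\<^bsub>inverse_limit I leq H \<phi>\<^esub> ?e = ?e"
    using group by (auto simp: inverse_limit_def product_group_def group.is_monoid monoid.l_one fun_eq_iff)
  have o: "\<one>\<^bsub>inverse_limit I leq H \<phi>\<^esub> = ?e"
    by (simp add: inverse_limit_def product_group_def)
  show "trivial_group (inverse_limit I leq H \<phi>)"
    unfolding trivial_group_def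
    by (intro conjI groupI) (use c m o in auto)
qed

text \<open>A compatible family on \<open>C\<close> extends to \<open>I\<close> by pulling its
  values back from upper bounds in \<open>C\<close>. The extension agrees with the family on
  \<open>C\<close>, so vanishing over \<open>I\<close> forces vanishing over
  \<open>C\<close>.\<close>

lemma inverse_vanishes_cofinal:
  assumes "cofinal_in I leq C"
  shows "inverse_vanishes I leq H \<phi> \<longleftrightarrow> inverse_vanishes C leq H \<phi>"
proof
  have CI: "C \<subseteq> I" and cof: "\<And>i. i \<in> I \<Longrightarrow> \<exists>c\<in>C. leq i c"
    using assms by (auto simp: cofinal_in_def)
  {
    assume R: "inverse_vanishes C leq H \<phi>"
    show "inverse_vanishes I leq H \<phi>"
      unfolding inverse_vanishes_def
    proof (intro allI impI ballI)
      fix x i assume x: "compatible I leq H \<phi> x" and i: "i \<in> I"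
      then obtain c where c: "c \<in> C" "leq i c"
        using cof by blast
      have "compatible C leq H \<phi> x"
        using x CI by (auto simp: compatible_def)
      then have "x c = \<one>\<^bsub>H c\<^esub>"
        using R c by (simp add: inverse_vanishes_def)
      moreover have "\<phi> i c (x c) = x i"
        using x i c CI by (auto simp: compatible_def)
      ultimately show "x i = \<one>\<^bsub>H i\<^esub>"
        using map_one[of i c] i c CI by auto
    qed
  next
    assume R: "inverse_vanishes I leq H \<phi>"
    show "inverse_vanishes C leq H \<phi>"
      unfolding inverse_vanishes_def
    proof (intro allI impI ballI)
      fix x c assume x: "compatible C leq H \<phi> x" and c: "c \<in> C"
      obtain u where u: "\<And>i. i \<in> I \<Longrightarrow> u i \<in> C \<and> leq i (u i)"
        using cof by metis
      define y where "y = (\<lambda>i. \<phi> i (u i) (x (u i)))"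
      \<comment> \<open>Two upper bounds of \<open>i\<close> have a common upper bound
        \<open>e\<close> in \<open>C\<close>, and both values are the pullback of
        \<open>x e\<close>.\<close>
      have indep: "\<phi> i c (x c) = \<phi> i d (x d)"
        if i: "i \<in> I" and c: "c \<in> C" "leq i c" and d: "d \<in> C" "leq i d" for i c d
      proof -
        obtain k where "k \<in> I" "leq c k" "leq d k"
          using directed[of c d] c d CI by auto
        then obtain e where e: "e \<in> C" "leq c e" "leq d e"
          using cof[of k] trans CI c d by (meson subsetD)
        have "\<phi> i c (\<phi> c e (x e)) = \<phi> i d (\<phi> d e (x e))"
          using map_comp[of i c e "x e"] map_comp[of i d e "x e"] i c d e CI x
          by (auto simp: compatible_def subset_eq)
        moreover have "\<phi> c e (x e) = x c" "\<phi> d e (x e) = x d"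
          using x c d e by (auto simp: compatible_def)
        ultimately show ?thesis
          by simp
      qed
      have "compatible I leq H \<phi> y"
        unfolding compatible_def
      proof (intro conjI ballI impI)
        fix i assume "i \<in> I"
        then show "y i \<in> carrier (H i)"
          using u[of i] x CI closed by (auto simp: y_def compatible_def)
      next
        fix i j assume ij: "i \<in> I" "j \<in> I" "leq i j"
        then have "\<phi> i j (y j) = \<phi> i (u j) (x (u j))"
          using u[of j] x CI by (auto simp: y_def compatible_def intro!: map_comp)
        also have "\<dots> = y i"
          unfolding y_def using ij u[of i] u[of j] CI
          by (intro indep) (auto intro: trans)
        finally show "\<phi> i j (y j) = y i" .
      qed
      then have "y c = \<one>\<^bsub>H c\<^esub>"
        using R c CI by (auto simp: inverse_vanishes_def)
      moreover have "y c = x c"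
        using x c u[of c] CI by (auto simp: y_def compatible_def)
      ultimately show "x c = \<one>\<^bsub>H c\<^esub>"
        by simp
    qed
  }
qed

end

locale direct_system = directed_preorder I leq
  for I :: "'i set" and leq :: "'i \<Rightarrow> 'i \<Rightarrow> bool" +
  fixes H :: "'i \<Rightarrow> 'h monoid" and \<phi> :: "'i \<Rightarrow> 'i \<Rightarrow> 'h \<Rightarrow> 'h"
  assumes group: "i \<in> I \<Longrightarrow> group (H i)"
    and closed: "\<lbrakk>i \<in> I; j \<in> I; leq i j; x \<in> carrier (H i)\<rbrakk> \<Longrightarrow> \<phi> i j x \<in> carrier (H j)"
    and map_one: "\<lbrakk>i \<in> I; j \<in> I; leq i j\<rbrakk> \<Longrightarrow> \<phi> i j \<one>\<^bsub>H i\<^esub> = \<one>\<^bsub>H j\<^esub>"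
    and map_comp: "\<lbrakk>i \<in> I; j \<in> I; k \<in> I; leq i j; leq j k; x \<in> carrier (H i)\<rbrakk>
      \<Longrightarrow> \<phi> j k (\<phi> i j x) = \<phi> i k x"
begin

text \<open>The argument avoids showing that \<open>direct_limit_rel\<close> is an equivalence. If
  there is a single class, then \<open>(i, x)\<close> and the neutral element at \<open>i\<close>
  have the same image; the latter is related to itself, so \<open>(i, x)\<close> is related to it.
  If conversely every element dies at a later stage, the relation is total on the disjoint union and
  leaves only one class.\<close>

lemma trivial_direct_limit_iff:
  "trivial_group (direct_limit I leq H \<phi>) \<longleftrightarrow> direct_vanishes I leq H \<phi>"
proof
  let ?R = "direct_limit_rel I leq H \<phi>" and ?S = "SIGMA i:I. carrier (H i)"
  {
    assume "trivial_group (direct_limit I leq H \<phi>)"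
    then have L: "?S // ?R = {?R `` {(i, \<one>\<^bsub>H i\<^esub>) | i. i \<in> I}}"
      by (simp add: trivial_group_def direct_limit_def)
    show "direct_vanishes I leq H \<phi>"
      unfolding direct_vanishes_def
    proof (intro ballI)
      fix i x assume i: "i \<in> I" and x: "x \<in> carrier (H i)"
      then have one: "\<one>\<^bsub>H i\<^esub> \<in> carrier (H i)"
        using group by (simp add: group.is_monoid)
      have "?R `` {(i, x)} \<in> ?S // ?R" "?R `` {(i, \<one>\<^bsub>H i\<^esub>)} \<in> ?S // ?R"
        using i x one by (auto intro!: quotientI)
      then have "?R `` {(i, x)} = ?R `` {(i, \<one>\<^bsub>H i\<^esub>)}"
        using L by auto
      moreover have "((i, \<one>\<^bsub>H i\<^esub>), (i, \<one>\<^bsub>H i\<^esub>)) \<in> ?R"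
        using i one refl by (auto simp: direct_limit_rel_def)
      ultimately have "((i, x), (i, \<one>\<^bsub>H i\<^esub>)) \<in> ?R"
        by blast
      then show "\<exists>k\<in>I. leq i k \<and> \<phi> i k x = \<one>\<^bsub>H k\<^esub>"
        using map_one by (auto simp: direct_limit_rel_def)
    qed
  next
    assume R: "direct_vanishes I leq H \<phi>"
    have "((i, x), (j, y)) \<in> ?R"
      if i: "i \<in> I" "x \<in> carrier (H i)" and j: "j \<in> I" "y \<in> carrier (H j)" for i x j y
    proof -
      obtain k where k: "k \<in> I" "leq i k" "\<phi> i k x = \<one>\<^bsub>H k\<^esub>"
        using R i by (auto simp: direct_vanishes_def)
      obtain l where l: "l \<in> I" "leq j l" "\<phi> j l y = \<one>\<^bsub>H l\<^esub>"
        using R j by (auto simp: direct_vanishes_def)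
      obtain m where m: "m \<in> I" "leq k m" "leq l m"
        using directed k l by blast
      have "\<phi> i m x = \<phi> k m (\<phi> i k x)"
        using i k m by (intro map_comp[symmetric])
      also have "\<dots> = \<one>\<^bsub>H m\<^esub>"
        using k m map_one by simp
      finally have x: "\<phi> i m x = \<one>\<^bsub>H m\<^esub>" .
      have "\<phi> j m y = \<phi> l m (\<phi> j l y)"
        using j l m by (intro map_comp[symmetric])
      also have "\<dots> = \<one>\<^bsub>H m\<^esub>"
        using l m map_one by simp
      finally have "\<phi> i m x = \<phi> j m y"
        using x by simp
      moreover have "leq i m" "leq j m"
        using trans i j k l m by blast+
      ultimately show ?thesis
        using i j m by (auto simp: direct_limit_rel_def)
    qed
    moreover have "?R \<subseteq> ?S \<times> ?S"
      by (auto simp: direct_limit_rel_def)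
    ultimately have RS: "?R = ?S \<times> ?S"
      by auto
    have im: "?R `` P = ?S" if "P \<subseteq> ?S" "P \<noteq> {}" for P
      using that unfolding RS by blast
    obtain i where i: "i \<in> I"
      using nonempty by blast
    have oS: "(j, \<one>\<^bsub>H j\<^esub>) \<in> ?S" if "j \<in> I" for j
      using group that by (simp add: group.is_monoid)
    have ne: "?S \<noteq> {}"
      using oS[OF i] by blast
    have "?S // ?R = {?S}"
      using ne im unfolding quotient_def by auto
    then have c: "carrier (direct_limit I leq H \<phi>) = {?S}"
      by (simp add: direct_limit_def)
    have o: "\<one>\<^bsub>direct_limit I leq H \<phi>\<^esub> = ?S"
      unfolding direct_limit_def using i oS by (auto intro!: im)
    let ?P = "{(k, \<phi> i k x \<otimes>\<^bsub>H k\<^esub> \<phi> j k y) | i x j y k.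
       (i, x) \<in> ?S \<and> (j, y) \<in> ?S \<and> k \<in> I \<and> leq i k \<and> leq j k}"
    have P1: "(i, \<phi> i i \<one>\<^bsub>H i\<^esub> \<otimes>\<^bsub>H i\<^esub> \<phi> i i \<one>\<^bsub>H i\<^esub>) \<in> ?P"
      using oS[OF i] i refl by blast
    have P2: "?P \<subseteq> ?S"
    proof clarify
      fix i j k x y
      assume "i \<in> I" "x \<in> carrier (H i)" "j \<in> I" "y \<in> carrier (H j)" "k \<in> I" "leq i k" "leq j k"
      then show "\<phi> i k x \<otimes>\<^bsub>H k\<^esub> \<phi> j k y \<in> carrier (H k)"
        using closed group by (simp add: group.is_monoid monoid.m_closed)
    qed
    have "?R `` ?P = ?S"
      by (rule im[OF P2]) (use P1 in \<open>metis empty_iff\<close>)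
    then have m: "?S \<otimes>\<^bsub>direct_limit I leq H \<phi>\<^esub> ?S = ?S"
      by (simp add: direct_limit_def)
    show "trivial_group (direct_limit I leq H \<phi>)"
      unfolding trivial_group_def
      by (intro conjI groupI) (use c m o in auto)
  }
qed

lemma direct_vanishes_cofinal:
  assumes "cofinal_in I leq C"
  shows "direct_vanishes I leq H \<phi> \<longleftrightarrow> direct_vanishes C leq H \<phi>"
proof
  have CI: "C \<subseteq> I" and cof: "\<And>i. i \<in> I \<Longrightarrow> \<exists>c\<in>C. leq i c"
    using assms by (auto simp: cofinal_in_def)
  \<comment> \<open>An element that is neutral at stage \<open>k\<close> remains so at every later
    stage, in particular at one in \<open>C\<close>.\<close>
  have push: "\<exists>c\<in>C. leq i c \<and> \<phi> i c x = \<one>\<^bsub>H c\<^esub>"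
    if i: "i \<in> I" "x \<in> carrier (H i)" and k: "k \<in> I" "leq i k" "\<phi> i k x = \<one>\<^bsub>H k\<^esub>" for i x k
  proof -
    obtain c where c: "c \<in> C" "leq k c"
      using cof k by blast
    have "\<phi> i c x = \<phi> k c (\<phi> i k x)"
      using map_comp[of i k c x] i k c CI by auto
    also have "\<dots> = \<one>\<^bsub>H c\<^esub>"
      using k c CI map_one by auto
    finally show ?thesis
      using trans[of i k c] i k c CI by auto
  qed
  {
    assume "direct_vanishes I leq H \<phi>"
    then show "direct_vanishes C leq H \<phi>"
      using push CI unfolding direct_vanishes_def by (meson subsetD)
  next
    assume R: "direct_vanishes C leq H \<phi>"
    show "direct_vanishes I leq H \<phi>"
      unfolding direct_vanishes_def
    proof (intro ballI)
      fix i x assume i: "i \<in> I" and x: "x \<in> carrier (H i)"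
      obtain c where c: "c \<in> C" "leq i c"
        using cof i by blast
      then have "\<phi> i c x \<in> carrier (H c)"
        using closed i x CI by auto
      then obtain d where d: "d \<in> C" "leq c d" "\<phi> c d (\<phi> i c x) = \<one>\<^bsub>H d\<^esub>"
        using R c by (auto simp: direct_vanishes_def)
      have I: "c \<in> I" "d \<in> I"
        using c d CI by auto
      have "\<phi> i d x = \<one>\<^bsub>H d\<^esub>"
        using map_comp[OF i I c(2) d(2) x] d(3) by simp
      then show "\<exists>k\<in>I. leq i k \<and> \<phi> i k x = \<one>\<^bsub>H k\<^esub>"
        using trans[of i c d] i c d CI by auto
    qed
  }
qed

end

section \<open>Transfer of vanishing along a map of index sets\<close>

text \<open>In \<open>lift\<close> the comparison \<open>h\<close> need not reflect the order; it does so after replacing \<open>b\<close> by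
  another element of the fibre of \<open>h\<close>.\<close>

locale system_comparison =
  fixes C :: "'i set" and leq :: "'i \<Rightarrow> 'i \<Rightarrow> bool" and H :: "'i \<Rightarrow> 'h monoid"
    and \<phi> :: "'i \<Rightarrow> 'i \<Rightarrow> 'h \<Rightarrow> 'h"
    and leq' :: "'j \<Rightarrow> 'j \<Rightarrow> bool" and H' :: "'j \<Rightarrow> 'h monoid"
    and \<phi>' :: "'j \<Rightarrow> 'j \<Rightarrow> 'h \<Rightarrow> 'h" and h :: "'i \<Rightarrow> 'j"
  assumes same_group: "a \<in> C \<Longrightarrow> H' (h a) = H a"
    and mono: "\<lbrakk>a \<in> C; b \<in> C; leq a b\<rbrakk> \<Longrightarrow> leq' (h a) (h b)"
    and lift: "\<lbrakk>a \<in> C; b \<in> C; leq' (h a) (h b)\<rbrakk> \<Longrightarrow> \<exists>c\<in>C. leq a c \<and> leq b c \<and> h c = h b"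
    and refl': "a \<in> C \<Longrightarrow> leq' (h a) (h a)"
begin

lemma inverse_vanishes_image:
  assumes same_map: "\<And>a b x. \<lbrakk>a \<in> C; b \<in> C; leq a b; x \<in> carrier (H b)\<rbrakk> \<Longrightarrow> \<phi>' (h a) (h b) x = \<phi> a b x"
    and id': "\<And>a x. \<lbrakk>a \<in> C; x \<in> carrier (H a)\<rbrakk> \<Longrightarrow> \<phi>' (h a) (h a) x = x"
  shows "inverse_vanishes C leq H \<phi> \<longleftrightarrow> inverse_vanishes (h ` C) leq' H' \<phi>'"
proof
  assume L: "inverse_vanishes C leq H \<phi>"
  show "inverse_vanishes (h ` C) leq' H' \<phi>'"
    unfolding inverse_vanishes_def
  proof (intro allI impI ballI)
    fix y j assume y: "compatible (h ` C) leq' H' \<phi>' y" and j: "j \<in> h ` C"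
    have "compatible C leq H \<phi> (y \<circ> h)"
      unfolding compatible_def
    proof (intro conjI ballI impI)
      show c: "(y \<circ> h) a \<in> carrier (H a)" if "a \<in> C" for a
        using y that same_group by (auto simp: compatible_def)
      show "\<phi> a b ((y \<circ> h) b) = (y \<circ> h) a" if "a \<in> C" "b \<in> C" "leq a b" for a b
        using same_map[OF that c[OF that(2)]] y mono[OF that] that by (auto simp: compatible_def)
    qed
    then show "y j = \<one>\<^bsub>H' j\<^esub>"
      using L j same_group by (auto simp: inverse_vanishes_def)
  qed
next
  assume R: "inverse_vanishes (h ` C) leq' H' \<phi>'"
  show "inverse_vanishes C leq H \<phi>"
    unfolding inverse_vanishes_def
  proof (intro allI impI ballI)
    fix x a assume x: "compatible C leq H \<phi> x" and a: "a \<in> C"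
    \<comment> \<open>Since \<open>h c = h b\<close>, the transition map from \<open>c\<close> to
      \<open>b\<close> is a self-map at one index of the image system, hence the identity. So
      \<open>x\<close> has the same value at \<open>b\<close> and at the lifted index
      \<open>c\<close>, which does lie above \<open>a\<close>.\<close>
    have push: "\<phi>' (h a) (h b) (x b) = x a" if ab: "a \<in> C" "b \<in> C" "leq' (h a) (h b)" for a b
    proof -
      obtain c where c: "c \<in> C" "leq a c" "leq b c" "h c = h b"
        using lift ab by blast
      have xc: "x c \<in> carrier (H c)" and xa: "\<phi> a c (x c) = x a" and xb: "\<phi> b c (x c) = x b"
        using x ab c by (auto simp: compatible_def)
      have "x b = \<phi>' (h b) (h c) (x c)"
        using same_map[of b c] ab c xc xb by simp
      also have "\<dots> = x c"
        using id'[of c "x c"] c xc by simp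
      finally show ?thesis
        using same_map[of a c "x c"] ab c xc xa by simp
    qed
    have fibre: "x a = x b" if "a \<in> C" "b \<in> C" "h a = h b" for a b
      using push[of a b] push[of b b] refl' that by simp
    \<comment> \<open>By \<open>fibre\<close> the value does not depend on the chosen preimage of
      \<open>j\<close>.\<close>
    define y where "y = (\<lambda>j. x (SOME a. a \<in> C \<and> h a = j))"
    have yh: "y (h a) = x a" if "a \<in> C" for a
    proof -
      have "(SOME b. b \<in> C \<and> h b = h a) \<in> C \<and> h (SOME b. b \<in> C \<and> h b = h a) = h a"
        using that by (rule_tac someI[where x = a]) simp
      then show ?thesis
        unfolding y_def using fibre that by metis
    qed
    have "compatible (h ` C) leq' H' \<phi>' y"
      using x push same_group by (auto simp: compatible_def yh)
    then show "x a = \<one>\<^bsub>H a\<^esub>"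
      using R a same_group yh by (force simp: inverse_vanishes_def)
  qed
qed

text \<open>For the converse, an element that dies at \<open>h b\<close> in the image system dies at
  the lifted index \<open>c\<close> of the original one, because \<open>h c\<close> is the same
  index as \<open>h b\<close>.\<close>

lemma direct_vanishes_image:
  assumes same_map: "\<And>a b x. \<lbrakk>a \<in> C; b \<in> C; leq a b; x \<in> carrier (H a)\<rbrakk> \<Longrightarrow> \<phi>' (h a) (h b) x = \<phi> a b x"
  shows "direct_vanishes C leq H \<phi> \<longleftrightarrow> direct_vanishes (h ` C) leq' H' \<phi>'"
proof
  assume L: "direct_vanishes C leq H \<phi>"
  show "direct_vanishes (h ` C) leq' H' \<phi>'"
    unfolding direct_vanishes_def
  proof clarify
    fix a x assume a: "a \<in> C" and x: "x \<in> carrier (H' (h a))"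
    have xa: "x \<in> carrier (H a)"
      using x same_group[OF a] by simp
    then obtain k where k: "k \<in> C" "leq a k" "\<phi> a k x = \<one>\<^bsub>H k\<^esub>"
      using L a unfolding direct_vanishes_def by blast
    have "\<phi>' (h a) (h k) x = \<one>\<^bsub>H' (h k)\<^esub>"
      using same_map[OF a k(1,2) xa] same_group[OF k(1)] k(3) by simp
    then show "\<exists>k\<in>h ` C. leq' (h a) k \<and> \<phi>' (h a) k x = \<one>\<^bsub>H' k\<^esub>"
      using mono[OF a k(1,2)] k(1) by blast
  qed
next
  assume R: "direct_vanishes (h ` C) leq' H' \<phi>'"
  show "direct_vanishes C leq H \<phi>"
    unfolding direct_vanishes_def
  proof (intro ballI)
    fix a x assume a: "a \<in> C" and x: "x \<in> carrier (H a)"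
    then obtain b where b: "b \<in> C" "leq' (h a) (h b)" "\<phi>' (h a) (h b) x = \<one>\<^bsub>H' (h b)\<^esub>"
      using R same_group by (force simp: direct_vanishes_def)
    then obtain c where c: "c \<in> C" "leq a c" "h c = h b"
      using lift a by blast
    have "\<phi> a c x = \<one>\<^bsub>H c\<^esub>"
      using same_map[OF a c(1,2) x] same_group[OF c(1)] b(3) c(3) by simp
    then show "\<exists>k\<in>C. leq a k \<and> \<phi> a k x = \<one>\<^bsub>H k\<^esub>"
      using c by auto
  qed
qed

end

section \<open>Functoriality of simplicial (co)homology\<close>

subsection \<open>Quotients of additive subgroups\<close>

text \<open>Chains and cochains both form types of class \<open>ab_group_add\<close>, the latter by
  pointwise addition. Subsets of such a type closed under subtraction therefore treat cycles,
  boundaries, cocycles and coboundaries alike.\<close>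

definition additive_subgroup :: "'a::ab_group_add set \<Rightarrow> bool"
  where "additive_subgroup S \<longleftrightarrow> 0 \<in> S \<and> (\<forall>x\<in>S. \<forall>y\<in>S. x - y \<in> S)"

definition additive_group :: "'a::ab_group_add set \<Rightarrow> 'a monoid"
  where "additive_group Z = \<lparr>carrier = Z, monoid.mult = (+), one = 0\<rparr>"

definition coset :: "'a::ab_group_add set \<Rightarrow> 'a \<Rightarrow> 'a set"
  where "coset N c = (\<lambda>b. b + c) ` N"

lemma additive_subgroupD:
  assumes "additive_subgroup S"
  shows "0 \<in> S" "x \<in> S \<Longrightarrow> y \<in> S \<Longrightarrow> x - y \<in> S" "x \<in> S \<Longrightarrow> - x \<in> S"
    "x \<in> S \<Longrightarrow> y \<in> S \<Longrightarrow> x + y \<in> S"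
proof -
  show 0: "0 \<in> S" and d: "x \<in> S \<Longrightarrow> y \<in> S \<Longrightarrow> x - y \<in> S" for x y
    using assms by (auto simp: additive_subgroup_def)
  show m: "x \<in> S \<Longrightarrow> - x \<in> S" for x
    using d[of 0 x] 0 by simp
  show "x \<in> S \<Longrightarrow> y \<in> S \<Longrightarrow> x + y \<in> S"
    using d[of x "- y"] m[of y] by simp
qed

lemma additive_subgroup_sum:
  assumes "additive_subgroup S" "\<And>i. i \<in> A \<Longrightarrow> f i \<in> S"
  shows "sum f A \<in> S"
  using assms(2) by (induction A rule: infinite_finite_induct) (auto intro: additive_subgroupD[OF assms(1)])

lemma comm_group_additive_group:
  assumes "additive_subgroup Z"
  shows "comm_group (additive_group Z)"
proof (rule comm_groupI)
  fix x assume "x \<in> carrier (additive_group Z)"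
  then show "\<exists>y\<in>carrier (additive_group Z). y \<otimes>\<^bsub>additive_group Z\<^esub> x = \<one>\<^bsub>additive_group Z\<^esub>"
    using additive_subgroupD(3)[OF assms, of x]
    by (auto simp: additive_group_def intro!: bexI[of _ "- x"])
qed (use additive_subgroupD[OF assms] in \<open>auto simp: additive_group_def add_ac\<close>)

lemma normal_additive_group:
  assumes Z: "additive_subgroup Z" and N: "additive_subgroup N" and sub: "N \<subseteq> Z"
  shows "N \<lhd> additive_group Z"
proof -
  interpret comm_group "additive_group Z"
    by (rule comm_group_additive_group[OF Z])
  have "inv\<^bsub>additive_group Z\<^esub> x = - x" if "x \<in> N" for x
    using that sub additive_subgroupD(3)[OF Z, of x]
    by (intro inv_equality) (auto simp: additive_group_def)
  then have "subgroup N (additive_group Z)"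
    by unfold_locales (use sub additive_subgroupD[OF N] in \<open>auto simp: additive_group_def\<close>)
  then show ?thesis
    by (rule subgroup_imp_normal)
qed

lemma group_additive_quotient:
  assumes "additive_subgroup Z" "additive_subgroup N" "N \<subseteq> Z"
  shows "group (additive_group Z Mod N)"
  by (rule normal.factorgroup_is_group[OF normal_additive_group[OF assms]])

lemma carrier_additive_quotient: "carrier (additive_group Z Mod N) = coset N ` Z"
  unfolding carrier_FactGroup by (auto simp: r_coset_def coset_def additive_group_def)

lemma coset_eqI:
  assumes "additive_subgroup N" "c - d \<in> N"
  shows "coset N c = coset N d"
proof -
  have "coset N c \<subseteq> coset N d" if "c - d \<in> N" for c d
  proof
    fix x assume "x \<in> coset N c"
    then obtain b where b: "b \<in> N" "x = b + c"
      by (auto simp: coset_def)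
    then have "x = (b + (c - d)) + d" "b + (c - d) \<in> N"
      using additive_subgroupD(4)[OF assms(1)] that by auto
    then show "x \<in> coset N d"
      unfolding coset_def by blast
  qed
  moreover have "d - c \<in> N"
    using additive_subgroupD(3)[OF assms(1,2)] by simp
  ultimately show ?thesis
    using assms(2) by blast
qed

lemma coset_zero [simp]: "coset N 0 = N"
  by (simp add: coset_def)

text \<open>The image of a coset of \<open>N\<close> lies in a single coset of \<open>N'\<close> but
  need not fill it; multiplying by \<open>N'\<close> fills it. This evaluates the induced maps on
  representatives.\<close>

lemma set_mult_image_coset:
  assumes N: "additive_subgroup N" and N': "additive_subgroup N'"
    and add: "Modules.additive \<phi>" and sub: "\<phi> ` N \<subseteq> N'"
  shows "N' <#>\<^bsub>additive_group Z'\<^esub> (\<phi> ` coset N c) = coset N' (\<phi> c)"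
proof (rule Set.set_eqI)
  fix y
  show "y \<in> N' <#>\<^bsub>additive_group Z'\<^esub> (\<phi> ` coset N c) \<longleftrightarrow> y \<in> coset N' (\<phi> c)"
  proof
    assume "y \<in> N' <#>\<^bsub>additive_group Z'\<^esub> (\<phi> ` coset N c)"
    then obtain a b where ab: "a \<in> N'" "b \<in> N" "y = a + \<phi> (b + c)"
      by (auto simp: set_mult_def coset_def additive_group_def)
    then have "y = (a + \<phi> b) + \<phi> c" "a + \<phi> b \<in> N'"
      using additive.add[OF add] additive_subgroupD(4)[OF N'] sub by (auto simp: add.assoc)
    then show "y \<in> coset N' (\<phi> c)"
      unfolding coset_def by blast
  next
    assume "y \<in> coset N' (\<phi> c)"
    then obtain a where "a \<in> N'" "y = a + \<phi> c"
      by (auto simp: coset_def)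
    moreover have "\<phi> c = \<phi> (0 + c)" "0 \<in> N"
      using additive_subgroupD(1)[OF N] by auto
    ultimately show "y \<in> N' <#>\<^bsub>additive_group Z'\<^esub> (\<phi> ` coset N c)"
      unfolding set_mult_def coset_def additive_group_def by force
  qed
qed

subsection \<open>Alternating sums over faces and prisms\<close>

lemma alt_sign_simps [simp]:
  "alt_sign 0 g = g" "alt_sign (Suc i) g = - alt_sign i g" "alt_sign i 0 = 0"
  by (auto simp: alt_sign_def)

text \<open>Deleting the head leaves the tail; deleting a later entry keeps the head and changes the
  sign. In this recursive form the identities below are list inductions without index shifts. On
  \<open>[x]\<close> the value is \<open>f []\<close>, which is the augmentation. The target group
  is arbitrary so that \<open>f\<close> can be a cochain as well as the map sending a list to its
  generator.\<close>

primrec face_sum :: "'v list \<Rightarrow> ('v list \<Rightarrow> 'b::ab_group_add) \<Rightarrow> 'b" where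
  "face_sum [] f = 0"
| "face_sum (x # xs) f = f xs - face_sum xs (\<lambda>ys. f (x # ys))"

text \<open>The classical prism operator between the vertex maps \<open>p\<close> and
  \<open>q\<close>; \<open>prism_sum_eq\<close> gives the usual closed formula.\<close>

primrec prism_sum :: "('v \<Rightarrow> 'w) \<Rightarrow> ('v \<Rightarrow> 'w) \<Rightarrow> 'v list \<Rightarrow> ('w list \<Rightarrow> 'b::ab_group_add) \<Rightarrow> 'b" where
  "prism_sum p q [] f = 0"
| "prism_sum p q (x # xs) f = f (p x # q x # map q xs) - prism_sum p q xs (\<lambda>ys. f (p x # ys))"

lemma face_sum_eq: "face_sum xs f = (\<Sum>i<length xs. alt_sign i (f (face i xs)))"
proof (induction xs arbitrary: f)
  case (Cons x xs)
  then show ?case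
    by (simp del: sum.lessThan_Suc add: sum.lessThan_Suc_shift face_def sum_negf)
qed simp

lemma prism_sum_eq:
  "prism_sum p q xs f =
    (\<Sum>i<length xs. alt_sign i (f (map p (take (Suc i) xs) @ map q (drop i xs))))"
proof (induction xs arbitrary: f)
  case (Cons x xs)
  then show ?case
    by (simp del: sum.lessThan_Suc add: sum.lessThan_Suc_shift sum_negf)
qed simp

lemma face_sum_diff: "face_sum xs (\<lambda>ys. f ys - g ys) = face_sum xs f - face_sum xs g"
  by (induction xs arbitrary: f g) (auto simp: algebra_simps)

lemma prism_sum_diff: "prism_sum p q xs (\<lambda>ys. f ys - g ys) = prism_sum p q xs f - prism_sum p q xs g"
  by (induction xs arbitrary: f g) (auto simp: algebra_simps)

lemma face_sum_map: "face_sum (map p xs) f = face_sum xs (\<lambda>ys. f (map p ys))"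
  by (induction xs arbitrary: f) auto

lemma face_sum_additive:
  assumes "Modules.additive \<phi>"
  shows "\<phi> (face_sum xs f) = face_sum xs (\<lambda>ys. \<phi> (f ys))"
  by (induction xs arbitrary: f) (auto simp: additive.zero[OF assms] additive.diff[OF assms])

lemma prism_sum_additive:
  assumes "Modules.additive \<phi>"
  shows "\<phi> (prism_sum p q xs f) = prism_sum p q xs (\<lambda>ys. \<phi> (f ys))"
  by (induction xs arbitrary: f) (auto simp: additive.zero[OF assms] additive.diff[OF assms])

lemma face_sum_face_sum: "face_sum xs (\<lambda>ys. face_sum ys f) = 0"
proof (induction xs arbitrary: f)
  case (Cons x xs)
  then show ?case
    by (simp add: face_sum_diff)
qed simp

text \<open>With generators for \<open>f\<close>, the first term is the prism over the boundary and
  the second the boundary of the prism, so this is the chain homotopy formula; with a cochain for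
  \<open>f\<close> it is the dual one. Thanks to the augmentation it holds for every list, including
  \<open>[]\<close>, and the induction needs no separate low degrees.\<close>

lemma prism_identity:
  "face_sum xs (\<lambda>ys. prism_sum p q ys f) + prism_sum p q xs (\<lambda>ys. face_sum ys f)
    = f (map q xs) - f (map p xs)"
proof (induction xs arbitrary: f)
  case (Cons x xs)
  let ?g = "\<lambda>ys. f (p x # ys)"
  show ?case
    using Cons[of ?g] by (simp add: face_sum_diff prism_sum_diff face_sum_map algebra_simps)
qed simp

lemma alt_sign_mem: "additive_subgroup S \<Longrightarrow> g \<in> S \<Longrightarrow> alt_sign i g \<in> S"
  by (simp add: alt_sign_def additive_subgroupD)

text \<open>With a group of chains as \<open>S\<close> this places a boundary in a subcomplex; with
  \<open>S = {0}\<close> it shows that a coboundary vanishes on a simplex.\<close>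

lemma face_sum_mem:
  assumes "additive_subgroup S" "\<And>i. i < length xs \<Longrightarrow> f (face i xs) \<in> S"
  shows "face_sum xs f \<in> S"
  unfolding face_sum_eq using assms by (intro additive_subgroup_sum alt_sign_mem) auto

lemma prism_sum_mem:
  assumes "additive_subgroup S"
    "\<And>i. i < length xs \<Longrightarrow> f (map p (take (Suc i) xs) @ map q (drop i xs)) \<in> S"
  shows "prism_sum p q xs f \<in> S"
  unfolding prism_sum_eq using assms by (intro additive_subgroup_sum alt_sign_mem) auto

lemma face_sum_cong:
  assumes "\<And>i. i < length xs \<Longrightarrow> f (face i xs) = g (face i xs)"
  shows "face_sum xs f = face_sum xs g"
  unfolding face_sum_eq using assms by (intro sum.cong) auto

lemma additive_subgroup_zero: "additive_subgroup {0}"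
  by (simp add: additive_subgroup_def)

subsection \<open>Simplicial pairs and contiguous maps\<close>

definition simplicial_pair :: "'v set set \<Rightarrow> 'v set set \<Rightarrow> bool"
  where "simplicial_pair K L \<longleftrightarrow> L \<subseteq> K \<and> {} \<notin> K \<and>
    (\<forall>s\<in>K. \<forall>t\<subseteq>s. t \<noteq> {} \<longrightarrow> t \<in> K) \<and> (\<forall>s\<in>L. \<forall>t\<subseteq>s. t \<noteq> {} \<longrightarrow> t \<in> L)"

text \<open>The diagonal case \<open>contiguous K L K' L' p p\<close> says that \<open>p\<close> is
  a simplicial map of pairs and serves as that notion throughout.\<close>

definition contiguous ::
    "'v set set \<Rightarrow> 'v set set \<Rightarrow> 'w set set \<Rightarrow> 'w set set \<Rightarrow> ('v \<Rightarrow> 'w) \<Rightarrow> ('v \<Rightarrow> 'w) \<Rightarrow> bool"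
  where "contiguous K L K' L' p q \<longleftrightarrow>
    (\<forall>s\<in>K. p ` s \<union> q ` s \<in> K') \<and> (\<forall>s\<in>L. p ` s \<union> q ` s \<in> L')"

lemma simplicial_pair_absolute: "simplicial_pair K L \<Longrightarrow> simplicial_pair K K"
  and simplicial_pair_sub: "simplicial_pair K L \<Longrightarrow> simplicial_pair L L"
  unfolding simplicial_pair_def by blast+

lemma face_ordered_simplices:
  assumes "simplicial_pair K K" "xs \<in> ordered_simplices (Suc n) K" "i < length xs"
  shows "face i xs \<in> ordered_simplices n K"
proof -
  have l: "length (face i xs) = Suc n"
    using assms by (auto simp: face_def ordered_simplices_def)
  have "set (face i xs) \<subseteq> set xs"
    unfolding face_def by (metis set_append le_sup_iff set_take_subset set_drop_subset)
  moreover have "set (face i xs) \<noteq> {}"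
    using l by auto
  ultimately show ?thesis
    using assms l by (auto simp: simplicial_pair_def ordered_simplices_def)
qed

lemma prism_ordered_simplices:
  assumes "simplicial_pair K' K'" "\<And>s. s \<in> K \<Longrightarrow> p ` s \<union> q ` s \<in> K'"
    and "xs \<in> ordered_simplices n K" "i < length xs"
  shows "map p (take (Suc i) xs) @ map q (drop i xs) \<in> ordered_simplices (Suc n) K'"
proof -
  let ?ys = "map p (take (Suc i) xs) @ map q (drop i xs)"
  have l: "length ?ys = Suc (Suc n)"
    using assms by (auto simp: ordered_simplices_def)
  have "set ?ys \<subseteq> p ` set xs \<union> q ` set xs"
    using set_take_subset[of "Suc i" xs] set_drop_subset[of i xs] by auto
  moreover have "set ?ys \<noteq> {}"
    using l by (metis length_0_conv nat.distinct(1) set_empty)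
  moreover have "p ` set xs \<union> q ` set xs \<in> K'"
    using assms by (auto simp: ordered_simplices_def)
  ultimately have "set ?ys \<in> K'"
    using assms(1) unfolding simplicial_pair_def by blast
  then show ?thesis
    using l by (simp add: ordered_simplices_def)
qed

lemma map_ordered_simplices:
  assumes "\<And>s. s \<in> K \<Longrightarrow> p ` s \<in> K'" "xs \<in> ordered_simplices n K"
  shows "map p xs \<in> ordered_simplices n K'"
  using assms by (auto simp: ordered_simplices_def)

lemma contiguous_refl_iff:
  "contiguous K L K' L' p p \<longleftrightarrow> (\<forall>s\<in>K. p ` s \<in> K') \<and> (\<forall>s\<in>L. p ` s \<in> L')"
  by (simp add: contiguous_def)

lemma contiguous_simplicial:
  assumes "contiguous K L K' L' p q" "simplicial_pair K L" "simplicial_pair K' L'"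
  shows "contiguous K L K' L' p p" "contiguous K L K' L' q q"
proof -
  have ne: "s \<noteq> {}" if "s \<in> K" for s
    using assms(2) that by (auto simp: simplicial_pair_def)
  have "r ` s \<in> K'" if "s \<in> K" "r = p \<or> r = q" for r s
  proof -
    have "p ` s \<union> q ` s \<in> K'" "r ` s \<noteq> {}" "r ` s \<subseteq> p ` s \<union> q ` s"
      using that assms(1) ne by (auto simp: contiguous_def)
    then show ?thesis
      using assms(3) unfolding simplicial_pair_def by blast
  qed
  moreover have "r ` s \<in> L'" if "s \<in> L" "r = p \<or> r = q" for r s
  proof -
    have "s \<in> K"
      using assms(2) that by (auto simp: simplicial_pair_def)
    then have "p ` s \<union> q ` s \<in> L'" "r ` s \<noteq> {}" "r ` s \<subseteq> p ` s \<union> q ` s"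
      using that assms(1) ne by (auto simp: contiguous_def)
    then show ?thesis
      using assms(3) unfolding simplicial_pair_def by blast
  qed
  ultimately show "contiguous K L K' L' p p" "contiguous K L K' L' q q"
    by (auto simp: contiguous_refl_iff)
qed

subsection \<open>Homology\<close>

text \<open>Chain maps, the augmented boundary and the prism operator all have this form, with
  \<open>F xs\<close> additive in the coefficient. Identities and memberships can then be checked on
  single generators by \<open>additive_eqI\<close> and \<open>additive_memI\<close>.\<close>

definition linear_extension ::
    "('v list \<Rightarrow> 'g \<Rightarrow> 'b::ab_group_add) \<Rightarrow> ('v list \<Rightarrow>\<^sub>0 'g::ab_group_add) \<Rightarrow> 'b"
  where "linear_extension F c = (\<Sum>xs\<in>Poly_Mapping.keys c. F xs (Poly_Mapping.lookup c xs))"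

lemma linear_extension_superset:
  assumes "\<And>xs. Modules.additive (F xs)" "finite A" "Poly_Mapping.keys c \<subseteq> A"
  shows "linear_extension F c = (\<Sum>xs\<in>A. F xs (Poly_Mapping.lookup c xs))"
  unfolding linear_extension_def using assms
  by (intro sum.mono_neutral_left) (auto simp: in_keys_iff additive.zero)

lemma additive_linear_extension:
  assumes F: "\<And>xs. Modules.additive (F xs)"
  shows "Modules.additive (linear_extension F)"
proof
  fix c d :: "'a list \<Rightarrow>\<^sub>0 'b"
  \<comment> \<open>Coefficients may cancel in \<open>c + d\<close>, so all three sums are taken
    over one common finite set.\<close>
  let ?A = "Poly_Mapping.keys c \<union> Poly_Mapping.keys d"
  have "Poly_Mapping.keys (c + d) \<subseteq> ?A"
    by (rule keys_add)
  then show "linear_extension F (c + d) = linear_extension F c + linear_extension F d"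
    by (simp add: linear_extension_superset[OF F, of ?A] lookup_add additive.add[OF F] sum.distrib)
qed

lemma linear_extension_single:
  assumes "\<And>xs. Modules.additive (F xs)"
  shows "linear_extension F (Poly_Mapping.single xs g) = F xs g"
  using linear_extension_superset[OF assms, of "{xs}" "Poly_Mapping.single xs g"] by simp

lemma sum_singles: "(\<Sum>x\<in>Poly_Mapping.keys c. Poly_Mapping.single x (Poly_Mapping.lookup c x)) = c"
proof (rule poly_mapping_eqI)
  fix k
  have "(\<Sum>x\<in>Poly_Mapping.keys c. Poly_Mapping.lookup (Poly_Mapping.single x (Poly_Mapping.lookup c x)) k)
    = (\<Sum>x\<in>Poly_Mapping.keys c. if x = k then Poly_Mapping.lookup c k else 0)"
    by (intro sum.cong) (auto simp: lookup_single when_def)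
  then show "Poly_Mapping.lookup (\<Sum>x\<in>Poly_Mapping.keys c. Poly_Mapping.single x (Poly_Mapping.lookup c x)) k
    = Poly_Mapping.lookup c k"
    by (simp add: lookup_sum sum.delta in_keys_iff)
qed

lemma additive_eqI:
  assumes "Modules.additive \<phi>" "Modules.additive \<psi>"
    and "\<And>xs g. xs \<in> Poly_Mapping.keys c \<Longrightarrow> \<phi> (Poly_Mapping.single xs g) = \<psi> (Poly_Mapping.single xs g)"
  shows "\<phi> c = \<psi> c"
proof -
  have "\<phi> (\<Sum>x\<in>Poly_Mapping.keys c. Poly_Mapping.single x (Poly_Mapping.lookup c x))
    = \<psi> (\<Sum>x\<in>Poly_Mapping.keys c. Poly_Mapping.single x (Poly_Mapping.lookup c x))"
    unfolding additive.sum[OF assms(1)] additive.sum[OF assms(2)]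
    using assms(3) by (intro sum.cong) auto
  then show ?thesis
    by (simp add: sum_singles)
qed

lemma additive_memI:
  assumes "Modules.additive \<phi>" "additive_subgroup S"
    and "\<And>xs g. xs \<in> Poly_Mapping.keys c \<Longrightarrow> \<phi> (Poly_Mapping.single xs g) \<in> S"
  shows "\<phi> c \<in> S"
proof -
  have "\<phi> (\<Sum>x\<in>Poly_Mapping.keys c. Poly_Mapping.single x (Poly_Mapping.lookup c x)) \<in> S"
    unfolding additive.sum[OF assms(1)] using assms(3) by (intro additive_subgroup_sum[OF assms(2)]) auto
  then show ?thesis
    by (simp add: sum_singles)
qed

text \<open>Unlike \<open>boundary\<close>, this is the augmented boundary: it sends \<open>[x]\<close> to \<open>[]\<close>.\<close>

definition augmented_boundary :: "('v list \<Rightarrow>\<^sub>0 'g::ab_group_add) \<Rightarrow> ('v list \<Rightarrow>\<^sub>0 'g)"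
  where "augmented_boundary = linear_extension (\<lambda>xs g. face_sum xs (\<lambda>ys. Poly_Mapping.single ys g))"

definition prism :: "('v \<Rightarrow> 'w) \<Rightarrow> ('v \<Rightarrow> 'w) \<Rightarrow> ('v list \<Rightarrow>\<^sub>0 'g::ab_group_add) \<Rightarrow> ('w list \<Rightarrow>\<^sub>0 'g)"
  where "prism p q = linear_extension (\<lambda>xs g. prism_sum p q xs (\<lambda>ys. Poly_Mapping.single ys g))"

lemma face_sum_add: "face_sum xs (\<lambda>ys. f ys + g ys) = face_sum xs f + face_sum xs g"
  by (induction xs arbitrary: f g) (auto simp: algebra_simps)

lemma prism_sum_add: "prism_sum p q xs (\<lambda>ys. f ys + g ys) = prism_sum p q xs f + prism_sum p q xs g"
  by (induction xs arbitrary: f g) (auto simp: algebra_simps)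

lemma additive_face_single: "Modules.additive (\<lambda>g. face_sum xs (\<lambda>ys. Poly_Mapping.single ys g))"
  by standard (simp add: single_add face_sum_add)

lemma additive_prism_single: "Modules.additive (\<lambda>g. prism_sum p q xs (\<lambda>ys. Poly_Mapping.single ys g))"
  by standard (simp add: single_add prism_sum_add)

lemma additive_map_single: "Modules.additive (\<lambda>g. Poly_Mapping.single (map p xs) g)"
  by standard (simp add: single_add)

lemma chain_map_of_eq: "chain_map_of p = linear_extension (\<lambda>xs g. Poly_Mapping.single (map p xs) g)"
  by (simp add: chain_map_of_def linear_extension_def fun_eq_iff)

lemma additive_augmented_boundary: "Modules.additive augmented_boundary"
  unfolding augmented_boundary_def by (intro additive_linear_extension additive_face_single)

lemma additive_prism: "Modules.additive (prism p q)"
  unfolding prism_def by (intro additive_linear_extension additive_prism_single)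

lemma additive_chain_map_of: "Modules.additive (chain_map_of p)"
  unfolding chain_map_of_eq by (intro additive_linear_extension additive_map_single)

lemma augmented_boundary_single:
  "augmented_boundary (Poly_Mapping.single xs g) = face_sum xs (\<lambda>ys. Poly_Mapping.single ys g)"
  unfolding augmented_boundary_def by (rule linear_extension_single) (rule additive_face_single)

lemma prism_single:
  "prism p q (Poly_Mapping.single xs g) = prism_sum p q xs (\<lambda>ys. Poly_Mapping.single ys g)"
  unfolding prism_def by (rule linear_extension_single) (rule additive_prism_single)

lemma chain_map_of_single:
  "chain_map_of p (Poly_Mapping.single xs g) = Poly_Mapping.single (map p xs) g"
  unfolding chain_map_of_eq by (rule linear_extension_single) (rule additive_map_single)

lemma additive_compose: "Modules.additive f \<Longrightarrow> Modules.additive g \<Longrightarrow> Modules.additive (\<lambda>x. f (g x))"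
  by (simp add: Modules.additive_def)

lemma additive_plus: "Modules.additive f \<Longrightarrow> Modules.additive g \<Longrightarrow> Modules.additive (\<lambda>x. f x + g x)"
  and additive_minus: "Modules.additive f \<Longrightarrow> Modules.additive g \<Longrightarrow> Modules.additive (\<lambda>x. f x - g x)"
  by (simp_all add: Modules.additive_def algebra_simps)

lemma additive_zero_map: "Modules.additive (\<lambda>x. 0)"
  and additive_ident: "Modules.additive (\<lambda>x. x)"
  by (simp_all add: Modules.additive_def)

lemma augmented_boundary_squared: "augmented_boundary (augmented_boundary c) = 0"
  by (rule additive_eqI[OF additive_compose[OF additive_augmented_boundary additive_augmented_boundary]
        additive_zero_map])
    (simp add: augmented_boundary_single face_sum_additive[OF additive_augmented_boundary] face_sum_face_sum)

lemma chain_map_of_augmented_boundary: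
  "chain_map_of p (augmented_boundary c) = augmented_boundary (chain_map_of p c)"
  by (rule additive_eqI[OF additive_compose[OF additive_chain_map_of additive_augmented_boundary]
        additive_compose[OF additive_augmented_boundary additive_chain_map_of]])
    (simp add: augmented_boundary_single chain_map_of_single face_sum_additive[OF additive_chain_map_of]
      face_sum_map)

lemma prism_homotopy:
  fixes c :: "'v list \<Rightarrow>\<^sub>0 'g::ab_group_add"
  shows "augmented_boundary (prism p q c) + prism p q (augmented_boundary c) = chain_map_of q c - chain_map_of p c"
proof (rule additive_eqI[of "\<lambda>c. augmented_boundary (prism p q c) + prism p q (augmented_boundary c)"
      "\<lambda>c. chain_map_of q c - chain_map_of p c"])
  fix xs and g :: 'g
  show "augmented_boundary (prism p q (Poly_Mapping.single xs g)) + prism p q (augmented_boundary (Poly_Mapping.single xs g))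
    = chain_map_of q (Poly_Mapping.single xs g) - chain_map_of p (Poly_Mapping.single xs g)"
    using prism_identity[of xs p q "\<lambda>ys. Poly_Mapping.single ys g"]
    by (simp add: augmented_boundary_single chain_map_of_single prism_single
      face_sum_additive[OF additive_prism] prism_sum_additive[OF additive_augmented_boundary] add.commute)
qed (rule additive_plus[OF additive_compose[OF additive_augmented_boundary additive_prism]
        additive_compose[OF additive_prism additive_augmented_boundary]]
      additive_minus[OF additive_chain_map_of additive_chain_map_of])+

lemma chain_map_of_comp: "chain_map_of p (chain_map_of q c) = chain_map_of (p \<circ> q) c"
  by (rule additive_eqI[OF additive_compose[OF additive_chain_map_of additive_chain_map_of] additive_chain_map_of])
    (simp add: chain_map_of_single)

lemma chain_map_of_id: "chain_map_of (\<lambda>x. x) c = c"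
  by (rule additive_eqI[OF additive_chain_map_of additive_ident]) (simp add: chain_map_of_single)

lemma boundary_eq:
  assumes "c \<in> chains n K"
  shows "boundary n c = (if n = 0 then 0 else augmented_boundary c)"
proof -
  have "(\<Sum>i\<le>n. Poly_Mapping.single (face i xs) (alt_sign i g))
    = face_sum xs (\<lambda>ys. Poly_Mapping.single ys g)" if "xs \<in> Poly_Mapping.keys c" for xs g
  proof -
    have "length xs = Suc n"
      using assms that by (auto simp: chains_def ordered_simplices_def)
    then show ?thesis
      unfolding face_sum_eq by (intro sum.cong) (auto simp: alt_sign_def single_uminus)
  qed
  then show ?thesis
    by (auto simp: boundary_def augmented_boundary_def linear_extension_def intro!: sum.cong)
qed

text \<open>The key set is arbitrary because augmented boundaries of 0-chains, which are supported
  on \<open>[]\<close>, are handled by it as well as chains.\<close>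

lemma additive_subgroup_keys:
  "additive_subgroup {c :: 'a \<Rightarrow>\<^sub>0 'b::ab_group_add. Poly_Mapping.keys c \<subseteq> A}"
proof -
  have "Poly_Mapping.keys (c - d) \<subseteq> Poly_Mapping.keys c \<union> Poly_Mapping.keys d"
    for c d :: "'a \<Rightarrow>\<^sub>0 'b"
    by (auto simp: in_keys_iff lookup_minus)
  then show ?thesis
    unfolding additive_subgroup_def by fastforce
qed

lemma additive_subgroup_chains: "additive_subgroup (chains n K)"
  unfolding chains_def by (rule additive_subgroup_keys)

lemma single_chains: "xs \<in> ordered_simplices n K \<Longrightarrow> Poly_Mapping.single xs g \<in> chains n K"
  by (auto simp: chains_def)

lemma chains_mono: "L \<subseteq> K \<Longrightarrow> chains n L \<subseteq> chains n K"
  by (auto simp: chains_def ordered_simplices_def)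

lemma augmented_boundary_chains:
  assumes "simplicial_pair K K" "c \<in> chains (Suc n) K"
  shows "augmented_boundary c \<in> chains n K"
proof (rule additive_memI[OF additive_augmented_boundary additive_subgroup_chains])
  fix xs g assume "xs \<in> Poly_Mapping.keys c"
  then have "xs \<in> ordered_simplices (Suc n) K"
    using assms by (auto simp: chains_def)
  then show "augmented_boundary (Poly_Mapping.single xs g) \<in> chains n K"
    using assms unfolding augmented_boundary_single
    by (intro face_sum_mem additive_subgroup_chains single_chains face_ordered_simplices) auto
qed

lemma prism_chains:
  assumes "simplicial_pair K' K'" "\<And>s. s \<in> K \<Longrightarrow> p ` s \<union> q ` s \<in> K'" "c \<in> chains n K"
  shows "prism p q c \<in> chains (Suc n) K'"
proof (rule additive_memI[OF additive_prism additive_subgroup_chains])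
  fix xs g assume "xs \<in> Poly_Mapping.keys c"
  then have "xs \<in> ordered_simplices n K"
    using assms by (auto simp: chains_def)
  then show "prism p q (Poly_Mapping.single xs g) \<in> chains (Suc n) K'"
    using assms unfolding prism_single
    by (intro prism_sum_mem additive_subgroup_chains single_chains prism_ordered_simplices[of K' K]) auto
qed

lemma chain_map_of_chains:
  assumes "\<And>s. s \<in> K \<Longrightarrow> p ` s \<in> K'" "c \<in> chains n K"
  shows "chain_map_of p c \<in> chains n K'"
proof (rule additive_memI[OF additive_chain_map_of additive_subgroup_chains])
  fix xs g assume "xs \<in> Poly_Mapping.keys c"
  then have "xs \<in> ordered_simplices n K"
    using assms by (auto simp: chains_def)
  then show "chain_map_of p (Poly_Mapping.single xs g) \<in> chains n K'"
    using assms unfolding chain_map_of_single by (intro single_chains map_ordered_simplices[of K]) auto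
qed

text \<open>In degree 0 the condition is void: \<open>boundary 0\<close> is zero, and the truncated
  degree \<open>0 - 1\<close> is again 0.\<close>

definition rel_cycles :: "nat \<Rightarrow> 'v set set \<Rightarrow> 'v set set \<Rightarrow> ('v list \<Rightarrow>\<^sub>0 'g::ab_group_add) set"
  where "rel_cycles n K L = {c \<in> chains n K. boundary n c \<in> chains (n - 1) L}"

lemma rel_cycle_group_eq: "rel_cycle_group n K L = additive_group (rel_cycles n K L)"
  by (simp add: rel_cycle_group_def additive_group_def rel_cycles_def)

lemma boundary_diff:
  assumes "c \<in> chains n K" "d \<in> chains n K"
  shows "boundary n (c - d) = boundary n c - boundary n d"
  using assms additive_subgroupD(2)[OF additive_subgroup_chains assms]
  by (simp add: boundary_eq additive.diff[OF additive_augmented_boundary])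

lemma additive_subgroup_rel_cycles: "additive_subgroup (rel_cycles n K L)"
  using additive_subgroupD[OF additive_subgroup_chains]
  unfolding additive_subgroup_def rel_cycles_def
  by (auto simp: boundary_diff boundary_def[of n 0])

lemma additive_subgroup_rel_boundaries:
  fixes K :: "'v set set"
  shows "additive_subgroup (rel_boundaries n K L :: ('v list \<Rightarrow>\<^sub>0 'g::ab_group_add) set)"
  unfolding additive_subgroup_def
proof (intro conjI ballI)
  have "boundary (Suc n) 0 + 0 \<in> rel_boundaries n K L"
    unfolding rel_boundaries_def using additive_subgroupD(1)[OF additive_subgroup_chains] by blast
  then show "0 \<in> rel_boundaries n K L"
    by (simp add: boundary_def)
next
  fix x y :: "'v list \<Rightarrow>\<^sub>0 'g" assume "x \<in> rel_boundaries n K L" "y \<in> rel_boundaries n K L"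
  then obtain d e d' e' where
    d: "d \<in> chains (Suc n) K" "d' \<in> chains (Suc n) K" and e: "e \<in> chains n L" "e' \<in> chains n L"
    and xy: "x = boundary (Suc n) d + e" "y = boundary (Suc n) d' + e'"
    by (auto simp: rel_boundaries_def)
  have "x - y = boundary (Suc n) (d - d') + (e - e')"
    by (simp add: xy boundary_diff[OF d])
  then show "x - y \<in> rel_boundaries n K L"
    unfolding rel_boundaries_def
    using additive_subgroupD(2)[OF additive_subgroup_chains] d e by blast
qed

lemma rel_boundaries_subset:
  assumes "simplicial_pair K L"
  shows "rel_boundaries n K L \<subseteq> rel_cycles n K L"
proof
  fix x assume "x \<in> rel_boundaries n K L"
  then obtain d e where d: "d \<in> chains (Suc n) K" and e: "e \<in> chains n L"
    and x: "x = augmented_boundary d + e"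
    by (auto simp: rel_boundaries_def boundary_eq)
  note K = simplicial_pair_absolute[OF assms] and L = simplicial_pair_sub[OF assms]
  have eK: "e \<in> chains n K"
    using e chains_mono[of L K n] assms by (auto simp: simplicial_pair_def)
  have xK: "x \<in> chains n K"
    unfolding x by (intro additive_subgroupD(4)[OF additive_subgroup_chains] augmented_boundary_chains K d eK)
  have "boundary n x \<in> chains (n - 1) L"
  proof (cases n)
    case 0
    then show ?thesis
      using additive_subgroupD(1)[OF additive_subgroup_chains] by (simp add: boundary_def)
  next
    case (Suc m)
    then have "boundary n x = augmented_boundary x"
      unfolding boundary_eq[OF xK] by simp
    then have "boundary n x = augmented_boundary e"
      by (simp add: x additive.add[OF additive_augmented_boundary] augmented_boundary_squared)
    then show ?thesis
      using augmented_boundary_chains[OF L] e Suc by simp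
  qed
  then show "x \<in> rel_cycles n K L"
    using xK by (simp add: rel_cycles_def)
qed

lemma group_simp_homology:
  assumes "simplicial_pair K L"
  shows "group (simp_homology n K L)"
  unfolding simp_homology_def rel_cycle_group_eq
  by (intro group_additive_quotient additive_subgroup_rel_cycles additive_subgroup_rel_boundaries
      rel_boundaries_subset assms)

lemma carrier_simp_homology: "carrier (simp_homology n K L) = coset (rel_boundaries n K L) ` rel_cycles n K L"
  unfolding simp_homology_def rel_cycle_group_eq by (rule carrier_additive_quotient)

lemma one_simp_homology: "\<one>\<^bsub>simp_homology n K L\<^esub> = rel_boundaries n K L"
  by (simp add: simp_homology_def)

lemma chain_map_of_rel_cycles:
  assumes "contiguous K L K' L' p p" "c \<in> rel_cycles n K L"
  shows "chain_map_of p c \<in> rel_cycles n K' L'"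
proof -
  have c: "c \<in> chains n K" "boundary n c \<in> chains (n - 1) L"
    using assms by (auto simp: rel_cycles_def)
  have pc: "chain_map_of p c \<in> chains n K'"
    using assms c by (intro chain_map_of_chains[of K]) (auto simp: contiguous_refl_iff)
  have "boundary n (chain_map_of p c) = chain_map_of p (boundary n c)"
    by (simp add: boundary_eq[OF c(1)] boundary_eq[OF pc] chain_map_of_augmented_boundary
        additive.zero[OF additive_chain_map_of])
  also have "\<dots> \<in> chains (n - 1) L'"
    using assms c by (intro chain_map_of_chains[of L]) (auto simp: contiguous_refl_iff)
  finally show ?thesis
    using pc by (simp add: rel_cycles_def)
qed

lemma chain_map_of_rel_boundaries:
  assumes "contiguous K L K' L' p p"
  shows "chain_map_of p ` rel_boundaries n K L \<subseteq> rel_boundaries n K' L'"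
proof
  fix y assume "y \<in> chain_map_of p ` rel_boundaries n K L"
  then obtain d e where d: "d \<in> chains (Suc n) K" and e: "e \<in> chains n L"
    and y: "y = chain_map_of p (augmented_boundary d + e)"
    by (auto simp: rel_boundaries_def boundary_eq)
  have pd: "chain_map_of p d \<in> chains (Suc n) K'"
    using assms d by (intro chain_map_of_chains[of K]) (auto simp: contiguous_refl_iff)
  have pe: "chain_map_of p e \<in> chains n L'"
    using assms e by (intro chain_map_of_chains[of L]) (auto simp: contiguous_refl_iff)
  have "y = boundary (Suc n) (chain_map_of p d) + chain_map_of p e"
    by (simp add: y boundary_eq[OF pd] additive.add[OF additive_chain_map_of] chain_map_of_augmented_boundary)
  then show "y \<in> rel_boundaries n K' L'"
    unfolding rel_boundaries_def using pd pe by blast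
qed

lemma homology_induced_coset:
  assumes "contiguous K L K' L' p p"
  shows "homology_induced n K' L' p (coset (rel_boundaries n K L) c) =
    coset (rel_boundaries n K' L') (chain_map_of p c)"
  unfolding homology_induced_def rel_cycle_group_eq
  by (intro set_mult_image_coset additive_subgroup_rel_boundaries additive_chain_map_of
      chain_map_of_rel_boundaries assms)

text \<open>By the homotopy formula the difference is the boundary of the prism over
  \<open>c\<close> plus the prism over the boundary of \<open>c\<close>. Contiguity on
  \<open>K\<close> puts the first prism in \<open>K'\<close>; the boundary of \<open>c\<close> lies
  in \<open>L\<close>, so contiguity on \<open>L\<close> puts the second in
  \<open>L'\<close>.\<close>

lemma chain_map_of_contiguous:
  assumes pq: "contiguous K L K' L' p q" and K': "simplicial_pair K' L'"
    and c: "c \<in> rel_cycles n K L"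
  shows "chain_map_of q c - chain_map_of p c \<in> rel_boundaries n K' L'"
proof -
  have cK: "c \<in> chains n K" and bc: "boundary n c \<in> chains (n - 1) L"
    using c by (auto simp: rel_cycles_def)
  have pK: "prism p q c \<in> chains (Suc n) K'"
    using pq simplicial_pair_absolute[OF K'] cK by (intro prism_chains[of K' K]) (auto simp: contiguous_def)
  have "prism p q (augmented_boundary c) \<in> chains n L'"
  proof (cases n)
    case 0
    \<comment> \<open>In degree 0 the augmented boundary may differ from \<open>boundary\<close>. It
      is a multiple of the generator \<open>[]\<close>, and the prism over the empty list is
      zero.\<close>
    have "Poly_Mapping.keys (augmented_boundary c) \<subseteq> {[]}"
    proof -
      have "augmented_boundary c \<in> {d. Poly_Mapping.keys d \<subseteq> {[]}}"
      proof (rule additive_memI[OF additive_augmented_boundary additive_subgroup_keys])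
        fix xs g assume "xs \<in> Poly_Mapping.keys c"
        then obtain x where "xs = [x]"
          using cK 0 by (auto simp: chains_def ordered_simplices_def length_Suc_conv)
        then show "augmented_boundary (Poly_Mapping.single xs g) \<in> {d. Poly_Mapping.keys d \<subseteq> {[]}}"
          by (simp add: augmented_boundary_single)
      qed
      then show ?thesis
        by simp
    qed
    then have "prism p q (augmented_boundary c) = 0"
      by (rule_tac additive_eqI[OF additive_prism additive_zero_map]) (auto simp: prism_single)
    then show ?thesis
      using additive_subgroupD(1)[OF additive_subgroup_chains] by simp
  next
    case (Suc m)
    then show ?thesis
      using prism_chains[of L' L p q "boundary n c" m] bc pq simplicial_pair_sub[OF K'] boundary_eq[OF cK]
      by (auto simp: contiguous_def)
  qed
  moreover have "chain_map_of q c - chain_map_of p c = boundary (Suc n) (prism p q c) + prism p q (augmented_boundary c)"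
    by (simp add: boundary_eq[OF pK] prism_homotopy)
  ultimately show ?thesis
    unfolding rel_boundaries_def using pK by blast
qed

lemma homology_induced_closed:
  assumes "contiguous K L K' L' p p" "S \<in> carrier (simp_homology n K L)"
  shows "homology_induced n K' L' p S \<in> carrier (simp_homology n K' L')"
  using assms chain_map_of_rel_cycles[OF assms(1)]
  by (auto simp: carrier_simp_homology homology_induced_coset[OF assms(1)] intro!: imageI)

lemma homology_induced_one:
  assumes "contiguous K L K' L' p p"
  shows "homology_induced n K' L' p \<one>\<^bsub>simp_homology n K L\<^esub> = \<one>\<^bsub>simp_homology n K' L'\<^esub>"
  using homology_induced_coset[OF assms, of n 0]
  by (simp add: one_simp_homology additive.zero[OF additive_chain_map_of])

lemma homology_induced_contiguous:
  assumes pq: "contiguous K L K' L' p q" and K: "simplicial_pair K L" and K': "simplicial_pair K' L'"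
    and S: "S \<in> carrier (simp_homology n K L)"
  shows "homology_induced n K' L' q S = homology_induced n K' L' p S"
proof -
  obtain c where c: "c \<in> rel_cycles n K L" "S = coset (rel_boundaries n K L) c"
    using S by (auto simp: carrier_simp_homology)
  have "coset (rel_boundaries n K' L') (chain_map_of q c) = coset (rel_boundaries n K' L') (chain_map_of p c)"
    by (intro coset_eqI additive_subgroup_rel_boundaries chain_map_of_contiguous[OF pq K' c(1)])
  then show ?thesis
    unfolding c(2) using homology_induced_coset contiguous_simplicial[OF pq K K'] by metis
qed

lemma homology_induced_comp:
  assumes p: "contiguous K' L' K'' L'' p p" and q: "contiguous K L K' L' q q"
    and S: "S \<in> carrier (simp_homology n K L)"
  shows "homology_induced n K'' L'' p (homology_induced n K' L' q S) = homology_induced n K'' L'' (p \<circ> q) S"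
proof -
  have "contiguous K L K'' L'' (p \<circ> q) (p \<circ> q)"
    using p q unfolding contiguous_refl_iff by (metis image_comp)
  then show ?thesis
    using S by (auto simp: carrier_simp_homology homology_induced_coset[OF p] homology_induced_coset[OF q]
        homology_induced_coset chain_map_of_comp)
qed

lemma homology_induced_id:
  assumes "S \<in> carrier (simp_homology n K L)"
  shows "homology_induced n K L (\<lambda>x. x) S = S"
proof -
  have "contiguous K L K L (\<lambda>x. x) (\<lambda>x. x)"
    by (simp add: contiguous_refl_iff)
  then show ?thesis
    using assms by (auto simp: carrier_simp_homology homology_induced_coset chain_map_of_id)
qed

subsection \<open>Cohomology\<close>

definition rel_cocycles :: "nat \<Rightarrow> 'v set set \<Rightarrow> 'v set set \<Rightarrow> ('v list \<Rightarrow> 'g::ab_group_add) set"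
  where "rel_cocycles n K L = {f \<in> rel_cochains n K L. coboundary n K f = 0}"

lemma rel_cocycle_group_eq: "rel_cocycle_group n K L = additive_group (rel_cocycles n K L)"
  by (simp add: rel_cocycle_group_def additive_group_def rel_cocycles_def fun_eq_iff)

lemma coboundary_eq:
  "coboundary n K f = (\<lambda>xs. if xs \<in> ordered_simplices (Suc n) K then face_sum xs f else 0)"
  unfolding coboundary_def
proof (rule ext, intro if_cong refl)
  fix xs assume "xs \<in> ordered_simplices (Suc n) K"
  then have "length xs = Suc (Suc n)"
    by (simp add: ordered_simplices_def)
  then show "(\<Sum>i\<le>Suc n. alt_sign i (f (face i xs))) = face_sum xs f"
    unfolding face_sum_eq by (intro sum.cong) auto
qed

lemma additive_coboundary: "Modules.additive (coboundary n K)"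
  unfolding coboundary_eq by standard (auto simp: fun_eq_iff plus_fun_def face_sum_add)

lemma additive_cochain_map_of: "Modules.additive (cochain_map_of n K p)"
  unfolding cochain_map_of_def by standard (auto simp: fun_eq_iff)

lemma additive_subgroup_rel_cochains: "additive_subgroup (rel_cochains n K L)"
  by (auto simp: additive_subgroup_def rel_cochains_def fun_diff_def)

lemma additive_subgroup_image:
  assumes "Modules.additive \<phi>" "additive_subgroup S"
  shows "additive_subgroup (\<phi> ` S)"
  unfolding additive_subgroup_def
proof (intro conjI ballI)
  show "0 \<in> \<phi> ` S"
    using additive_subgroupD(1)[OF assms(2)] additive.zero[OF assms(1)] by (metis imageI)
  fix x y assume "x \<in> \<phi> ` S" "y \<in> \<phi> ` S"
  then show "x - y \<in> \<phi> ` S"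
    using additive_subgroupD(2)[OF assms(2)] by (auto simp flip: additive.diff[OF assms(1)])
qed

lemma additive_subgroup_rel_cocycles: "additive_subgroup (rel_cocycles n K L)"
  using additive_subgroupD(1,2)[OF additive_subgroup_rel_cochains]
  by (auto simp: additive_subgroup_def rel_cocycles_def
      additive.zero[OF additive_coboundary] additive.diff[OF additive_coboundary])

lemma rel_coboundaries_eq:
  "rel_coboundaries n K L = (case n of 0 \<Rightarrow> {0} | Suc m \<Rightarrow> coboundary m K ` rel_cochains m K L)"
  by (auto simp: rel_coboundaries_def zero_fun_def split: nat.split)

lemma additive_subgroup_rel_coboundaries: "additive_subgroup (rel_coboundaries n K L)"
  by (auto simp: rel_coboundaries_eq additive_subgroup_zero
      intro!: additive_subgroup_image additive_coboundary additive_subgroup_rel_cochains split: nat.split)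

lemma rel_cochains_zero: "f \<in> rel_cochains n K L \<Longrightarrow> xs \<in> ordered_simplices n L \<Longrightarrow> f xs = 0"
  by (auto simp: rel_cochains_def)

lemma coboundary_rel_cochains:
  assumes L: "simplicial_pair L L" and f: "f \<in> rel_cochains n K L"
  shows "coboundary n K f \<in> rel_cochains (Suc n) K L"
proof -
  have "face_sum xs f = 0" if "xs \<in> ordered_simplices (Suc n) L" for xs
  proof -
    have "face_sum xs f \<in> {0}"
      using face_ordered_simplices[OF L that] rel_cochains_zero[OF f]
      by (intro face_sum_mem additive_subgroup_zero) auto
    then show ?thesis
      by simp
  qed
  then show ?thesis
    by (auto simp: rel_cochains_def coboundary_eq)
qed

lemma coboundary_squared:
  assumes "simplicial_pair K K"
  shows "coboundary (Suc n) K (coboundary n K f) = 0"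
proof
  fix xs
  \<comment> \<open>The inner coboundary is cut off to zero outside \<open>K\<close>, but every face
    of \<open>xs\<close> lies in \<open>K\<close>.\<close>
  have "face_sum xs (coboundary n K f) = face_sum xs (\<lambda>ys. face_sum ys f)"
    if "xs \<in> ordered_simplices (Suc (Suc n)) K"
    using face_ordered_simplices[OF assms that] by (intro face_sum_cong) (simp add: coboundary_eq)
  then show "coboundary (Suc n) K (coboundary n K f) xs = 0 xs"
    by (simp add: coboundary_eq[of "Suc n"] face_sum_face_sum)
qed

lemma rel_coboundaries_subset:
  assumes "simplicial_pair K L"
  shows "rel_coboundaries n K L \<subseteq> rel_cocycles n K L"
  using additive_subgroupD(1)[OF additive_subgroup_rel_cocycles]
    coboundary_rel_cochains[OF simplicial_pair_sub[OF assms]]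
    coboundary_squared[OF simplicial_pair_absolute[OF assms]]
  by (cases n) (auto simp: rel_coboundaries_eq rel_cocycles_def)

lemma group_simp_cohomology:
  assumes "simplicial_pair K L"
  shows "group (simp_cohomology n K L)"
  unfolding simp_cohomology_def rel_cocycle_group_eq
  by (intro group_additive_quotient additive_subgroup_rel_cocycles additive_subgroup_rel_coboundaries
      rel_coboundaries_subset assms)

lemma carrier_simp_cohomology:
  "carrier (simp_cohomology n K L) = coset (rel_coboundaries n K L) ` rel_cocycles n K L"
  unfolding simp_cohomology_def rel_cocycle_group_eq by (rule carrier_additive_quotient)

lemma one_simp_cohomology: "\<one>\<^bsub>simp_cohomology n K L\<^esub> = rel_coboundaries n K L"
  by (simp add: simp_cohomology_def)

lemma cochain_map_of_rel_cochains:
  assumes p: "contiguous K L K' L' p p" and f: "f \<in> rel_cochains n K' L'"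
  shows "cochain_map_of n K p f \<in> rel_cochains n K L"
proof -
  have "f (map p xs) = 0" if "xs \<in> ordered_simplices n L" for xs
    using map_ordered_simplices[of L p L' xs n] that p rel_cochains_zero[OF f]
    by (auto simp: contiguous_refl_iff)
  then show ?thesis
    by (auto simp: rel_cochains_def cochain_map_of_def)
qed

lemma coboundary_cochain_map_of:
  assumes K: "simplicial_pair K K" and p: "contiguous K L K' L' p p"
  shows "coboundary n K (cochain_map_of n K p f) = cochain_map_of (Suc n) K p (coboundary n K' f)"
proof
  fix xs
  show "coboundary n K (cochain_map_of n K p f) xs = cochain_map_of (Suc n) K p (coboundary n K' f) xs"
  proof (cases "xs \<in> ordered_simplices (Suc n) K")
    case True
    then have "map p xs \<in> ordered_simplices (Suc n) K'"
      using p by (intro map_ordered_simplices[of K]) (auto simp: contiguous_refl_iff)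
    moreover have "face_sum xs (cochain_map_of n K p f) = face_sum xs (\<lambda>ys. f (map p ys))"
      using face_ordered_simplices[OF K True] by (intro face_sum_cong) (simp add: cochain_map_of_def)
    ultimately show ?thesis
      using True by (simp add: coboundary_eq cochain_map_of_def[of "Suc n"] face_sum_map)
  qed (simp add: coboundary_eq cochain_map_of_def)
qed

lemma cochain_map_of_rel_cocycles:
  assumes "simplicial_pair K K" "contiguous K L K' L' p p" "f \<in> rel_cocycles n K' L'"
  shows "cochain_map_of n K p f \<in> rel_cocycles n K L"
  using assms
  by (simp add: rel_cocycles_def cochain_map_of_rel_cochains[OF assms(2)] coboundary_cochain_map_of[OF assms(1,2)]
      additive.zero[OF additive_cochain_map_of])

lemma cochain_map_of_rel_coboundaries:
  assumes "simplicial_pair K K" "contiguous K L K' L' p p"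
  shows "cochain_map_of n K p ` rel_coboundaries n K' L' \<subseteq> rel_coboundaries n K L"
  by (cases n) (auto simp: rel_coboundaries_eq additive.zero[OF additive_cochain_map_of]
      intro!: imageI cochain_map_of_rel_cochains[OF assms(2)] simp flip: coboundary_cochain_map_of[OF assms])

lemma cohomology_induced_coset:
  assumes "simplicial_pair K K" "contiguous K L K' L' p p"
  shows "cohomology_induced n K L p (coset (rel_coboundaries n K' L') f) =
    coset (rel_coboundaries n K L) (cochain_map_of n K p f)"
  unfolding cohomology_induced_def rel_cocycle_group_eq
  by (intro set_mult_image_coset additive_subgroup_rel_coboundaries additive_cochain_map_of
      cochain_map_of_rel_coboundaries assms)

text \<open>In \<open>prism_identity\<close> for the cocycle \<open>f\<close> the sum over faces of
  prisms vanishes, as these prisms lie in \<open>K'\<close>. What remains exhibits the difference as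
  the coboundary of the transposed prism operator applied to \<open>f\<close>.\<close>

lemma cochain_map_of_contiguous:
  assumes pq: "contiguous K L K' L' p q" and K: "simplicial_pair K L" and K': "simplicial_pair K' L'"
    and f: "f \<in> rel_cocycles n K' L'"
  shows "cochain_map_of n K q f - cochain_map_of n K p f \<in> rel_coboundaries n K L"
proof -
  have fc: "f \<in> rel_cochains n K' L'" and df: "coboundary n K' f = 0"
    using f by (auto simp: rel_cocycles_def)
  have cocycle: "face_sum ys f = 0" if "ys \<in> ordered_simplices (Suc n) K'" for ys
    using fun_cong[OF df, of ys] that by (simp add: coboundary_eq)
  have diff: "f (map q xs) - f (map p xs) = face_sum xs (\<lambda>ys. prism_sum p q ys f)"
    if "xs \<in> ordered_simplices n K" for xs
  proof -
    have "prism_sum p q xs (\<lambda>ys. face_sum ys f) \<in> {0}"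
      using cocycle prism_ordered_simplices[OF simplicial_pair_absolute[OF K'], of K p q xs n] pq that
      by (intro prism_sum_mem additive_subgroup_zero) (auto simp: contiguous_def)
    then show ?thesis
      using prism_identity[of xs p q f] by simp
  qed
  show ?thesis
  proof (cases n)
    case 0
    \<comment> \<open>The only face of \<open>[x]\<close> is the empty list, over which the prism is
      zero; so the pullbacks agree already as cochains.\<close>
    have "cochain_map_of n K q f - cochain_map_of n K p f = 0"
    proof
      fix xs
      show "(cochain_map_of n K q f - cochain_map_of n K p f) xs = 0 xs"
      proof (cases "xs \<in> ordered_simplices n K")
        case True
        then obtain x where "xs = [x]"
          using 0 by (auto simp: ordered_simplices_def length_Suc_conv)
        then show ?thesis
          using diff[OF True] True by (simp add: cochain_map_of_def)
      qed (simp add: cochain_map_of_def)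
    qed
    then show ?thesis
      using 0 by (simp add: rel_coboundaries_eq)
  next
    case (Suc m)
    define h where "h = (\<lambda>xs. if xs \<in> ordered_simplices m K then prism_sum p q xs f else 0)"
    \<comment> \<open>Prisms over simplexes of \<open>L\<close> lie in \<open>L'\<close>, where
      \<open>f\<close> vanishes; this makes \<open>h\<close> a relative cochain.\<close>
    have "prism_sum p q xs f = 0" if "xs \<in> ordered_simplices m L" for xs
    proof -
      have "prism_sum p q xs f \<in> {0}"
        using rel_cochains_zero[OF fc] Suc that pq
          prism_ordered_simplices[OF simplicial_pair_sub[OF K'], of L p q xs m]
        by (intro prism_sum_mem additive_subgroup_zero) (auto simp: contiguous_def)
      then show ?thesis
        by simp
    qed
    then have "h \<in> rel_cochains m K L"
      by (auto simp: h_def rel_cochains_def)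
    moreover have "cochain_map_of n K q f - cochain_map_of n K p f = coboundary m K h"
    proof
      fix xs
      show "(cochain_map_of n K q f - cochain_map_of n K p f) xs = coboundary m K h xs"
      proof (cases "xs \<in> ordered_simplices n K")
        case True
        have "face_sum xs (\<lambda>ys. prism_sum p q ys f) = face_sum xs h"
          using face_ordered_simplices[OF simplicial_pair_absolute[OF K], of xs m] True Suc
          by (intro face_sum_cong) (simp add: h_def)
        then show ?thesis
          using diff[OF True] True Suc by (simp add: cochain_map_of_def coboundary_eq)
      qed (use Suc in \<open>simp add: cochain_map_of_def coboundary_eq\<close>)
    qed
    ultimately show ?thesis
      using Suc by (auto simp: rel_coboundaries_eq)
  qed
qed

lemma cohomology_induced_closed:
  assumes "simplicial_pair K K" "contiguous K L K' L' p p" "S \<in> carrier (simp_cohomology n K' L')"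
  shows "cohomology_induced n K L p S \<in> carrier (simp_cohomology n K L)"
  using assms cochain_map_of_rel_cocycles[OF assms(1,2)]
  by (auto simp: carrier_simp_cohomology cohomology_induced_coset[OF assms(1,2)] intro!: imageI)

lemma cohomology_induced_one:
  assumes "simplicial_pair K K" "contiguous K L K' L' p p"
  shows "cohomology_induced n K L p \<one>\<^bsub>simp_cohomology n K' L'\<^esub> = \<one>\<^bsub>simp_cohomology n K L\<^esub>"
  using cohomology_induced_coset[OF assms, of n 0]
  by (simp add: one_simp_cohomology additive.zero[OF additive_cochain_map_of])

lemma cohomology_induced_contiguous:
  assumes pq: "contiguous K L K' L' p q" and K: "simplicial_pair K L" and K': "simplicial_pair K' L'"
    and S: "S \<in> carrier (simp_cohomology n K' L')"
  shows "cohomology_induced n K L q S = cohomology_induced n K L p S"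
proof -
  obtain f where f: "f \<in> rel_cocycles n K' L'" "S = coset (rel_coboundaries n K' L') f"
    using S by (auto simp: carrier_simp_cohomology)
  have "coset (rel_coboundaries n K L) (cochain_map_of n K q f) = coset (rel_coboundaries n K L) (cochain_map_of n K p f)"
    by (intro coset_eqI additive_subgroup_rel_coboundaries cochain_map_of_contiguous[OF pq K K' f(1)])
  then show ?thesis
    unfolding f(2) using contiguous_simplicial[OF pq K K']
    by (simp add: cohomology_induced_coset[OF simplicial_pair_absolute[OF K]])
qed

lemma cohomology_induced_comp:
  assumes K: "simplicial_pair K K" and K': "simplicial_pair K' K'"
    and p: "contiguous K' L' K'' L'' p p" and q: "contiguous K L K' L' q q"
    and S: "S \<in> carrier (simp_cohomology n K'' L'')"
  shows "cohomology_induced n K L q (cohomology_induced n K' L' p S) = cohomology_induced n K L (p \<circ> q) S"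
proof -
  have pq: "contiguous K L K'' L'' (p \<circ> q) (p \<circ> q)"
    using p q unfolding contiguous_refl_iff by (metis image_comp)
  have "cochain_map_of n K q (cochain_map_of n K' p f) = cochain_map_of n K (p \<circ> q) f" for f :: "'c list \<Rightarrow> 'd"
    using map_ordered_simplices[of K q K' _ n] q
    by (auto simp: cochain_map_of_def fun_eq_iff contiguous_refl_iff)
  then show ?thesis
    using S by (auto simp: carrier_simp_cohomology cohomology_induced_coset[OF K' p]
        cohomology_induced_coset[OF K q] cohomology_induced_coset[OF K pq])
qed

section \<open>Systems of nerves\<close>

lemma simplicial_pair_nerve:
  assumes "dverts \<alpha> \<subseteq> verts \<alpha>"
  shows "simplicial_pair (nerve \<alpha>) (subnerve A \<alpha>)"
  unfolding simplicial_pair_def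
proof (intro conjI ballI allI impI)
  have mono: "carrier_of \<alpha> s \<subseteq> carrier_of \<alpha> t" if "t \<subseteq> s" for s t
    using that by (auto simp: carrier_of_def)
  show "subnerve A \<alpha> \<subseteq> nerve \<alpha>" "{} \<notin> nerve \<alpha>"
    using assms by (auto simp: subnerve_def nerve_def)
  show "t \<in> nerve \<alpha>" if "s \<in> nerve \<alpha>" "t \<subseteq> s" "t \<noteq> {}" for s t
    using that mono[OF that(2)] by (auto simp: nerve_def dest: finite_subset)
  show "t \<in> subnerve A \<alpha>" if "s \<in> subnerve A \<alpha>" "t \<subseteq> s" "t \<noteq> {}" for s t
    using that mono[OF that(2)] by (auto simp: subnerve_def dest: finite_subset)
qed

text \<open>A point common to the members indexed by \<open>s\<close> lies in all members indexed by
  \<open>p\<close> s\<open>and by\<close>q \<open>s\<close>. So the union of the two images has a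
  carrier at least as large as that of \<open>s\<close>, and it still meets \<open>A\<close> if that
  of \<open>s\<close> does.\<close>

lemma refinement_projections_contiguous:
  assumes p: "refinement_projection \<alpha> \<beta> p" and q: "refinement_projection \<alpha> \<beta> q"
    and d: "dverts \<beta> \<subseteq> verts \<beta>"
  shows "contiguous (nerve \<beta>) (subnerve A \<beta>) (nerve \<alpha>) (subnerve A \<alpha>) p q"
proof -
  have verts: "p ` verts \<beta> \<subseteq> verts \<alpha>" "q ` verts \<beta> \<subseteq> verts \<alpha>"
    and dverts: "p ` dverts \<beta> \<subseteq> dverts \<alpha>" "q ` dverts \<beta> \<subseteq> dverts \<alpha>"
    using p q by (auto simp: refinement_projection_def)
  have sub: "carrier_of \<beta> s \<subseteq> carrier_of \<alpha> (p ` s \<union> q ` s)" if "s \<subseteq> verts \<beta>" for s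
    using that p q by (fastforce simp: carrier_of_def refinement_projection_def)
  have "p ` s \<union> q ` s \<in> nerve \<alpha>" if s: "s \<in> nerve \<beta>" for s
  proof -
    have "s \<subseteq> verts \<beta>" "carrier_of \<beta> s \<noteq> {}" "finite s" "s \<noteq> {}"
      using s by (auto simp: nerve_def)
    moreover from this have "p ` s \<union> q ` s \<subseteq> verts \<alpha>"
      using verts by auto
    ultimately show ?thesis
      using sub[of s] by (auto simp: nerve_def)
  qed
  moreover have "p ` s \<union> q ` s \<in> subnerve A \<alpha>" if s: "s \<in> subnerve A \<beta>" for s
  proof -
    have "s \<subseteq> dverts \<beta>" "carrier_of \<beta> s \<inter> A \<noteq> {}" "finite s" "s \<noteq> {}"
      using s by (auto simp: subnerve_def)
    moreover from this have "p ` s \<union> q ` s \<subseteq> dverts \<alpha>" "s \<subseteq> verts \<beta>"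
      using dverts d by auto
    moreover from this have "carrier_of \<alpha> (p ` s \<union> q ` s) \<inter> A \<noteq> {}"
      using sub[of s] \<open>carrier_of \<beta> s \<inter> A \<noteq> {}\<close> by auto
    ultimately show ?thesis
      by (simp add: subnerve_def)
  qed
  ultimately show ?thesis
    by (simp add: contiguous_def)
qed

lemma refinement_projection_id: "refinement_projection \<alpha> \<alpha> (\<lambda>v. v)"
  by (simp add: refinement_projection_def)

lemma refinement_projection_comp:
  assumes "refinement_projection \<alpha> \<beta> p" "refinement_projection \<beta> \<gamma> q"
  shows "refinement_projection \<alpha> \<gamma> (p \<circ> q)"
  using assms by (fastforce simp: refinement_projection_def)

lemma some_projection: "refined_by \<alpha> \<beta> \<Longrightarrow> refinement_projection \<alpha> \<beta> (some_projection \<alpha> \<beta>)"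
  unfolding refined_by_def some_projection_def by (metis someI_ex)

locale family_system =
  fixes \<C> :: "('v, 'a) family set"
  assumes nonempty: "\<C> \<noteq> {}"
    and dverts: "\<alpha> \<in> \<C> \<Longrightarrow> dverts \<alpha> \<subseteq> verts \<alpha>"
    and directed: "\<lbrakk>\<alpha> \<in> \<C>; \<beta> \<in> \<C>\<rbrakk> \<Longrightarrow> \<exists>\<gamma>\<in>\<C>. refined_by \<alpha> \<gamma> \<and> refined_by \<beta> \<gamma>"
begin

sublocale directed_preorder \<C> refined_by
proof
  show "refined_by \<alpha> \<alpha>" for \<alpha> :: "('v, 'a) family"
    using refinement_projection_id by (auto simp: refined_by_def)
  show "refined_by \<alpha> \<gamma>" if "refined_by \<alpha> \<beta>" "refined_by \<beta> \<gamma>" for \<alpha> \<beta> \<gamma> :: "('v, 'a) family"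
    using that unfolding refined_by_def by (blast intro: refinement_projection_comp)
qed (use nonempty directed in auto)

text \<open>The projections picked by \<open>some_projection\<close> need not compose to the picked
  one. The composite is nevertheless a refinement projection, hence contiguous to the picked one,
  and both induce the same map.\<close>

lemma homology_system:
  "inverse_system \<C> refined_by (\<lambda>\<alpha>. simp_homology n (nerve \<alpha>) (subnerve A \<alpha>))
    (\<lambda>\<alpha> \<beta>. homology_induced n (nerve \<alpha>) (subnerve A \<alpha>) (some_projection \<alpha> \<beta>)
      :: ('v list \<Rightarrow>\<^sub>0 'g::ab_group_add) set \<Rightarrow> _)"
proof (intro inverse_system.intro inverse_system_axioms.intro directed_preorder_axioms)
  fix \<alpha> assume "\<alpha> \<in> \<C>"
  then show "group (simp_homology n (nerve \<alpha>) (subnerve A \<alpha>) :: ('v list \<Rightarrow>\<^sub>0 'g) set monoid)"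
    by (intro group_simp_homology simplicial_pair_nerve dverts)
next
  fix \<alpha> \<beta> and x :: "('v list \<Rightarrow>\<^sub>0 'g) set"
  assume *: "\<alpha> \<in> \<C>" "\<beta> \<in> \<C>" "refined_by \<alpha> \<beta>"
  note c = refinement_projections_contiguous[OF some_projection some_projection dverts, OF *(3,3,2)]
  show "homology_induced n (nerve \<alpha>) (subnerve A \<alpha>) (some_projection \<alpha> \<beta>) x
      \<in> carrier (simp_homology n (nerve \<alpha>) (subnerve A \<alpha>))"
    if "x \<in> carrier (simp_homology n (nerve \<beta>) (subnerve A \<beta>))"
    using that by (rule homology_induced_closed[OF c])
  show "homology_induced n (nerve \<alpha>) (subnerve A \<alpha>) (some_projection \<alpha> \<beta>)
      \<one>\<^bsub>simp_homology n (nerve \<beta>) (subnerve A \<beta>)\<^esub>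
    = (\<one>\<^bsub>simp_homology n (nerve \<alpha>) (subnerve A \<alpha>)\<^esub> :: ('v list \<Rightarrow>\<^sub>0 'g) set)"
    by (rule homology_induced_one[OF c])
next
  fix \<alpha> \<beta> \<gamma> and x :: "('v list \<Rightarrow>\<^sub>0 'g) set"
  assume *: "\<alpha> \<in> \<C>" "\<beta> \<in> \<C>" "\<gamma> \<in> \<C>" and r: "refined_by \<alpha> \<beta>" "refined_by \<beta> \<gamma>"
    and x: "x \<in> carrier (simp_homology n (nerve \<gamma>) (subnerve A \<gamma>))"
  have r': "refined_by \<alpha> \<gamma>"
    using trans[OF *] r by blast
  have "refinement_projection \<alpha> \<gamma> (some_projection \<alpha> \<beta> \<circ> some_projection \<beta> \<gamma>)"
    by (rule refinement_projection_comp[OF some_projection[OF r(1)] some_projection[OF r(2)]])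
  from refinement_projections_contiguous[OF some_projection[OF r'] this dverts[OF *(3)], of A]
  show "homology_induced n (nerve \<alpha>) (subnerve A \<alpha>) (some_projection \<alpha> \<beta>)
      (homology_induced n (nerve \<beta>) (subnerve A \<beta>) (some_projection \<beta> \<gamma>) x)
    = homology_induced n (nerve \<alpha>) (subnerve A \<alpha>) (some_projection \<alpha> \<gamma>) x"
    using homology_induced_comp[OF
        refinement_projections_contiguous[OF some_projection some_projection dverts, OF r(1,1) *(2)]
        refinement_projections_contiguous[OF some_projection some_projection dverts, OF r(2,2) *(3)] x]
    by (simp add: homology_induced_contiguous[OF _ simplicial_pair_nerve simplicial_pair_nerve x] dverts *)
qed

lemma cohomology_system:
  "direct_system \<C> refined_by (\<lambda>\<alpha>. simp_cohomology n (nerve \<alpha>) (subnerve A \<alpha>))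
    (\<lambda>\<alpha> \<beta>. cohomology_induced n (nerve \<beta>) (subnerve A \<beta>) (some_projection \<alpha> \<beta>)
      :: ('v list \<Rightarrow> 'g::ab_group_add) set \<Rightarrow> _)"
proof (intro direct_system.intro direct_system_axioms.intro directed_preorder_axioms)
  fix \<alpha> assume "\<alpha> \<in> \<C>"
  then show "group (simp_cohomology n (nerve \<alpha>) (subnerve A \<alpha>) :: ('v list \<Rightarrow> 'g) set monoid)"
    by (intro group_simp_cohomology simplicial_pair_nerve dverts)
next
  fix \<alpha> \<beta> and x :: "('v list \<Rightarrow> 'g) set"
  assume *: "\<alpha> \<in> \<C>" "\<beta> \<in> \<C>" "refined_by \<alpha> \<beta>"
  note K = simplicial_pair_absolute[OF simplicial_pair_nerve[OF dverts[OF *(2)]]]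
  note c = refinement_projections_contiguous[OF some_projection some_projection dverts, OF *(3,3,2)]
  show "cohomology_induced n (nerve \<beta>) (subnerve A \<beta>) (some_projection \<alpha> \<beta>) x
      \<in> carrier (simp_cohomology n (nerve \<beta>) (subnerve A \<beta>))"
    if "x \<in> carrier (simp_cohomology n (nerve \<alpha>) (subnerve A \<alpha>))"
    using that by (rule cohomology_induced_closed[OF K c])
  show "cohomology_induced n (nerve \<beta>) (subnerve A \<beta>) (some_projection \<alpha> \<beta>)
      \<one>\<^bsub>simp_cohomology n (nerve \<alpha>) (subnerve A \<alpha>)\<^esub>
    = (\<one>\<^bsub>simp_cohomology n (nerve \<beta>) (subnerve A \<beta>)\<^esub> :: ('v list \<Rightarrow> 'g) set)"
    by (rule cohomology_induced_one[OF K c])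
next
  fix \<alpha> \<beta> \<gamma> and x :: "('v list \<Rightarrow> 'g) set"
  assume *: "\<alpha> \<in> \<C>" "\<beta> \<in> \<C>" "\<gamma> \<in> \<C>" and r: "refined_by \<alpha> \<beta>" "refined_by \<beta> \<gamma>"
    and x: "x \<in> carrier (simp_cohomology n (nerve \<alpha>) (subnerve A \<alpha>))"
  have r': "refined_by \<alpha> \<gamma>"
    using trans[OF *] r by blast
  have "refinement_projection \<alpha> \<gamma> (some_projection \<alpha> \<beta> \<circ> some_projection \<beta> \<gamma>)"
    by (rule refinement_projection_comp[OF some_projection[OF r(1)] some_projection[OF r(2)]])
  from refinement_projections_contiguous[OF some_projection[OF r'] this dverts[OF *(3)], of A]
  show "cohomology_induced n (nerve \<gamma>) (subnerve A \<gamma>) (some_projection \<beta> \<gamma>)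
      (cohomology_induced n (nerve \<beta>) (subnerve A \<beta>) (some_projection \<alpha> \<beta>) x)
    = cohomology_induced n (nerve \<gamma>) (subnerve A \<gamma>) (some_projection \<alpha> \<gamma>) x"
    using cohomology_induced_comp[OF
        simplicial_pair_absolute[OF simplicial_pair_nerve[OF dverts[OF *(3)]]]
        simplicial_pair_absolute[OF simplicial_pair_nerve[OF dverts[OF *(2)]]]
        refinement_projections_contiguous[OF some_projection some_projection dverts, OF r(1,1) *(2)]
        refinement_projections_contiguous[OF some_projection some_projection dverts, OF r(2,2) *(3)] x]
    by (simp add: cohomology_induced_contiguous[OF _ simplicial_pair_nerve simplicial_pair_nerve x] dverts *)
qed

end

section \<open>Comparison of two systems of covers\<close>

lemma trivial_cech_homology_iff:
  assumes "family_system \<C>"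
  shows "trivial_group (cech_homology \<C> A n :: (('v, 'a) family \<Rightarrow> ('v list \<Rightarrow>\<^sub>0 'g::ab_group_add) set) monoid) \<longleftrightarrow>
    inverse_vanishes \<C> refined_by (\<lambda>\<alpha>. simp_homology n (nerve \<alpha>) (subnerve A \<alpha>))
      (\<lambda>\<alpha> \<beta>. homology_induced n (nerve \<alpha>) (subnerve A \<alpha>) (some_projection \<alpha> \<beta>) ::
         ('v list \<Rightarrow>\<^sub>0 'g) set \<Rightarrow> ('v list \<Rightarrow>\<^sub>0 'g) set)"
  unfolding cech_homology_def
  by (rule inverse_system.trivial_inverse_limit_iff[OF family_system.homology_system[OF assms]])

lemma trivial_cech_cohomology_iff:
  assumes "family_system \<C>"
  shows "trivial_group (cech_cohomology \<C> A n :: (('v, 'a) family \<times> ('v list \<Rightarrow> 'g::ab_group_add) set) set monoid) \<longleftrightarrow>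
    direct_vanishes \<C> refined_by (\<lambda>\<alpha>. simp_cohomology n (nerve \<alpha>) (subnerve A \<alpha>))
      (\<lambda>\<alpha> \<beta>. cohomology_induced n (nerve \<beta>) (subnerve A \<beta>) (some_projection \<alpha> \<beta>) ::
         ('v list \<Rightarrow> 'g) set \<Rightarrow> ('v list \<Rightarrow> 'g) set)"
  unfolding cech_cohomology_def
  by (rule direct_system.trivial_direct_limit_iff[OF family_system.cohomology_system[OF assms]])

text \<open>Nerves are compared as sets of index sets, so both sides have the very same groups, and
  a vertex map for one side can be used unchanged on the other.\<close>

locale cover_comparison =
  C: family_system \<C> + D: family_system \<D>
  for \<C> :: "('v, 'a) family set" and \<D> :: "('v, 'b) family set" +
  fixes A :: "'a set" and B :: "'b set"
    and N :: "('v, 'a) family set" and h :: "('v, 'a) family \<Rightarrow> ('v, 'b) family"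
  assumes cofinal: "cofinal_in \<C> refined_by N" and cofinal_image: "cofinal_in \<D> refined_by (h ` N)"
    and nerve_eq: "\<alpha> \<in> N \<Longrightarrow> nerve (h \<alpha>) = nerve \<alpha>"
    and subnerve_eq: "\<alpha> \<in> N \<Longrightarrow> subnerve B (h \<alpha>) = subnerve A \<alpha>"
    and projection: "\<lbrakk>\<alpha> \<in> N; \<beta> \<in> N; refinement_projection \<alpha> \<beta> p\<rbrakk> \<Longrightarrow> refinement_projection (h \<alpha>) (h \<beta>) p"
    and lift: "\<lbrakk>\<alpha> \<in> N; \<beta> \<in> N; refined_by (h \<alpha>) (h \<beta>)\<rbrakk>
      \<Longrightarrow> \<exists>\<gamma>\<in>N. refined_by \<alpha> \<gamma> \<and> refined_by \<beta> \<gamma> \<and> h \<gamma> = h \<beta>"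
begin

lemma refined_by_image: "\<lbrakk>\<alpha> \<in> N; \<beta> \<in> N; refined_by \<alpha> \<beta>\<rbrakk> \<Longrightarrow> refined_by (h \<alpha>) (h \<beta>)"
  using projection by (auto simp: refined_by_def)

text \<open>The images of two covers carry two relevant projections: the one picked for the covers
  and the one picked for the images. As both are refinement projections of the images, they are
  contiguous.\<close>

lemma image_projection:
  assumes "\<alpha> \<in> N" "\<beta> \<in> N" "refined_by \<alpha> \<beta>"
  shows "refinement_projection (h \<alpha>) (h \<beta>) (some_projection \<alpha> \<beta>)"
    "refinement_projection (h \<alpha>) (h \<beta>) (some_projection (h \<alpha>) (h \<beta>))"
  by (intro projection some_projection assms, intro some_projection refined_by_image assms)

lemma in_D: "\<alpha> \<in> N \<Longrightarrow> h \<alpha> \<in> \<D>"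
  using cofinal_image by (auto simp: cofinal_in_def)

lemma pair_image: "\<alpha> \<in> N \<Longrightarrow> simplicial_pair (nerve \<alpha>) (subnerve A \<alpha>)"
  using simplicial_pair_nerve[OF D.dverts[OF in_D], of \<alpha> B] by (simp add: nerve_eq subnerve_eq)

lemma contiguous_image:
  assumes "\<alpha> \<in> N" "\<beta> \<in> N" "refinement_projection (h \<alpha>) (h \<beta>) p" "refinement_projection (h \<alpha>) (h \<beta>) q"
  shows "contiguous (nerve \<beta>) (subnerve A \<beta>) (nerve \<alpha>) (subnerve A \<alpha>) p q"
  using refinement_projections_contiguous[OF assms(3,4) D.dverts[OF in_D[OF assms(2)]], of B] assms
  by (simp add: nerve_eq subnerve_eq)

theorem trivial_homology_iff:
  "trivial_group (cech_homology \<C> A n :: (('v, 'a) family \<Rightarrow> ('v list \<Rightarrow>\<^sub>0 'g::ab_group_add) set) monoid) \<longleftrightarrow>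
   trivial_group (cech_homology \<D> B n :: (('v, 'b) family \<Rightarrow> ('v list \<Rightarrow>\<^sub>0 'g) set) monoid)"
proof -
  let ?H = "\<lambda>\<alpha>. simp_homology n (nerve \<alpha>) (subnerve A \<alpha>) :: ('v list \<Rightarrow>\<^sub>0 'g) set monoid"
    and ?\<phi> = "\<lambda>\<alpha> \<beta>. homology_induced n (nerve \<alpha>) (subnerve A \<alpha>) (some_projection \<alpha> \<beta>)
       :: ('v list \<Rightarrow>\<^sub>0 'g) set \<Rightarrow> ('v list \<Rightarrow>\<^sub>0 'g) set"
  let ?H' = "\<lambda>\<alpha>. simp_homology n (nerve \<alpha>) (subnerve B \<alpha>) :: ('v list \<Rightarrow>\<^sub>0 'g) set monoid"
    and ?\<phi>' = "\<lambda>\<alpha> \<beta>. homology_induced n (nerve \<alpha>) (subnerve B \<alpha>) (some_projection \<alpha> \<beta>)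
       :: ('v list \<Rightarrow>\<^sub>0 'g) set \<Rightarrow> ('v list \<Rightarrow>\<^sub>0 'g) set"
  interpret S: system_comparison N refined_by ?H ?\<phi> refined_by ?H' ?\<phi>' h
    by unfold_locales (auto simp: nerve_eq subnerve_eq refined_by_image lift in_D intro: D.refl)
  have "inverse_vanishes \<C> refined_by ?H ?\<phi> \<longleftrightarrow> inverse_vanishes N refined_by ?H ?\<phi>"
    by (rule inverse_system.inverse_vanishes_cofinal[OF C.homology_system cofinal])
  also have "\<dots> \<longleftrightarrow> inverse_vanishes (h ` N) refined_by ?H' ?\<phi>'"
  proof (rule S.inverse_vanishes_image)
    fix \<alpha> \<beta> x assume *: "\<alpha> \<in> N" "\<beta> \<in> N" "refined_by \<alpha> \<beta>" and x: "x \<in> carrier (?H \<beta>)"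
    show "?\<phi>' (h \<alpha>) (h \<beta>) x = ?\<phi> \<alpha> \<beta> x"
      unfolding nerve_eq[OF *(1)] subnerve_eq[OF *(1)]
      by (rule homology_induced_contiguous[OF contiguous_image pair_image pair_image x])
        (use * image_projection in auto)
  next
    fix \<alpha> x assume *: "\<alpha> \<in> N" and x: "x \<in> carrier (?H \<alpha>)"
    \<comment> \<open>The projection picked from \<open>h \<alpha>\<close> to itself may permute or
      merge indices, but it is contiguous to the identity.\<close>
    have "?\<phi>' (h \<alpha>) (h \<alpha>) x = homology_induced n (nerve \<alpha>) (subnerve A \<alpha>) (\<lambda>v. v) x"
      unfolding nerve_eq[OF *(1)] subnerve_eq[OF *(1)]
      by (rule homology_induced_contiguous[OF contiguous_image pair_image pair_image x])
        (use * image_projection[OF _ _ C.refl] refinement_projection_id[of "h \<alpha>"] cofinal in \<open>auto simp: cofinal_in_def\<close>)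
    then show "?\<phi>' (h \<alpha>) (h \<alpha>) x = x"
      by (simp add: homology_induced_id[OF x])
  qed
  also have "\<dots> \<longleftrightarrow> inverse_vanishes \<D> refined_by ?H' ?\<phi>'"
    by (rule inverse_system.inverse_vanishes_cofinal[OF D.homology_system cofinal_image, symmetric])
  finally show ?thesis
    by (simp only: trivial_cech_homology_iff[OF C.family_system_axioms]
        trivial_cech_homology_iff[OF D.family_system_axioms])
qed

theorem trivial_cohomology_iff:
  "trivial_group (cech_cohomology \<C> A n :: (('v, 'a) family \<times> ('v list \<Rightarrow> 'g::ab_group_add) set) set monoid) \<longleftrightarrow>
   trivial_group (cech_cohomology \<D> B n :: (('v, 'b) family \<times> ('v list \<Rightarrow> 'g) set) set monoid)"
proof -
  let ?H = "\<lambda>\<alpha>. simp_cohomology n (nerve \<alpha>) (subnerve A \<alpha>) :: ('v list \<Rightarrow> 'g) set monoid"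
    and ?\<phi> = "\<lambda>\<alpha> \<beta>. cohomology_induced n (nerve \<beta>) (subnerve A \<beta>) (some_projection \<alpha> \<beta>)
       :: ('v list \<Rightarrow> 'g) set \<Rightarrow> ('v list \<Rightarrow> 'g) set"
  let ?H' = "\<lambda>\<alpha>. simp_cohomology n (nerve \<alpha>) (subnerve B \<alpha>) :: ('v list \<Rightarrow> 'g) set monoid"
    and ?\<phi>' = "\<lambda>\<alpha> \<beta>. cohomology_induced n (nerve \<beta>) (subnerve B \<beta>) (some_projection \<alpha> \<beta>)
       :: ('v list \<Rightarrow> 'g) set \<Rightarrow> ('v list \<Rightarrow> 'g) set"
  interpret S: system_comparison N refined_by ?H ?\<phi> refined_by ?H' ?\<phi>' h
    by unfold_locales (auto simp: nerve_eq subnerve_eq refined_by_image lift in_D intro: D.refl)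
  have "direct_vanishes \<C> refined_by ?H ?\<phi> \<longleftrightarrow> direct_vanishes N refined_by ?H ?\<phi>"
    by (rule direct_system.direct_vanishes_cofinal[OF C.cohomology_system cofinal])
  also have "\<dots> \<longleftrightarrow> direct_vanishes (h ` N) refined_by ?H' ?\<phi>'"
  proof (rule S.direct_vanishes_image)
    fix \<alpha> \<beta> x assume *: "\<alpha> \<in> N" "\<beta> \<in> N" "refined_by \<alpha> \<beta>" and x: "x \<in> carrier (?H \<alpha>)"
    show "?\<phi>' (h \<alpha>) (h \<beta>) x = ?\<phi> \<alpha> \<beta> x"
      unfolding nerve_eq[OF *(2)] subnerve_eq[OF *(2)]
      by (rule cohomology_induced_contiguous[OF contiguous_image pair_image pair_image x])
        (use * image_projection in auto)
  qed
  also have "\<dots> \<longleftrightarrow> direct_vanishes \<D> refined_by ?H' ?\<phi>'"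
    by (rule direct_system.direct_vanishes_cofinal[OF D.cohomology_system cofinal_image, symmetric])
  finally show ?thesis
    by (simp only: trivial_cech_cohomology_iff[OF C.family_system_axioms]
        trivial_cech_cohomology_iff[OF D.family_system_axioms])
qed

end

section \<open>The trace of open sets on the remainder\<close>

text \<open>By the Bolzano-Weierstrass criterion \<open>C\<close> contains an infinite set without
  limit points. Such a set is closed, and the same criterion applied to it shows that it is not
  compact.\<close>

lemma noncompact_closure_imp_noncompact_closed_subset:
  assumes X: "metrizable_space X" and C: "C \<subseteq> topspace X" "\<not> compactin X (X closure_of C)"
  obtains F where "closedin X F" "F \<subseteq> C" "\<not> compactin X F"
proof -
  obtain M d where "Metric_space M d" and Xd: "X = Metric_space.mtopology M d"
    using X by (auto simp: metrizable_space_def)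
  interpret Metric_space M d by fact
  obtain T where T: "infinite T" "T \<subseteq> C" "T \<subseteq> M" "X derived_set_of T = {}"
    using C compact_closure_of_eq_Bolzano_Weierstrass unfolding Xd by blast
  have closed: "closedin X T"
    using T by (simp add: closedin_contains_derived_set Xd)
  moreover have "\<not> compactin X (X closure_of T)"
    using T compact_closure_of_eq_Bolzano_Weierstrass[of T] unfolding Xd by blast
  then have "\<not> compactin X T"
    using closed by (metis closure_of_eq)
  ultimately show thesis
    using that T by blast
qed

lemma countable_neighbourhood_base_of_compact:
  assumes X: "metrizable_space X" and K: "compactin X K"
  obtains U :: "nat \<Rightarrow> 'a set" where "\<And>n. openin X (U n)" "\<And>n. K \<subseteq> U n"
    "\<And>W. openin X W \<Longrightarrow> K \<subseteq> W \<Longrightarrow> \<exists>n. U n \<subseteq> W"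
proof -
  obtain M d where "Metric_space M d" and Xd: "X = Metric_space.mtopology M d"
    using X by (auto simp: metrizable_space_def)
  interpret Metric_space M d by fact
  have KM: "K \<subseteq> M"
    using compactin_subset_topspace[OF K] by (simp add: Xd)
  show thesis
  proof (rule that[of "\<lambda>n. \<Union>x\<in>K. mball x (inverse (Suc n))"])
    show "openin X (\<Union>x\<in>K. mball x (inverse (Suc n)))" for n
      unfolding Xd by blast
    show "K \<subseteq> (\<Union>x\<in>K. mball x (inverse (Suc n)))" for n
      using KM by auto
    fix W assume W: "openin X W" "K \<subseteq> W"
    \<comment> \<open>A Lebesgue number of the one-member cover \<open>{W}\<close> is a radius that
      works at all points of \<open>K\<close> simultaneously.\<close>
    obtain \<epsilon> where \<epsilon>: "\<epsilon> > 0" "\<And>x. x \<in> K \<Longrightarrow> mball x \<epsilon> \<subseteq> W"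
      using lebesgue_number[of K "{W}"] K W unfolding Xd by auto
    obtain n where n: "inverse (Suc n) < \<epsilon>"
      using reals_Archimedean[OF \<epsilon>(1)] by blast
    have "mball x (inverse (Suc n)) \<subseteq> W" if "x \<in> K" for x
      using \<epsilon>(2)[OF that] mball_subset_concentric[of "inverse (Suc n)" \<epsilon> x] n by auto
    then show "\<exists>n. (\<Union>x\<in>K. mball x (inverse (Suc n))) \<subseteq> W"
      by blast
  qed
qed

text \<open>In the induction the new member is responsible for the closed part of \<open>C\<close>
  missed by the others. It is shrunk around that part, and the induction hypothesis is applied to
  what is left of \<open>C\<close>; this is why a closed set is covered rather than the whole
  space.\<close>

lemma normal_space_shrinking:
  assumes Z: "normal_space Z" and "finite F" "\<And>v. v \<in> F \<Longrightarrow> openin Z (W v)"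
    and "closedin Z C" "C \<subseteq> (\<Union>v\<in>F. W v)"
  shows "\<exists>V. (\<forall>v\<in>F. openin Z (V v) \<and> Z closure_of V v \<subseteq> W v) \<and> C \<subseteq> (\<Union>v\<in>F. V v)"
  using assms(2-)
proof (induction F arbitrary: C rule: finite_induct)
  case (insert a F)
  let ?U = "\<Union>v\<in>F. W v"
  have "openin Z ?U"
    using insert.prems(1) by (intro openin_Union) auto
  then have "closedin Z (C - ?U)" "openin Z (W a)" "C - ?U \<subseteq> W a"
    using insert.prems by (auto intro: closedin_diff)
  then obtain V0 where V0: "openin Z V0" "C - ?U \<subseteq> V0" "Z closure_of V0 \<subseteq> W a"
    using Z[unfolded normal_space_alt, rule_format, of "C - ?U" "W a"] by blast
  have "closedin Z (C - V0)" "C - V0 \<subseteq> ?U"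
    using insert.prems V0 by (auto intro: closedin_diff)
  then obtain V where V: "\<forall>v\<in>F. openin Z (V v) \<and> Z closure_of V v \<subseteq> W v" "C - V0 \<subseteq> (\<Union>v\<in>F. V v)"
    using insert.IH[of "C - V0"] insert.prems by auto
  have "C \<subseteq> (\<Union>v\<in>insert a F. (V(a := V0)) v)"
    using V(2) insert.hyps(2) by auto
  moreover have "\<forall>v\<in>insert a F. openin Z ((V(a := V0)) v) \<and> Z closure_of (V(a := V0)) v \<subseteq> W v"
    using V(1) V0 by auto
  ultimately show ?case
    by blast
qed auto

text \<open>For a normal space, disjointness of the closures of disjoint closed sets characterises
  the Stone-Cech compactification among all compactifications. The proof refers to the concrete
  construction only to establish these assumptions and to identify the remainders.\<close>

locale compactification =
  fixes X :: "'a topology" and P :: "'b topology" and e :: "'a \<Rightarrow> 'b"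
  assumes metrizable: "metrizable_space X"
    and compact: "compact_space P" and Hausdorff: "Hausdorff_space P"
    and embedding: "embedding_map X P e"
    and dense: "P closure_of (e ` topspace X) = topspace P"
    and separation: "\<lbrakk>closedin X C; closedin X D; C \<inter> D = {}\<rbrakk>
      \<Longrightarrow> P closure_of (e ` C) \<inter> P closure_of (e ` D) = {}"
begin

definition clo :: "'a set \<Rightarrow> 'b set"
  where "clo C = P closure_of (e ` C)"

definition remainder :: "'b set"
  where "remainder = topspace P - e ` topspace X"

text \<open>If \<open>Ex U\<close> denotes the largest open subset of \<open>P\<close> with trace \<open>U\<close> on \<open>X\<close>, this is
  \<open>Ex U \<inter> remainder\<close>.\<close>

definition remainder_trace :: "'a set \<Rightarrow> 'b set"
  where "remainder_trace U = remainder - clo (topspace X - U)"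

lemma homeomorphism: "homeomorphic_map X (subtopology P (e ` topspace X)) e"
  using embedding by (simp add: embedding_map_def)

lemma e_in: "x \<in> topspace X \<Longrightarrow> e x \<in> topspace P"
  using homeomorphic_imp_surjective_map[OF homeomorphism] by auto

lemma continuous_e: "continuous_map X P e"
  using homeomorphic_imp_continuous_map[OF homeomorphism] by (simp add: continuous_map_in_subtopology)

lemma inj_e: "inj_on e (topspace X)"
  using homeomorphic_imp_injective_map[OF homeomorphism] .

lemma Hausdorff_X: "Hausdorff_space X"
  using metrizable by (rule metrizable_imp_Hausdorff_space)

lemma clo_mono: "C \<subseteq> D \<Longrightarrow> clo C \<subseteq> clo D"
  unfolding clo_def by (intro closure_of_mono image_mono)

lemma clo_Un: "clo (C \<union> D) = clo C \<union> clo D"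
  by (simp add: clo_def image_Un)

lemma closedin_clo: "closedin P (clo C)"
  by (simp add: clo_def)

lemma clo_subset: "clo C \<subseteq> topspace P"
  by (simp add: clo_def closure_of_subset_topspace)

lemma subset_clo: "C \<subseteq> topspace X \<Longrightarrow> e ` C \<subseteq> clo C"
  unfolding clo_def by (intro closure_of_subset) (auto intro: e_in)

lemma clo_compact:
  assumes "compactin X K"
  shows "clo K = e ` K"
  unfolding clo_def closure_of_eq
  by (intro compactin_imp_closedin[OF Hausdorff] image_compactin[OF assms continuous_e])

lemma clo_Int_image:
  assumes "closedin X C"
  shows "clo C \<inter> e ` topspace X = e ` C"
proof -
  have C: "C \<subseteq> topspace X"
    using assms by (rule closedin_subset)
  have "(subtopology P (e ` topspace X)) closure_of (e ` C) = e ` C"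
    using homeomorphic_map_closure_of[OF homeomorphism C] assms by (metis closure_of_eq)
  moreover have "e ` topspace X \<inter> e ` C = e ` C"
    using C by blast
  ultimately show ?thesis
    by (simp add: clo_def closure_of_subtopology Int_commute)
qed

text \<open>Suppose \<open>y\<close> lies in both closures but not in that of the intersection, and
  separate \<open>y\<close> from the latter by open sets \<open>U\<close> and \<open>V\<close>.
  Discarding the points over \<open>V\<close> makes the two closed sets disjoint, while
  \<open>y\<close> stays in both closures because the discarded points are kept away from it by
  \<open>U\<close>. This contradicts \<open>separation\<close>.\<close>

lemma clo_Int_subset:
  assumes C: "closedin X C" and D: "closedin X D"
  shows "clo C \<inter> clo D \<subseteq> clo (C \<inter> D)"
proof (rule ccontr)
  assume "\<not> ?thesis"
  then obtain y where y: "y \<in> clo C" "y \<in> clo D" "y \<notin> clo (C \<inter> D)"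
    by blast
  have "regular_space P"
    by (intro compact_Hausdorff_imp_regular_space compact Hausdorff)
  then obtain U V where UV: "openin P U" "openin P V" "y \<in> U" "clo (C \<inter> D) \<subseteq> V" "disjnt U V"
    using y clo_subset closedin_clo unfolding regular_space_def by (metis DiffI subsetD)
  have *: "closedin X {x \<in> E. e x \<notin> V}" "y \<in> clo {x \<in> E. e x \<notin> V}"
    if E: "closedin X E" "y \<in> clo E" for E
  proof -
    have "E \<inter> {x \<in> topspace X. e x \<in> topspace P - V} = {x \<in> E. e x \<notin> V}"
      using closedin_subset[OF E(1)] e_in by blast
    then show "closedin X {x \<in> E. e x \<notin> V}"
      using closedin_Int[OF E(1) closedin_continuous_map_preimage[OF continuous_e, of "topspace P - V"]] UV
      by (simp add: closedin_diff)
    have "clo {x \<in> E. e x \<in> V} \<subseteq> topspace P - U"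
      unfolding clo_def using UV closedin_subset[OF E(1)] e_in
      by (intro closure_of_minimal) (auto simp: disjnt_iff closedin_diff)
    moreover have "clo E = clo {x \<in> E. e x \<in> V} \<union> clo {x \<in> E. e x \<notin> V}"
      unfolding clo_Un[symmetric] by (rule arg_cong[of _ _ clo]) blast
    ultimately show "y \<in> clo {x \<in> E. e x \<notin> V}"
      using E UV by blast
  qed
  have "{x \<in> C. e x \<notin> V} \<inter> {x \<in> D. e x \<notin> V} = {}"
  proof -
    have "e x \<in> V" if "x \<in> C \<inter> D" for x
      using that subset_clo[of "C \<inter> D"] closedin_subset[OF C] UV(4) by blast
    then show ?thesis
      by blast
  qed
  then have "clo {x \<in> C. e x \<notin> V} \<inter> clo {x \<in> D. e x \<notin> V} = {}"
    unfolding clo_def using *(1)[OF C y(1)] *(1)[OF D y(2)] by (rule separation[rotated 2])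
  then show False
    using *(2)[OF C y(1)] *(2)[OF D y(2)] by blast
qed

lemma trace_subset: "remainder_trace U \<subseteq> remainder"
  by (auto simp: remainder_trace_def)

lemma remainder_disjoint: "remainder \<inter> e ` C = {}" if "C \<subseteq> topspace X"
  using that by (auto simp: remainder_def)

lemma openin_trace: "openin (subtopology P remainder) (remainder_trace U)"
proof -
  have "remainder_trace U = (topspace P - clo (topspace X - U)) \<inter> remainder"
    by (auto simp: remainder_trace_def remainder_def)
  moreover have "openin P (topspace P - clo (topspace X - U))"
    using closedin_clo by blast
  ultimately show ?thesis
    by (auto simp: openin_subtopology)
qed

lemma trace_mono: "U \<subseteq> V \<Longrightarrow> remainder_trace U \<subseteq> remainder_trace V"
  using clo_mono[of "topspace X - V" "topspace X - U"] by (auto simp: remainder_trace_def)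

lemma trace_Int: "remainder_trace (U \<inter> V) = remainder_trace U \<inter> remainder_trace V"
  by (auto simp: remainder_trace_def clo_Un Diff_Int)

lemma trace_INT:
  assumes "finite s" "s \<noteq> {}"
  shows "remainder_trace (\<Inter>v\<in>s. f v) = (\<Inter>v\<in>s. remainder_trace (f v))"
  using assms by (induction s rule: finite_ne_induct) (auto simp: trace_Int)

text \<open>A compact subset of \<open>X\<close> has a closed image in \<open>P\<close>, so
  enlarging the complement of \<open>U\<close> by it adds no limit points in the remainder.\<close>

lemma trace_diff_compact:
  assumes "compactin X K"
  shows "remainder_trace (U - K) = remainder_trace U"
proof -
  have "topspace X - (U - K) = (topspace X - U) \<union> K"
    using compactin_subset_topspace[OF assms] by blast
  then have "clo (topspace X - (U - K)) = clo (topspace X - U) \<union> e ` K"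
    by (simp add: clo_Un clo_compact[OF assms])
  then show ?thesis
    using remainder_disjoint[OF compactin_subset_topspace[OF assms]] by (auto simp: remainder_trace_def)
qed

lemma trace_meets:
  assumes "remainder_trace U \<inter> clo C \<noteq> {}" "C \<subseteq> topspace X"
  shows "U \<inter> C \<noteq> {}"
proof
  assume "U \<inter> C = {}"
  then have "clo C \<subseteq> clo (topspace X - U)"
    using assms(2) by (intro clo_mono) blast
  then show False
    using assms(1) by (auto simp: remainder_trace_def)
qed

lemma remainder_subset_clo: "remainder \<subseteq> clo (topspace X)"
  by (auto simp: remainder_def clo_def dense)

lemma trace_nonempty: "remainder_trace U \<noteq> {} \<Longrightarrow> U \<noteq> {}"
  using trace_meets[of U "topspace X"] trace_subset remainder_subset_clo by fastforce

text \<open>A point outside all the traces lies in the closure of each complement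
  \<open>topspace X - U v\<close>. By repeated use of \<open>clo_Int_subset\<close> it lies in the
  closure of the part of \<open>C\<close> left uncovered. That part is contained in
  \<open>K\<close>, so the point would belong to the image of \<open>X\<close>.\<close>

lemma trace_cover:
  assumes F: "finite F" "\<And>v. v \<in> F \<Longrightarrow> openin X (U v)"
    and C: "closedin X C" and K: "compactin X K" "C \<subseteq> K \<union> (\<Union>v\<in>F. U v)"
  shows "clo C \<inter> remainder \<subseteq> (\<Union>v\<in>F. remainder_trace (U v))"
proof
  fix y assume y: "y \<in> clo C \<inter> remainder"
  show "y \<in> (\<Union>v\<in>F. remainder_trace (U v))"
  proof (rule ccontr)
    assume "y \<notin> (\<Union>v\<in>F. remainder_trace (U v))"
    then have "y \<in> clo (topspace X - U v)" if "v \<in> F" for v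
      using y that by (auto simp: remainder_trace_def)
    with F y have "y \<in> clo (C - (\<Union>v\<in>F. U v)) \<and> closedin X (C - (\<Union>v\<in>F. U v))"
    proof (induction F rule: finite_induct)
      case empty
      then show ?case
        using C by simp
    next
      case (insert a F)
      let ?D = "C - (\<Union>v\<in>F. U v)"
      have "closedin X (topspace X - U a)" "closedin X ?D" "y \<in> clo ?D" "y \<in> clo (topspace X - U a)"
        using insert by (auto intro!: closedin_diff)
      moreover have "?D \<inter> (topspace X - U a) = C - (\<Union>v\<in>insert a F. U v)"
        using closedin_subset[OF C] by auto
      ultimately show ?case
        using clo_Int_subset[of ?D "topspace X - U a"] closedin_Int[of X ?D "topspace X - U a"] by auto
    qed
    moreover have "C - (\<Union>v\<in>F. U v) \<subseteq> K"
      using K by blast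
    ultimately have "y \<in> e ` K"
      using clo_mono clo_compact[OF K(1)] by blast
    then show False
      using y compactin_subset_topspace[OF K(1)] by (auto simp: remainder_def)
  qed
qed

text \<open>If the closure in \<open>P\<close> of a closed noncompact \<open>F\<close> inside
  \<open>C\<close> stayed in the image of \<open>X\<close>, it would be the image of
  \<open>F\<close>, which would then be compact. Any point of that closure in the remainder serves
  as \<open>y\<close>. Closedness of \<open>F\<close> is what lets \<open>separation\<close> keep
  \<open>y\<close> away from the complement of an open set containing \<open>C\<close>.\<close>

lemma noncompact_closure_meets_remainder:
  assumes C: "C \<subseteq> topspace X" "\<not> compactin X (X closure_of C)"
  obtains y where "y \<in> remainder" "\<And>U. openin X U \<Longrightarrow> C \<subseteq> U \<Longrightarrow> y \<in> remainder_trace U"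
    "\<And>D. C \<subseteq> D \<Longrightarrow> y \<in> clo D"
proof -
  obtain F where F: "closedin X F" "F \<subseteq> C" "\<not> compactin X F"
    using noncompact_closure_imp_noncompact_closed_subset[OF metrizable C] .
  have "\<not> clo F \<subseteq> e ` topspace X"
  proof
    assume "clo F \<subseteq> e ` topspace X"
    then have "clo F = e ` F"
      using clo_Int_image[OF F(1)] by blast
    then have "compactin P (e ` F)"
      using closedin_compact_space[OF compact closedin_clo[of F]] by simp
    then have "compactin (subtopology P (e ` topspace X)) (e ` F)"
      using closedin_subset[OF F(1)] by (auto simp: compactin_subtopology)
    then show False
      using F(3) homeomorphic_map_compactness[OF homeomorphism closedin_subset[OF F(1)]] by simp
  qed
  then obtain y where y: "y \<in> clo F" "y \<in> remainder"
    using clo_subset by (auto simp: remainder_def)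
  show thesis
  proof (rule that[OF y(2)])
    show "y \<in> clo D" if "C \<subseteq> D" for D
      using y(1) clo_mono[of F D] that F(2) by blast
    show "y \<in> remainder_trace U" if "openin X U" "C \<subseteq> U" for U
    proof -
      have "clo F \<inter> clo (topspace X - U) = {}"
        unfolding clo_def using that F by (intro separation) auto
      then show ?thesis
        using y by (auto simp: remainder_trace_def)
    qed
  qed
qed

text \<open>Otherwise some point of the remainder lies in the trace of \<open>U\<close>, which
  contains \<open>U - V\<close>, and also in the closure of the complement of \<open>V\<close>,
  hence not in the trace of \<open>V\<close>.\<close>

lemma compact_closure_diff:
  assumes U: "openin X U" and V: "openin X V" and sub: "remainder_trace U \<subseteq> remainder_trace V"
  shows "compactin X (X closure_of (U - V))"
proof (rule ccontr)
  assume "\<not> compactin X (X closure_of (U - V))"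
  then obtain y where y: "y \<in> remainder" "\<And>W. openin X W \<Longrightarrow> U - V \<subseteq> W \<Longrightarrow> y \<in> remainder_trace W"
    "\<And>D. U - V \<subseteq> D \<Longrightarrow> y \<in> clo D"
    using noncompact_closure_meets_remainder[of "U - V"] openin_subset[OF U] by blast
  have "y \<in> remainder_trace U" "y \<in> clo (topspace X - V)"
    using y(2)[OF U] y(3)[of "topspace X - V"] openin_subset[OF U] by auto
  then show False
    using sub by (auto simp: remainder_trace_def)
qed

lemma normal_space_diff_compact:
  assumes K: "compactin X K"
  shows "normal_space (subtopology P (topspace P - e ` K))"
proof -
  obtain U :: "nat \<Rightarrow> 'a set" where U: "\<And>n. openin X (U n)" "\<And>n. K \<subseteq> U n"
    "\<And>W. openin X W \<Longrightarrow> K \<subseteq> W \<Longrightarrow> \<exists>n. U n \<subseteq> W"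
    by (rule countable_neighbourhood_base_of_compact[OF metrizable K]) blast
  have KX: "K \<subseteq> topspace X"
    using K by (rule compactin_subset_topspace)
  have "(\<Union>n. clo (topspace X - U n)) = topspace P - e ` K"
  proof
    have "e x \<notin> clo (topspace X - U n)" if "x \<in> K" for x n
    proof
      assume "e x \<in> clo (topspace X - U n)"
      then have "e x \<in> e ` (topspace X - U n)"
        using clo_Int_image[OF closedin_diff[OF closedin_topspace U(1)], of n] that KX by blast
      then show False
        using inj_e U(2) that KX by (auto simp: inj_on_def)
    qed
    then show "(\<Union>n. clo (topspace X - U n)) \<subseteq> topspace P - e ` K"
      using clo_subset by blast
    show "topspace P - e ` K \<subseteq> (\<Union>n. clo (topspace X - U n))"
    proof
      \<comment> \<open>Some \<open>U n\<close> is so close to \<open>K\<close> that its closure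
        misses \<open>y\<close>; as \<open>X\<close> is dense, \<open>y\<close> lies in the closure
        of the complement of \<open>U n\<close>.\<close>
      fix y assume y: "y \<in> topspace P - e ` K"
      have "closedin P (e ` K)"
        using clo_compact[OF K] closedin_clo by metis
      moreover have "regular_space P"
        by (intro compact_Hausdorff_imp_regular_space compact Hausdorff)
      ultimately obtain V W where VW: "openin P V" "openin P W" "y \<in> V" "e ` K \<subseteq> W" "disjnt V W"
        using y unfolding regular_space_def by metis
      have "K \<subseteq> {x \<in> topspace X. e x \<in> W}"
        using VW(4) KX by auto
      then obtain n where n: "U n \<subseteq> {x \<in> topspace X. e x \<in> W}"
        using U(3)[OF openin_continuous_map_preimage[OF continuous_e VW(2)]] by blast
      have "clo (U n) \<subseteq> topspace P - V"
        unfolding clo_def using n VW e_in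
        by (intro closure_of_minimal) (auto simp: disjnt_iff closedin_diff)
      moreover have "topspace X = U n \<union> (topspace X - U n)"
        using n by blast
      then have "topspace P = clo (U n) \<union> clo (topspace X - U n)"
        by (metis clo_Un clo_def dense)
      ultimately show "y \<in> (\<Union>n. clo (topspace X - U n))"
        using y VW(3) by blast
    qed
  qed
  moreover have "fsigma_in P (\<Union>(range (\<lambda>n. clo (topspace X - U n))))"
    by (intro fsigma_in_Union) (auto intro: closed_imp_fsigma_in closedin_clo)
  ultimately have "fsigma_in P (topspace P - e ` K)"
    by simp
  moreover have "normal_space P"
    using compact Hausdorff compact_Hausdorff_or_regular_imp_normal_space by blast
  ultimately show ?thesis
    by (rule normal_space_fsigma_subtopology[rotated])
qed

end

section \<open>Border covers and covers of the remainder\<close>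

text \<open>Indices must again be natural numbers, so pairs of indices are coded by
  \<open>prod_encode\<close>.\<close>

definition common_refinement :: "(nat, 'a) family \<Rightarrow> (nat, 'a) family \<Rightarrow> (nat, 'a) family"
  where "common_refinement \<alpha> \<beta> =
    Family (prod_encode ` (verts \<alpha> \<times> verts \<beta>)) (prod_encode ` (dverts \<alpha> \<times> dverts \<beta>))
      (\<lambda>k\<in>prod_encode ` (verts \<alpha> \<times> verts \<beta>).
        part \<alpha> (fst (prod_decode k)) \<inter> part \<beta> (snd (prod_decode k)))"

lemma common_refinement_simps [simp]:
  "verts (common_refinement \<alpha> \<beta>) = prod_encode ` (verts \<alpha> \<times> verts \<beta>)"
  "dverts (common_refinement \<alpha> \<beta>) = prod_encode ` (dverts \<alpha> \<times> dverts \<beta>)"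
  "v \<in> verts \<alpha> \<Longrightarrow> w \<in> verts \<beta> \<Longrightarrow>
    part (common_refinement \<alpha> \<beta>) (prod_encode (v, w)) = part \<alpha> v \<inter> part \<beta> w"
  by (auto simp: common_refinement_def)

lemma refined_by_common_refinement:
  "refined_by \<alpha> (common_refinement \<alpha> \<beta>)" "refined_by \<beta> (common_refinement \<alpha> \<beta>)"
proof -
  have "refinement_projection \<alpha> (common_refinement \<alpha> \<beta>) (fst \<circ> prod_decode)"
    "refinement_projection \<beta> (common_refinement \<alpha> \<beta>) (snd \<circ> prod_decode)"
    by (auto simp: refinement_projection_def)
  then show "refined_by \<alpha> (common_refinement \<alpha> \<beta>)" "refined_by \<beta> (common_refinement \<alpha> \<beta>)"
    by (auto simp: refined_by_def)
qed

lemma finite_open_common_refinement: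
  assumes "finite_open_family X \<alpha>" "finite_open_family X \<beta>"
  shows "finite_open_family X (common_refinement \<alpha> \<beta>)"
proof -
  have "part (common_refinement \<alpha> \<beta>) \<in> extensional (prod_encode ` (verts \<alpha> \<times> verts \<beta>))"
    by (simp add: common_refinement_def)
  then show ?thesis
    using assms by (auto simp: finite_open_family_def)
qed

lemma Union_common_refinement:
  assumes "S \<subseteq> verts \<alpha>" "T \<subseteq> verts \<beta>"
  shows "(\<Union>k\<in>prod_encode ` (S \<times> T). part (common_refinement \<alpha> \<beta>) k) =
    (\<Union>v\<in>S. part \<alpha> v) \<inter> (\<Union>w\<in>T. part \<beta> w)"
proof -
  have "(\<Union>k\<in>prod_encode ` (S \<times> T). part (common_refinement \<alpha> \<beta>) k) = (\<Union>(v, w)\<in>S \<times> T. part \<alpha> v \<inter> part \<beta> w)"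
    unfolding image_image using subsetD[OF assms(1)] subsetD[OF assms(2)] by (intro SUP_cong) auto
  then show ?thesis
    by auto
qed

lemma family_system_finite_open_covers:
  assumes "B \<subseteq> topspace Y"
  shows "family_system (finite_open_covers Y B)"
proof
  have "Family {0} {0} (\<lambda>v\<in>{0}. topspace Y) \<in> finite_open_covers Y B"
    using assms by (auto simp: finite_open_covers_def finite_open_family_def)
  then show "finite_open_covers Y B \<noteq> {}"
    by blast
  show "dverts \<alpha> \<subseteq> verts \<alpha>" if "\<alpha> \<in> finite_open_covers Y B" for \<alpha>
    using that by (auto simp: finite_open_covers_def finite_open_family_def)
  fix \<alpha> \<beta> assume *: "\<alpha> \<in> finite_open_covers Y B" "\<beta> \<in> finite_open_covers Y B"
  then have d: "dverts \<alpha> \<subseteq> verts \<alpha>" "dverts \<beta> \<subseteq> verts \<beta>"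
    by (auto simp: finite_open_covers_def finite_open_family_def)
  have "common_refinement \<alpha> \<beta> \<in> finite_open_covers Y B"
    unfolding finite_open_covers_def mem_Collect_eq common_refinement_simps
      Union_common_refinement[OF d] Union_common_refinement[OF order_refl order_refl]
    using * by (auto simp: finite_open_covers_def intro: finite_open_common_refinement)
  then show "\<exists>\<gamma>\<in>finite_open_covers Y B. refined_by \<alpha> \<gamma> \<and> refined_by \<beta> \<gamma>"
    using refined_by_common_refinement by blast
qed

lemma family_system_border_covers:
  assumes "A \<subseteq> topspace X"
  shows "family_system (border_covers X A)"
proof
  have "Family {0} {0} (\<lambda>v\<in>{0}. topspace X) \<in> border_covers X A"
    using assms by (auto simp: border_covers_def finite_open_family_def intro!: exI[of _ "{}"])
  then show "border_covers X A \<noteq> {}"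
    by blast
  show "dverts \<alpha> \<subseteq> verts \<alpha>" if "\<alpha> \<in> border_covers X A" for \<alpha>
    using that by (auto simp: border_covers_def finite_open_family_def)
  fix \<alpha> \<beta> assume *: "\<alpha> \<in> border_covers X A" "\<beta> \<in> border_covers X A"
  then obtain K L where K: "compactin X K" "topspace X - K = (\<Union>v\<in>verts \<alpha>. part \<alpha> v)"
      "A - K \<subseteq> (\<Union>v\<in>dverts \<alpha>. part \<alpha> v)"
    and L: "compactin X L" "topspace X - L = (\<Union>v\<in>verts \<beta>. part \<beta> v)"
      "A - L \<subseteq> (\<Union>v\<in>dverts \<beta>. part \<beta> v)"
    by (auto simp: border_covers_def)
  have fin: "finite_open_family X \<alpha>" "finite_open_family X \<beta>"
    using * by (auto simp: border_covers_def)
  then have d: "dverts \<alpha> \<subseteq> verts \<alpha>" "dverts \<beta> \<subseteq> verts \<beta>"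
    by (auto simp: finite_open_family_def)
  have "compactin X (K \<union> L)"
    using K L by (intro compactin_Un)
  moreover have "topspace X - (K \<union> L) = (topspace X - K) \<inter> (topspace X - L)"
    by blast
  moreover have "A - (K \<union> L) \<subseteq> (\<Union>v\<in>dverts \<alpha>. part \<alpha> v) \<inter> (\<Union>v\<in>dverts \<beta>. part \<beta> v)"
    using K(3) L(3) by blast
  ultimately have "common_refinement \<alpha> \<beta> \<in> border_covers X A"
    unfolding border_covers_def mem_Collect_eq common_refinement_simps
      Union_common_refinement[OF d] Union_common_refinement[OF order_refl order_refl]
    using finite_open_common_refinement[OF fin] K(2) L(2) by metis
  then show "\<exists>\<gamma>\<in>border_covers X A. refined_by \<alpha> \<gamma> \<and> refined_by \<beta> \<gamma>"
    using refined_by_common_refinement by blast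
qed

section \<open>Removing a compact set from the members of a cover\<close>

lemma openin_carrier_of:
  assumes "finite_open_family X \<alpha>" "finite s" "s \<noteq> {}" "s \<subseteq> verts \<alpha>"
  shows "openin X (carrier_of \<alpha> s)"
  unfolding carrier_of_def using assms by (intro openin_Inter) (auto simp: finite_open_family_def)

text \<open>Indices of members that become empty are kept, and the member function stays
  extensional. So removing a compact set leaves the family of traces literally unchanged.\<close>

definition remove_set :: "('v, 'a) family \<Rightarrow> 'a set \<Rightarrow> ('v, 'a) family"
  where "remove_set \<alpha> M = Family (verts \<alpha>) (dverts \<alpha>) (\<lambda>v\<in>verts \<alpha>. part \<alpha> v - M)"

lemma remove_set_simps [simp]:
  "verts (remove_set \<alpha> M) = verts \<alpha>" "dverts (remove_set \<alpha> M) = dverts \<alpha>"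
  "v \<in> verts \<alpha> \<Longrightarrow> part (remove_set \<alpha> M) v = part \<alpha> v - M"
  by (simp_all add: remove_set_def)

lemma carrier_of_remove_set:
  "s \<subseteq> verts \<alpha> \<Longrightarrow> s \<noteq> {} \<Longrightarrow> carrier_of (remove_set \<alpha> M) s = carrier_of \<alpha> s - M"
  by (fastforce simp: carrier_of_def)

lemma refinement_projection_remove_set: "refinement_projection \<alpha> (remove_set \<alpha> M) (\<lambda>v. v)"
  by (auto simp: refinement_projection_def)

lemma nerve_remove_set: "nerve (remove_set \<alpha> M) \<subseteq> nerve \<alpha>"
proof
  fix s assume "s \<in> nerve (remove_set \<alpha> M)"
  then show "s \<in> nerve \<alpha>"
    using carrier_of_remove_set[of s \<alpha> M] by (simp add: nerve_def) blast
qed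

lemma subnerve_remove_set:
  assumes "dverts \<alpha> \<subseteq> verts \<alpha>"
  shows "subnerve A (remove_set \<alpha> M) \<subseteq> subnerve A \<alpha>"
proof
  fix s assume s: "s \<in> subnerve A (remove_set \<alpha> M)"
  then have "s \<subseteq> verts \<alpha>"
    using assms by (auto simp: subnerve_def)
  then show "s \<in> subnerve A \<alpha>"
    using s carrier_of_remove_set[of s \<alpha> M] by (simp add: subnerve_def) blast
qed

lemma remove_set_border_covers:
  assumes X: "Hausdorff_space X" and \<alpha>: "\<alpha> \<in> border_covers X A" and M: "compactin X M"
  shows "remove_set \<alpha> M \<in> border_covers X A"
proof -
  obtain K where K: "compactin X K" "topspace X - K = (\<Union>v\<in>verts \<alpha>. part \<alpha> v)"
      "A - K \<subseteq> (\<Union>v\<in>dverts \<alpha>. part \<alpha> v)"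
    using \<alpha> by (auto simp: border_covers_def)
  have fin: "finite_open_family X \<alpha>"
    using \<alpha> by (auto simp: border_covers_def)
  then have d: "dverts \<alpha> \<subseteq> verts \<alpha>"
    by (simp add: finite_open_family_def)
  have "finite_open_family X (remove_set \<alpha> M)"
    using fin compactin_imp_closedin[OF X M]
    by (auto simp: finite_open_family_def remove_set_def intro!: openin_diff)
  moreover have "compactin X (K \<union> M)"
    using K M by (intro compactin_Un)
  moreover have "topspace X - (K \<union> M) = (\<Union>v\<in>verts \<alpha>. part (remove_set \<alpha> M) v)"
    using K(2) by auto
  moreover have "A - (K \<union> M) \<subseteq> (\<Union>v\<in>dverts \<alpha>. part (remove_set \<alpha> M) v)"
    using K(3) d by (fastforce simp: subset_iff)
  ultimately show ?thesis
    by (auto simp: border_covers_def)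
qed

section \<open>Traces of border covers as covers of the remainder\<close>

locale compactification_pair = compactification X P e
  for X :: "'a topology" and P :: "'b topology" and e +
  fixes A :: "'a set"
  assumes closed: "closedin X A"
begin

abbreviation "R \<equiv> subtopology P remainder"

abbreviation "B \<equiv> clo A - e ` A"

lemma A_subset: "A \<subseteq> topspace X"
  using closed by (rule closedin_subset)

lemma B_eq: "B = clo A \<inter> remainder"
  using clo_Int_image[OF closed] clo_subset[of A] by (auto simp: remainder_def)

lemma topspace_R: "topspace R = remainder"
  by (auto simp: remainder_def)

definition trace_family :: "(nat, 'a) family \<Rightarrow> (nat, 'b) family"
  where "trace_family \<alpha> = Family (verts \<alpha>) (dverts \<alpha>) (\<lambda>v\<in>verts \<alpha>. remainder_trace (part \<alpha> v))"

lemma trace_family_simps [simp]: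
  "verts (trace_family \<alpha>) = verts \<alpha>" "dverts (trace_family \<alpha>) = dverts \<alpha>"
  "v \<in> verts \<alpha> \<Longrightarrow> part (trace_family \<alpha>) v = remainder_trace (part \<alpha> v)"
  by (simp_all add: trace_family_def)

lemma carrier_of_trace_family:
  assumes "finite s" "s \<noteq> {}" "s \<subseteq> verts \<alpha>"
  shows "carrier_of (trace_family \<alpha>) s = remainder_trace (carrier_of \<alpha> s)"
proof -
  have "carrier_of (trace_family \<alpha>) s = (\<Inter>v\<in>s. remainder_trace (part \<alpha> v))"
    unfolding carrier_of_def using assms by (intro INF_cong) auto
  then show ?thesis
    unfolding carrier_of_def using trace_INT[OF assms(1,2)] by simp
qed

text \<open>The inclusion can be strict, because a nonempty carrier with compact closure has an
  empty trace.\<close>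

lemma nerve_trace_family: "nerve (trace_family \<alpha>) \<subseteq> nerve \<alpha>"
proof
  fix s assume "s \<in> nerve (trace_family \<alpha>)"
  then show "s \<in> nerve \<alpha>"
    using carrier_of_trace_family[of s \<alpha>] trace_nonempty[of "carrier_of \<alpha> s"] by (simp add: nerve_def)
qed

lemma subnerve_trace_family:
  assumes "dverts \<alpha> \<subseteq> verts \<alpha>"
  shows "subnerve B (trace_family \<alpha>) \<subseteq> subnerve A \<alpha>"
proof
  fix s assume s: "s \<in> subnerve B (trace_family \<alpha>)"
  then have "remainder_trace (carrier_of \<alpha> s) \<inter> clo A \<noteq> {}"
    using assms carrier_of_trace_family[of s \<alpha>] by (auto simp: subnerve_def)
  then show "s \<in> subnerve A \<alpha>"
    using s trace_meets[of "carrier_of \<alpha> s" A] A_subset by (auto simp: subnerve_def)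
qed

lemma trace_family_remove_set: "compactin X M \<Longrightarrow> trace_family (remove_set \<alpha> M) = trace_family \<alpha>"
  by (simp add: trace_family_def remove_set_def trace_diff_compact cong: restrict_cong)

lemma trace_family_cover:
  assumes \<alpha>: "\<alpha> \<in> border_covers X A"
  shows "trace_family \<alpha> \<in> finite_open_covers R B"
proof -
  obtain K where K: "compactin X K" "topspace X - K = (\<Union>v\<in>verts \<alpha>. part \<alpha> v)"
      "A - K \<subseteq> (\<Union>v\<in>dverts \<alpha>. part \<alpha> v)"
    using \<alpha> by (auto simp: border_covers_def)
  have fin: "finite (verts \<alpha>)" "\<And>v. v \<in> verts \<alpha> \<Longrightarrow> openin X (part \<alpha> v)" and d: "dverts \<alpha> \<subseteq> verts \<alpha>"
    using \<alpha> by (auto simp: border_covers_def finite_open_family_def)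
  have "finite_open_family R (trace_family \<alpha>)"
    using fin d openin_trace by (auto simp: finite_open_family_def trace_family_def)
  moreover have "(\<Union>v\<in>verts \<alpha>. remainder_trace (part \<alpha> v)) = remainder"
  proof
    have "topspace X \<subseteq> K \<union> (\<Union>v\<in>verts \<alpha>. part \<alpha> v)"
      using K(2) by blast
    then have "clo (topspace X) \<inter> remainder \<subseteq> (\<Union>v\<in>verts \<alpha>. remainder_trace (part \<alpha> v))"
      by (intro trace_cover[OF _ _ closedin_topspace K(1)] fin)
    then show "remainder \<subseteq> (\<Union>v\<in>verts \<alpha>. remainder_trace (part \<alpha> v))"
      using remainder_subset_clo by (simp add: Int_absorb1)
  qed (use trace_subset in blast)
  moreover have "B \<subseteq> (\<Union>v\<in>dverts \<alpha>. remainder_trace (part \<alpha> v))"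
    unfolding B_eq using K(3) fin d
    by (intro trace_cover[OF _ _ closed K(1)]) (auto dest: finite_subset)
  ultimately show ?thesis
    using d by (auto simp: finite_open_covers_def topspace_R subset_iff simp del: topspace_subtopology)
qed

text \<open>These are the covers for which passing to traces loses no simplex; they play the role of
  \<open>N\<close> in \<open>cover_comparison\<close>.\<close>

definition reduced_covers :: "(nat, 'a) family set"
  where "reduced_covers = {\<alpha> \<in> border_covers X A.
    nerve (trace_family \<alpha>) = nerve \<alpha> \<and> subnerve B (trace_family \<alpha>) = subnerve A \<alpha>}"

text \<open>Removal can only shrink the nerve, yet the nerve still contains that of the unchanged
  traces, which is the original nerve. So nothing shrinks, and the same holds for the
  subnerve.\<close>

lemma reduced_covers_remove_set:
  assumes \<alpha>: "\<alpha> \<in> reduced_covers" and M: "compactin X M"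
  shows "remove_set \<alpha> M \<in> reduced_covers"
proof -
  have d: "dverts \<alpha> \<subseteq> verts \<alpha>"
    using \<alpha> by (auto simp: reduced_covers_def border_covers_def finite_open_family_def)
  have "nerve (trace_family (remove_set \<alpha> M)) = nerve (remove_set \<alpha> M)"
    using nerve_trace_family[of "remove_set \<alpha> M"] nerve_remove_set[of \<alpha> M] \<alpha>
    by (auto simp: trace_family_remove_set[OF M] reduced_covers_def)
  moreover have "subnerve B (trace_family (remove_set \<alpha> M)) = subnerve A (remove_set \<alpha> M)"
    using subnerve_trace_family[of "remove_set \<alpha> M"] subnerve_remove_set[OF d, of A M] \<alpha> d
    by (auto simp: trace_family_remove_set[OF M] reduced_covers_def)
  ultimately show ?thesis
    using \<alpha> remove_set_border_covers[OF Hausdorff_X _ M] by (auto simp: reduced_covers_def)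
qed

lemma trace_carrier_meets:
  assumes "finite_open_family X \<alpha>" "finite s" "s \<noteq> {}" "s \<subseteq> verts \<alpha>" "C \<subseteq> topspace X"
    and "\<not> compactin X (X closure_of (carrier_of \<alpha> s \<inter> C))"
  shows "remainder_trace (carrier_of \<alpha> s) \<inter> (clo C \<inter> remainder) \<noteq> {}"
proof -
  have o: "openin X (carrier_of \<alpha> s)"
    using assms by (intro openin_carrier_of)
  obtain y where "y \<in> remainder" "\<And>U. openin X U \<Longrightarrow> carrier_of \<alpha> s \<inter> C \<subseteq> U \<Longrightarrow> y \<in> remainder_trace U"
    "\<And>D. carrier_of \<alpha> s \<inter> C \<subseteq> D \<Longrightarrow> y \<in> clo D"
    using noncompact_closure_meets_remainder[of "carrier_of \<alpha> s \<inter> C"] assms(5,6) by blast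
  then have "y \<in> remainder_trace (carrier_of \<alpha> s) \<inter> (clo C \<inter> remainder)"
    using o by blast
  then show ?thesis
    by blast
qed

text \<open>Removing the finitely many relatively compact carriers leaves a cover in which every simplex
  of the nerve is seen by the remainder.\<close>

lemma remove_set_reduced:
  assumes \<alpha>: "\<alpha> \<in> border_covers X A"
  obtains M where "compactin X M" "remove_set \<alpha> M \<in> reduced_covers"
proof -
  have fin: "finite_open_family X \<alpha>"
    using \<alpha> by (simp add: border_covers_def)
  then have fv: "finite (verts \<alpha>)" and d: "dverts \<alpha> \<subseteq> verts \<alpha>"
    by (auto simp: finite_open_family_def)
  \<comment> \<open>\<open>C = topspace X\<close> serves the nerve and \<open>C = A\<close> the
    subnerve: the part of a carrier in \<open>A\<close> may be relatively compact although the
    carrier is not.\<close>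
  define \<S> where "\<S> = {S \<in> (\<lambda>(s, C). carrier_of \<alpha> s \<inter> C) ` (Pow (verts \<alpha>) \<times> {topspace X, A}).
    compactin X (X closure_of S)}"
  define M where "M = \<Union>((\<lambda>S. X closure_of S) ` \<S>)"
  have "finite \<S>"
    using fv by (simp add: \<S>_def)
  then have M: "compactin X M"
    unfolding M_def by (intro compactin_Union) (auto simp: \<S>_def)
  have meets: "remainder_trace (carrier_of \<alpha> s) \<inter> (clo C \<inter> remainder) \<noteq> {}"
    if s: "finite s" "s \<noteq> {}" "s \<subseteq> verts \<alpha>" and C: "C \<in> {topspace X, A}"
      and ne: "(carrier_of \<alpha> s - M) \<inter> C \<noteq> {}" for s C
  proof (rule trace_carrier_meets[OF fin s])
    show CX: "C \<subseteq> topspace X"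
      using C A_subset by blast
    show "\<not> compactin X (X closure_of (carrier_of \<alpha> s \<inter> C))"
    proof
      assume "compactin X (X closure_of (carrier_of \<alpha> s \<inter> C))"
      then have "carrier_of \<alpha> s \<inter> C \<in> \<S>"
        using s C by (auto simp: \<S>_def intro!: image_eqI[of _ _ "(s, C)"])
      then have "X closure_of (carrier_of \<alpha> s \<inter> C) \<subseteq> M"
        by (auto simp: M_def)
      moreover have "carrier_of \<alpha> s \<inter> C \<subseteq> X closure_of (carrier_of \<alpha> s \<inter> C)"
        using CX by (intro closure_of_subset) blast
      ultimately show False
        using ne by blast
    qed
  qed
  have "nerve (remove_set \<alpha> M) \<subseteq> nerve (trace_family \<alpha>)"
  proof
    fix s assume s: "s \<in> nerve (remove_set \<alpha> M)"
    then have s': "finite s" "s \<noteq> {}" "s \<subseteq> verts \<alpha>"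
      by (auto simp: nerve_def)
    then have "(carrier_of \<alpha> s - M) \<inter> topspace X \<noteq> {}"
      using s openin_subset[OF openin_carrier_of[OF fin s']]
      by (auto simp: nerve_def carrier_of_remove_set)
    then show "s \<in> nerve (trace_family \<alpha>)"
      using s' meets[OF s', of "topspace X"] by (auto simp: nerve_def carrier_of_trace_family)
  qed
  then have "nerve (trace_family (remove_set \<alpha> M)) = nerve (remove_set \<alpha> M)"
    using nerve_trace_family[of "remove_set \<alpha> M"] by (auto simp: trace_family_remove_set[OF M])
  moreover have "subnerve A (remove_set \<alpha> M) \<subseteq> subnerve B (trace_family \<alpha>)"
  proof
    fix s assume s: "s \<in> subnerve A (remove_set \<alpha> M)"
    then have s': "finite s" "s \<noteq> {}" "s \<subseteq> verts \<alpha>" "s \<subseteq> dverts \<alpha>"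
      using d by (auto simp: subnerve_def)
    then have "(carrier_of \<alpha> s - M) \<inter> A \<noteq> {}"
      using s by (auto simp: subnerve_def carrier_of_remove_set)
    then show "s \<in> subnerve B (trace_family \<alpha>)"
      unfolding B_eq using s' meets[OF s'(1-3), of A] by (auto simp: subnerve_def carrier_of_trace_family)
  qed
  then have "subnerve B (trace_family (remove_set \<alpha> M)) = subnerve A (remove_set \<alpha> M)"
    using subnerve_trace_family[of "remove_set \<alpha> M"] d by (auto simp: trace_family_remove_set[OF M])
  ultimately have "remove_set \<alpha> M \<in> reduced_covers"
    using remove_set_border_covers[OF Hausdorff_X \<alpha> M] by (simp add: reduced_covers_def)
  then show thesis
    using that M by blast
qed

lemma reduced_covers_cofinal: "cofinal_in (border_covers X A) refined_by reduced_covers"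
  unfolding cofinal_in_def
proof (intro conjI ballI)
  show "reduced_covers \<subseteq> border_covers X A"
    by (auto simp: reduced_covers_def)
  fix \<alpha> assume "\<alpha> \<in> border_covers X A"
  then obtain M where "remove_set \<alpha> M \<in> reduced_covers"
    using remove_set_reduced by blast
  then show "\<exists>c\<in>reduced_covers. refined_by \<alpha> c"
    using refinement_projection_remove_set unfolding refined_by_def by blast
qed

lemma trace_family_projection:
  assumes "refinement_projection \<alpha> \<beta> p"
  shows "refinement_projection (trace_family \<alpha>) (trace_family \<beta>) p"
  using assms trace_mono by (auto simp: refinement_projection_def image_subset_iff)

text \<open>If \<open>p\<close> is a projection between the traces, then by
  \<open>compact_closure_diff\<close> each member of \<open>\<beta>\<close> lies in the
  corresponding member of \<open>\<alpha>\<close> up to a relatively compact set. After removing the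
  closures of these finitely many sets from \<open>\<beta>\<close>, the same \<open>p\<close> is a
  projection to \<open>\<alpha>\<close>.\<close>

lemma trace_family_lift:
  assumes \<alpha>: "\<alpha> \<in> reduced_covers" and \<beta>: "\<beta> \<in> reduced_covers"
    and ref: "refined_by (trace_family \<alpha>) (trace_family \<beta>)"
  shows "\<exists>\<gamma>\<in>reduced_covers. refined_by \<alpha> \<gamma> \<and> refined_by \<beta> \<gamma> \<and> trace_family \<gamma> = trace_family \<beta>"
proof -
  obtain p where p: "refinement_projection (trace_family \<alpha>) (trace_family \<beta>) p"
    using ref by (auto simp: refined_by_def)
  have fin: "finite_open_family X \<alpha>" "finite_open_family X \<beta>"
    using \<alpha> \<beta> by (auto simp: reduced_covers_def border_covers_def)
  define M where "M = (\<Union>v\<in>verts \<beta>. X closure_of (part \<beta> v - part \<alpha> (p v)))"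
  have M: "compactin X M"
    unfolding M_def
  proof (intro compactin_Union)
    show "finite ((\<lambda>v. X closure_of (part \<beta> v - part \<alpha> (p v))) ` verts \<beta>)"
      using fin by (simp add: finite_open_family_def)
    fix S assume "S \<in> (\<lambda>v. X closure_of (part \<beta> v - part \<alpha> (p v))) ` verts \<beta>"
    then obtain v where v: "v \<in> verts \<beta>" "S = X closure_of (part \<beta> v - part \<alpha> (p v))"
      by blast
    have "p v \<in> verts \<alpha>"
      using p v by (auto simp: refinement_projection_def)
    moreover from this have "remainder_trace (part \<beta> v) \<subseteq> remainder_trace (part \<alpha> (p v))"
      using p v unfolding refinement_projection_def by (metis trace_family_simps(1,3))
    ultimately show "compactin X S"
      unfolding v(2) using fin v(1) by (intro compact_closure_diff) (auto simp: finite_open_family_def)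
  qed
  have "refinement_projection \<alpha> (remove_set \<beta> M) p"
    unfolding refinement_projection_def
  proof (intro conjI ballI)
    show "p ` verts (remove_set \<beta> M) \<subseteq> verts \<alpha>" "p ` dverts (remove_set \<beta> M) \<subseteq> dverts \<alpha>"
      using p by (auto simp: refinement_projection_def)
    fix v assume v: "v \<in> verts (remove_set \<beta> M)"
    then have "part \<beta> v \<subseteq> topspace X"
      using fin(2) openin_subset[of X "part \<beta> v"] by (simp add: finite_open_family_def)
    then have "part \<beta> v - part \<alpha> (p v) \<subseteq> X closure_of (part \<beta> v - part \<alpha> (p v))"
      by (intro closure_of_subset) blast
    also have "\<dots> \<subseteq> M"
      using v by (auto simp: M_def)
    finally show "part (remove_set \<beta> M) v \<subseteq> part \<alpha> (p v)"
      using v by auto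
  qed
  then show ?thesis
    using reduced_covers_remove_set[OF \<beta> M] refinement_projection_remove_set trace_family_remove_set[OF M]
    unfolding refined_by_def by blast
qed

lemma compact_in_image:
  assumes "closedin P K" "K \<subseteq> e ` topspace X"
  obtains K' where "compactin X K'" "K = e ` K'"
proof -
  obtain K' where K': "K' \<subseteq> topspace X" "K = e ` K'"
    using assms(2) by (meson subset_imageE)
  have "compactin P (e ` K')"
    using closedin_compact_space[OF compact assms(1)] K' by simp
  then have "compactin (subtopology P (e ` topspace X)) (e ` K')"
    using K' by (auto simp: compactin_subtopology)
  then have "compactin X K'"
    using homeomorphic_map_compactness[OF homeomorphism K'(1)] by simp
  then show thesis
    using that K' by blast
qed

text \<open>Here metrizability of \<open>X\<close> enters a second time: the complement \<open>Z\<close> of a compact subset of \<open>X\<close>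
  in \<open>P\<close> is normal, so that open sets of \<open>P\<close> inducing the given cover can be shrunk in \<open>Z\<close>.\<close>

lemma trace_family_refines:
  assumes \<delta>: "\<delta> \<in> finite_open_covers R B"
  obtains \<alpha> where "\<alpha> \<in> border_covers X A" "refinement_projection \<delta> (trace_family \<alpha>) (\<lambda>v. v)"
proof -
  have fv: "finite (verts \<delta>)" and d: "dverts \<delta> \<subseteq> verts \<delta>"
    and op: "\<And>v. v \<in> verts \<delta> \<Longrightarrow> openin R (part \<delta> v)"
    and cov: "(\<Union>v\<in>verts \<delta>. part \<delta> v) = remainder" and covB: "B \<subseteq> (\<Union>v\<in>dverts \<delta>. part \<delta> v)"
    using \<delta> unfolding finite_open_covers_def finite_open_family_def topspace_R by auto
  have "\<forall>v\<in>verts \<delta>. \<exists>W. openin P W \<and> part \<delta> v = W \<inter> remainder"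
    using op by (auto simp: openin_subtopology)
  then obtain W where W: "\<And>v. v \<in> verts \<delta> \<Longrightarrow> openin P (W v)"
    "\<And>v. v \<in> verts \<delta> \<Longrightarrow> part \<delta> v = W v \<inter> remainder"
    by metis
  \<comment> \<open>These are the points where the \<open>W v\<close> fail to be a cover of the pair
    formed by \<open>P\<close> and \<open>clo A\<close>. The given cover leaves no such point in the
    remainder, so this closed set is the image of a compact subset of \<open>X\<close>.\<close>
  define L where "L = (topspace P - (\<Union>v\<in>verts \<delta>. W v)) \<union> (clo A - (\<Union>v\<in>dverts \<delta>. W v))"
  have "openin P (\<Union>v\<in>verts \<delta>. W v)" "openin P (\<Union>v\<in>dverts \<delta>. W v)"
    using W d by (auto intro!: openin_Union)
  then have "closedin P L"
    unfolding L_def using closedin_clo[of A] by (intro closedin_Un closedin_diff) auto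
  moreover have "L \<subseteq> e ` topspace X"
  proof
    fix y assume y: "y \<in> L"
    show "y \<in> e ` topspace X"
    proof (rule ccontr)
      assume "y \<notin> e ` topspace X"
      then have r: "y \<in> remainder"
        using y clo_subset[of A] by (auto simp: L_def remainder_def)
      then have "y \<in> (\<Union>v\<in>verts \<delta>. W v)"
        using cov W(2) by fastforce
      then have "y \<in> clo A" "y \<notin> (\<Union>v\<in>dverts \<delta>. W v)"
        using y by (auto simp: L_def)
      then have "y \<in> B"
        using r by (simp add: B_eq)
      then show False
        using covB W(2) d \<open>y \<notin> (\<Union>v\<in>dverts \<delta>. W v)\<close> by blast
    qed
  qed
  ultimately obtain K where K: "compactin X K" "L = e ` K"
    by (rule compact_in_image)
  define Z where "Z = subtopology P (topspace P - L)"
  have Z: "normal_space Z"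
    unfolding Z_def K(2) by (rule normal_space_diff_compact[OF K(1)])
  have tZ: "topspace Z = topspace P - L"
    by (auto simp: Z_def)
  have openZ: "openin P U" if "openin Z U" for U
    using that \<open>closedin P L\<close> unfolding Z_def by (meson openin_diff openin_topspace openin_trans_full)
  define W' where "W' = (\<lambda>v. W v - L)"
  have W': "openin Z (W' v)" if "v \<in> verts \<delta>" for v
  proof -
    have "W' v = W v \<inter> (topspace P - L)"
      using openin_subset[OF W(1)[OF that]] by (auto simp: W'_def)
    then show ?thesis
      unfolding Z_def openin_subtopology using W(1)[OF that] by blast
  qed
  have sub: "topspace Z \<subseteq> (\<Union>v\<in>verts \<delta>. W' v)"
    by (auto simp: tZ W'_def L_def)
  have "\<exists>V. (\<forall>v\<in>verts \<delta>. openin Z (V v) \<and> Z closure_of V v \<subseteq> W' v) \<and>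
      topspace Z \<subseteq> (\<Union>v\<in>verts \<delta>. V v)"
    by (intro normal_space_shrinking[OF Z] fv W' closedin_topspace sub)
  then obtain V where V0: "\<forall>v\<in>verts \<delta>. openin Z (V v) \<and> Z closure_of V v \<subseteq> W' v"
    and Vcover: "topspace Z \<subseteq> (\<Union>v\<in>verts \<delta>. V v)"
    by (elim exE conjE)
  have V: "openin Z (V v)" "Z closure_of V v \<subseteq> W' v" if "v \<in> verts \<delta>" for v
    using V0 that by auto
  have "closedin Z (clo A - L)"
    unfolding Z_def using closedin_clo[of A] clo_subset[of A]
    by (auto simp: closedin_subtopology)
  moreover have "clo A - L \<subseteq> (\<Union>v\<in>dverts \<delta>. W' v)"
    by (auto simp: W'_def L_def)
  moreover have "finite (dverts \<delta>)" "\<And>v. v \<in> dverts \<delta> \<Longrightarrow> openin Z (W' v)"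
    using fv d W' finite_subset by blast+
  ultimately have "\<exists>V'. (\<forall>v\<in>dverts \<delta>. openin Z (V' v) \<and> Z closure_of V' v \<subseteq> W' v) \<and>
      clo A - L \<subseteq> (\<Union>v\<in>dverts \<delta>. V' v)"
    by (intro normal_space_shrinking[OF Z])
  then obtain V' where V'0: "\<forall>v\<in>dverts \<delta>. openin Z (V' v) \<and> Z closure_of V' v \<subseteq> W' v"
    and V'cover: "clo A - L \<subseteq> (\<Union>v\<in>dverts \<delta>. V' v)"
    by (elim exE conjE)
  have V': "openin Z (V' v)" "Z closure_of V' v \<subseteq> W' v" if "v \<in> dverts \<delta>" for v
    using V'0 that by auto
  \<comment> \<open>The shrinking must cover \<open>Z\<close>, and its distinguished members must in
    addition cover the part of \<open>clo A\<close> in \<open>Z\<close>. Two shrinkings are made for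
    the two purposes and united.\<close>
  define T where "T = (\<lambda>v. if v \<in> dverts \<delta> then V v \<union> V' v else V v)"
  have T: "openin Z (T v)" "Z closure_of T v \<subseteq> W' v" if "v \<in> verts \<delta>" for v
    using that V V' by (auto simp: T_def)
  have TZ: "T v \<subseteq> topspace P - L" if "v \<in> verts \<delta>" for v
    using openin_subset[OF T(1)[OF that]] tZ by simp
  define \<alpha> where "\<alpha> = Family (verts \<delta>) (dverts \<delta>) (\<lambda>v\<in>verts \<delta>. {x \<in> topspace X. e x \<in> T v})"
  have KX: "K \<subseteq> topspace X"
    using K(1) by (rule compactin_subset_topspace)
  have eK: "e x \<in> L \<longleftrightarrow> x \<in> K" if "x \<in> topspace X" for x
    using that KX inj_e unfolding K(2) by (auto simp: inj_on_def)
  have "\<alpha> \<in> border_covers X A"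
  proof -
    have "finite_open_family X \<alpha>"
      using fv d openin_continuous_map_preimage[OF continuous_e openZ[OF T(1)]]
      by (auto simp: finite_open_family_def \<alpha>_def)
    moreover have "topspace X - K = (\<Union>v\<in>verts \<alpha>. part \<alpha> v)"
    proof
      show "topspace X - K \<subseteq> (\<Union>v\<in>verts \<alpha>. part \<alpha> v)"
      proof
        fix x assume x: "x \<in> topspace X - K"
        then have "e x \<in> topspace Z"
          using eK e_in by (auto simp: tZ)
        then obtain v where "v \<in> verts \<delta>" "e x \<in> V v"
          using Vcover by blast
        then show "x \<in> (\<Union>v\<in>verts \<alpha>. part \<alpha> v)"
          using x by (auto simp: \<alpha>_def T_def intro!: bexI[of _ v])
      qed
      show "(\<Union>v\<in>verts \<alpha>. part \<alpha> v) \<subseteq> topspace X - K"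
        using TZ eK by (fastforce simp: \<alpha>_def)
    qed
    moreover have "A - K \<subseteq> (\<Union>v\<in>dverts \<alpha>. part \<alpha> v)"
    proof
      fix x assume x: "x \<in> A - K"
      then have "e x \<in> clo A - L"
        using eK subset_clo[OF A_subset] A_subset by blast
      then obtain v where "v \<in> dverts \<delta>" "e x \<in> V' v"
        using V'cover by blast
      then show "x \<in> (\<Union>v\<in>dverts \<alpha>. part \<alpha> v)"
        using x d A_subset by (auto simp: \<alpha>_def T_def intro!: bexI[of _ v])
    qed
    ultimately show ?thesis
      using K(1) unfolding border_covers_def by blast
  qed
  moreover have "refinement_projection \<delta> (trace_family \<alpha>) (\<lambda>v. v)"
    unfolding refinement_projection_def
  proof (intro conjI ballI)
    fix v assume "v \<in> verts (trace_family \<alpha>)"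
    then have v: "v \<in> verts \<delta>"
      by (simp add: \<alpha>_def)
    let ?U = "{x \<in> topspace X. e x \<in> T v}"
    \<comment> \<open>The trace of the preimage is controlled only by the closure of
      \<open>T v\<close>: a point of the trace avoids the closure of the complement of
      \<open>?U\<close>, hence lies in that of \<open>?U\<close>. The shrinking keeps this closure,
      taken in \<open>Z\<close>, inside \<open>W v\<close>.\<close>
    have "remainder_trace ?U \<subseteq> part \<delta> v"
    proof
      fix y assume y: "y \<in> remainder_trace ?U"
      then have r: "y \<in> remainder" and "y \<notin> clo (topspace X - ?U)"
        by (auto simp: remainder_trace_def)
      moreover have "topspace X = (topspace X - ?U) \<union> ?U"
        by blast
      ultimately have "y \<in> clo ?U"
        using remainder_subset_clo clo_Un by (metis (no_types, lifting) UnE subsetD)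
      moreover have "clo ?U \<subseteq> P closure_of T v"
        unfolding clo_def by (intro closure_of_mono) auto
      moreover have "y \<in> topspace P - L"
        using r \<open>L \<subseteq> e ` topspace X\<close> by (auto simp: remainder_def)
      moreover have "Z closure_of T v = (topspace P - L) \<inter> P closure_of T v"
        unfolding Z_def closure_of_subtopology using TZ[OF v] by (simp add: Int_absorb1)
      ultimately have "y \<in> W v"
        using T(2)[OF v] by (auto simp: W'_def)
      then show "y \<in> part \<delta> v"
        using W(2)[OF v] r by simp
    qed
    then show "part (trace_family \<alpha>) v \<subseteq> part \<delta> v"
      using v by (simp add: \<alpha>_def)
  qed (auto simp: \<alpha>_def)
  ultimately show thesis
    by (rule that)
qed

lemma trace_family_cofinal: "cofinal_in (finite_open_covers R B) refined_by (trace_family ` reduced_covers)"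
  unfolding cofinal_in_def
proof (intro conjI ballI)
  show "trace_family ` reduced_covers \<subseteq> finite_open_covers R B"
    using trace_family_cover by (auto simp: reduced_covers_def)
  fix \<delta> assume "\<delta> \<in> finite_open_covers R B"
  then obtain \<alpha> where \<alpha>: "\<alpha> \<in> border_covers X A" "refinement_projection \<delta> (trace_family \<alpha>) (\<lambda>v. v)"
    by (rule trace_family_refines)
  obtain M where M: "compactin X M" "remove_set \<alpha> M \<in> reduced_covers"
    using remove_set_reduced[OF \<alpha>(1)] .
  have "refined_by \<delta> (trace_family (remove_set \<alpha> M))"
    using \<alpha>(2) by (auto simp: trace_family_remove_set[OF M(1)] refined_by_def)
  then show "\<exists>c\<in>trace_family ` reduced_covers. refined_by \<delta> c"
    using M(2) by blast
qed

sublocale cover_comparison "border_covers X A" "finite_open_covers R B" A B reduced_covers trace_family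
proof (intro cover_comparison.intro cover_comparison_axioms.intro)
  show "family_system (border_covers X A)"
    by (rule family_system_border_covers[OF A_subset])
  show "family_system (finite_open_covers R B)"
    by (rule family_system_finite_open_covers) (simp only: topspace_R B_eq Int_lower2)
qed (simp_all add: reduced_covers_cofinal trace_family_cofinal trace_family_projection trace_family_lift,
    simp_all add: reduced_covers_def)

end

section \<open>The Stone--Cech compactification\<close>

lemma compactification_stone_cech:
  assumes X: "metrizable_space X"
  shows "compactification X (stone_cech X) (sc_embed X)"
proof
  let ?S = "sc_cube X closure_of (sc_embed X ` topspace X)"
  have "compact_space (sc_cube X)"
    by (auto simp: sc_cube_def compact_space_product_topology compact_space_subtopology)
  then show "compact_space (stone_cech X)"
    unfolding stone_cech_def
    by (intro compact_space_subtopology closedin_compact_space) auto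
  have "Hausdorff_space (sc_cube X)"
    by (auto simp: sc_cube_def Hausdorff_space_product_topology Hausdorff_space_subtopology)
  then show "Hausdorff_space (stone_cech X)"
    unfolding stone_cech_def by (rule Hausdorff_space_subtopology)
  \<comment> \<open>The standard cube embedding takes its coordinates from the bounded continuous
    functions with values in the unit interval; boundedness is automatic there.\<close>
  have "mspace (submetric (cfunspace X euclidean_metric) {f. f \<in> topspace X \<rightarrow> {0..1::real}}) = unit_functions X"
  proof -
    have "bounded (f ` topspace X)" if "f \<in> topspace X \<rightarrow> {0..1::real}" for f
      by (rule bounded_subset[OF bounded_closed_interval]) (use that in blast)
    then show ?thesis
      by (auto simp: unit_functions_def continuous_map_in_subtopology)
  qed
  then have emb: "embedding_map X (sc_cube X) (sc_embed X)"
    using completely_regular_space_cube_embedding_explicit[OF metrizable_imp_completely_regular_space[OF X]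
        metrizable_imp_Hausdorff_space[OF X]]
    by (simp add: sc_cube_def sc_embed_def[abs_def])
  then have hom: "homeomorphic_map X (subtopology (sc_cube X) (sc_embed X ` topspace X)) (sc_embed X)"
    by (simp add: embedding_map_def)
  have im: "sc_embed X ` topspace X \<subseteq> topspace (sc_cube X)"
    using continuous_map_image_subset_topspace[OF homeomorphic_imp_continuous_map[OF hom]]
    by (simp add: topspace_subtopology)
  have sub: "sc_embed X ` topspace X \<subseteq> ?S"
    using im by (rule closure_of_subset)
  show "embedding_map X (stone_cech X) (sc_embed X)"
    using hom sub by (simp add: embedding_map_def stone_cech_def subtopology_subtopology Int_absorb1)
  show "stone_cech X closure_of (sc_embed X ` topspace X) = topspace (stone_cech X)"
    using sub closure_of_subset_topspace[of "sc_cube X"]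
    by (auto simp: stone_cech_def closure_of_subtopology Int_absorb1)
  show "stone_cech X closure_of (sc_embed X ` C) \<inter> stone_cech X closure_of (sc_embed X ` D) = {}"
    if C: "closedin X C" and D: "closedin X D" and CD: "C \<inter> D = {}" for C D
  proof -
    obtain f where f: "continuous_map X (top_of_set {0..1::real}) f" "f ` C \<subseteq> {0}" "f ` D \<subseteq> {1}"
      using Urysohn_lemma[OF metrizable_imp_normal_space[OF X] C D, of 0 1] CD by (auto simp: disjnt_def)
    \<comment> \<open>Coordinates of the cube are extensional functions, so the Urysohn function is
      restricted to become one. Projection to this coordinate extends it over the compactification,
      and the closures of \<open>C\<close> and \<open>D\<close> lie in its level sets at 0 and
      1.\<close>
    define g where "g = restrict f (topspace X)"
    have "continuous_map X (top_of_set {0..1::real}) g"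
      using f(1) by (rule continuous_map_eq) (simp add: g_def)
    then have g: "g \<in> unit_functions X"
      by (simp add: unit_functions_def g_def)
    have "continuous_map (sc_cube X) (top_of_set {0..1::real}) (\<lambda>y. y g)"
      unfolding sc_cube_def using g by (rule continuous_map_product_projection)
    then have "continuous_map (stone_cech X) euclideanreal (\<lambda>y. y g)"
      unfolding stone_cech_def by (simp add: continuous_map_from_subtopology continuous_map_in_subtopology)
    then have cl: "closedin (stone_cech X) {y \<in> topspace (stone_cech X). y g \<in> {c}}" for c
      by (rule closedin_continuous_map_preimage) simp
    have val: "sc_embed X x g = f x" if "x \<in> topspace X" for x
      using g that by (simp add: sc_embed_def g_def)
    have top: "sc_embed X x \<in> topspace (stone_cech X)" if "x \<in> topspace X" for x
      using that sub im by (auto simp: stone_cech_def)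
    have "stone_cech X closure_of (sc_embed X ` E) \<subseteq> {y \<in> topspace (stone_cech X). y g \<in> {c}}"
      if "closedin X E" "f ` E \<subseteq> {c}" for E c
      using that closedin_subset[OF that(1)] val top by (intro closure_of_minimal cl) blast
    from this[OF C f(2)] this[OF D f(3)] show ?thesis
      by fastforce
  qed
qed (rule X)

theorem theorem2p3:
  fixes X :: "'a topology" and A :: "'a set"
  assumes "metrizable_space X" and "closedin X A"
  shows "border_coh_cyclicity TYPE('g::ab_group_add) X A =
           coh_cyclicity TYPE('g) (sc_remainder X) (sc_remainder_of X A) \<and>
         border_hom_cyclicity TYPE('g) X A =
           hom_cyclicity TYPE('g) (sc_remainder X) (sc_remainder_of X A)"
proof -
  interpret compactification X "stone_cech X" "sc_embed X"
    by (rule compactification_stone_cech[OF assms(1)])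
  interpret compactification_pair X "stone_cech X" "sc_embed X" A
    by unfold_locales (rule assms(2))
  have R: "sc_remainder X = R" and B: "sc_remainder_of X A = B"
    by (simp_all add: sc_remainder_def remainder_def sc_remainder_of_def clo_def)
  show ?thesis
    unfolding border_coh_cyclicity_def coh_cyclicity_def border_hom_cyclicity_def hom_cyclicity_def R B
      border_cohomology_def finite_cech_cohomology_def border_homology_def finite_cech_homology_def
    by (intro conjI coefficient_of_cyclicity_cong trivial_cohomology_iff trivial_homology_iff)
qed

end
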